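(* There exists a universal constant $c>0$ (not depending on $n,d,G,\mu,\sigma,f$) such that the following holds. Let $n,d\ge 1$ be integers, let $\mu$ be a probability measure on an open set $G\subset\mathbb{R}^n$ satisfying a Poincaré-type inequality with constant $\sigma^2>0$ (where $\sigma>0$), and let $f\colon G\to\mathbb{R}$ be a $\mathcal{C}^d$-smooth function with $\int_G f\,d\mu=0$. Assume that $$\lVert f^{(k)}\rVert_{\mathrm{Op},2}\le\sigma^{d-k}\quad\text{for all }k=1,\ldots,d-1,\qquad\text{and}\qquad \lVert f^{(d)}\rVert_{\mathrm{Op},\infty}\le 1.$$ Then $$\int_G\exp\Big(\frac{c}{\sigma}\,|f|^{1/d}\Big)\,d\mu\le 2.$$
   Context: A Borel probability measure $\mu$ on an open set $G\subset\mathbb{R}^n$ satisfies a Poincaré-type inequality with constant $\sigma^2>0$ if for every bounded smooth function $g$ on $G$ with gradient $\nabla g$, $\mathrm{Var}_\mu(g)\le\sigma^2\int|\nabla g|^2\,d\mu$, where $\mathrm{Var}_\mu(g)=\int g^2\,d\mu-(\int g\,d\mu)^2$ and $|\cdot|$ is the Euclidean norm. The number $\sigma$ is always taken positive. For $f\in\mathcal{C}^d(G)$ and $1\le k\le d$, $f^{(k)}(x)$ is the (hyper-)matrix with entries $f^{(k)}_{i_1\ldots i_k}(x)=\partial_{i_1\ldots i_k}f(x)$, regarded as a symmetric multilinear $k$-form, and its operator norm is $|f^{(k)}(x)|_{\mathrm{Op}}=\sup\{f^{(k)}(x)[v_1,\ldots,v_k]\colon v_i\in\mathbb{R}^n,\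 |v_1|=\cdots=|v_k|=1\}$. For $p\in(0,\infty)$, $\lVert f^{(k)}\rVert_{\mathrm{Op},p}=\big(\int_G|f^{(k)}|_{\mathrm{Op}}^p\,d\mu\big)^{1/p}$, and $\lVert f^{(k)}\rVert_{\mathrm{Op},\infty}$ is the $L^\infty(\mu)$-norm of $|f^{(k)}|_{\mathrm{Op}}$. *)

theory Defs
  imports "HOL-Analysis.Analysis" "HOL-Probability.Probability"
begin

text \<open>
  Dimension-free statements need the dimension \<^term>\<open>n\<close> as a term, not as a type. The space
  \<open>\<real>\<^sup>n\<close> is therefore \<^term>\<open>Euclidean_space n\<close>, whose points are the sequences
  \<open>x :: nat \<Rightarrow> real\<close> with \<^prop>\<open>x i = 0\<close> for all \<^prop>\<open>i \<ge> n\<close>. Its topology is induced from the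
  function type, so \<^const>\<open>continuous_on\<close> and \<^const>\<open>borel\<close> have their usual meaning on subsets.
  A function on an open set \<open>G\<close> is a total function whose values outside \<open>G\<close> are never used.
\<close>

definition euclidean_norm :: "nat \<Rightarrow> (nat \<Rightarrow> real) \<Rightarrow> real"
  where "euclidean_norm n v = L2_set v {..<n}"

definition partial_deriv :: "nat \<Rightarrow> ((nat \<Rightarrow> real) \<Rightarrow> real) \<Rightarrow> (nat \<Rightarrow> real) \<Rightarrow> real"
  where "partial_deriv i f x = deriv (\<lambda>t. f (x(i := t))) (x i)"

primrec iter_partial :: "nat list \<Rightarrow> ((nat \<Rightarrow> real) \<Rightarrow> real) \<Rightarrow> (nat \<Rightarrow> real) \<Rightarrow> real"
  where
    "iter_partial [] f = f"
  | "iter_partial (i # is) f = partial_deriv i (iter_partial is f)"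

text \<open>
  \<open>C_diff n d G f\<close>: on the open subset \<open>G\<close> of \<open>\<real>\<^sup>n\<close>, all partial derivatives of \<open>f\<close> of order at
  most \<open>d\<close> exist and are continuous. Differentiability is required explicitly since \<^const>\<open>deriv\<close>
  is total.
\<close>

primrec C_diff :: "nat \<Rightarrow> nat \<Rightarrow> (nat \<Rightarrow> real) set \<Rightarrow> ((nat \<Rightarrow> real) \<Rightarrow> real) \<Rightarrow> bool"
  where
    "C_diff n 0 G f \<longleftrightarrow> continuous_on G f"
  | "C_diff n (Suc d) G f \<longleftrightarrow> continuous_on G f \<and>
       (\<forall>i<n. (\<forall>x\<in>G. (\<lambda>t. f (x(i := t))) differentiable (at (x i))) \<and>
              C_diff n d G (partial_deriv i f))"

definition smooth :: "nat \<Rightarrow> (nat \<Rightarrow> real) set \<Rightarrow> ((nat \<Rightarrow> real) \<Rightarrow> real) \<Rightarrow> bool"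
  where "smooth n G f \<longleftrightarrow> (\<forall>d. C_diff n d G f)"

definition gradient :: "nat \<Rightarrow> ((nat \<Rightarrow> real) \<Rightarrow> real) \<Rightarrow> (nat \<Rightarrow> real) \<Rightarrow> (nat \<Rightarrow> real)"
  where "gradient n f x = (\<lambda>i. if i < n then partial_deriv i f x else 0)"

definition borel_prob_on :: "(nat \<Rightarrow> real) set \<Rightarrow> (nat \<Rightarrow> real) measure \<Rightarrow> bool"
  where "borel_prob_on G M \<longleftrightarrow>
    prob_space M \<and> space M = G \<and> sets M = sets (restrict_space borel G)"

definition Var :: "(nat \<Rightarrow> real) measure \<Rightarrow> ((nat \<Rightarrow> real) \<Rightarrow> real) \<Rightarrow> real"
  where "Var M g = (\<integral>x. (g x)\<^sup>2 \<partial>M) - (\<integral>x. g x \<partial>M)\<^sup>2"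

text \<open>
  The right-hand side is a nonnegative integral in \<^typ>\<open>ennreal\<close>: the inequality is void when
  the gradient is not square-integrable.
\<close>

definition poincare_ineq ::
    "nat \<Rightarrow> (nat \<Rightarrow> real) set \<Rightarrow> (nat \<Rightarrow> real) measure \<Rightarrow> real \<Rightarrow> bool"
  where "poincare_ineq n G M C \<longleftrightarrow>
    (\<forall>g. smooth n G g \<and> bounded (g ` G) \<longrightarrow>
      ennreal (Var M g) \<le> ennreal C * (\<integral>\<^sup>+x. ennreal ((euclidean_norm n (gradient n g x))\<^sup>2) \<partial>M))"

text \<open>The \<open>k\<close>-form \<open>f\<^sup>(\<^sup>k\<^sup>)(x)[v\<^sub>0,\<dots>,v\<^sub>k\<^sub>-\<^sub>1]\<close>; the list \<open>is\<close> is the multi-index \<open>(i\<^sub>1,\<dots>,i\<^sub>k)\<close>.\<close>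

definition deriv_form ::
    "nat \<Rightarrow> nat \<Rightarrow> ((nat \<Rightarrow> real) \<Rightarrow> real) \<Rightarrow> (nat \<Rightarrow> real) \<Rightarrow> (nat \<Rightarrow> nat \<Rightarrow> real) \<Rightarrow> real"
  where "deriv_form n k f x v =
    (\<Sum>is\<in>{is. length is = k \<and> set is \<subseteq> {..<n}}.
       iter_partial is f x * (\<Prod>j<k. v j (is ! j)))"

definition op_norm ::
    "nat \<Rightarrow> nat \<Rightarrow> ((nat \<Rightarrow> real) \<Rightarrow> real) \<Rightarrow> (nat \<Rightarrow> real) \<Rightarrow> real"
  where "op_norm n k f x =
    Sup {deriv_form n k f x v | v.
           \<forall>j<k. v j \<in> topspace (Euclidean_space n) \<and> euclidean_norm n (v j) = 1}"

definition Lp_norm :: "(nat \<Rightarrow> real) measure \<Rightarrow> real \<Rightarrow> ((nat \<Rightarrow> real) \<Rightarrow> real) \<Rightarrow> ennreal"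
  where "Lp_norm M p h =
    (let I = (\<integral>\<^sup>+x. ennreal (\<bar>h x\<bar> powr p) \<partial>M)
     in if I = \<infinity> then \<infinity> else ennreal (enn2real I powr (1 / p)))"

definition Linf_norm :: "(nat \<Rightarrow> real) measure \<Rightarrow> ((nat \<Rightarrow> real) \<Rightarrow> real) \<Rightarrow> ennreal"
  where "Linf_norm M h = esssup M (\<lambda>x. ennreal \<bar>h x\<bar>)"

definition op_norm_Lp ::
    "nat \<Rightarrow> (nat \<Rightarrow> real) measure \<Rightarrow> real \<Rightarrow> nat \<Rightarrow> ((nat \<Rightarrow> real) \<Rightarrow> real) \<Rightarrow> ennreal"
  where "op_norm_Lp n M p k f = Lp_norm M p (op_norm n k f)"

definition op_norm_Linf ::
    "nat \<Rightarrow> (nat \<Rightarrow> real) measure \<Rightarrow> nat \<Rightarrow> ((nat \<Rightarrow> real) \<Rightarrow> real) \<Rightarrow> ennreal"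
  where "op_norm_Linf n M k f = Linf_norm M (op_norm n k f)"

end

theory Submission
  imports Defs
begin

text \<open>
  A Poincare inequality, applied to \<open>g\<^sup>q\<close> with \<open>q = p/2\<close> and \<open>\<bar>\<nabla>g\<bar> \<le> H\<close>, bounds \<open>\<integral> g\<^sup>p\<close> by
  \<open>(\<integral> g\<^sup>q)\<^sup>2 + \<sigma>\<^sup>2q\<^sup>2 \<integral> g\<^sup>p\<^sup>-\<^sup>2H\<^sup>2\<close>, and Young's inequality absorbs part of the last term on the left. Iterating over
  the exponents \<open>p = 2\<^sup>m\<close>, the \<open>L\<^sup>p\<close> norm of \<open>g\<close> is at most of order \<open>\<sigma>p\<close> times that of \<open>H\<close>, up to the
  \<open>L\<^sup>2\<close> norm of \<open>g\<close>. Since the gradient of the operator norm of \<open>f\<^sup>(\<^sup>k\<^sup>)\<close> is at most the operator norm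
  of \<open>f\<^sup>(\<^sup>k\<^sup>+\<^sup>1\<^sup>)\<close>, descending from \<open>k = d\<close> to \<open>k = 0\<close> gives \<open>\<parallel>f\<parallel>\<^sub>p \<le> (C\<sigma>p)\<^sup>d\<close>, and the exponential
  series converges.

  The inequality is assumed for bounded smooth functions only, while \<open>f\<close> is merely \<open>C\<^sup>d\<close> and the operator
  norm is not differentiable. The first gap is closed by a Meyers-Serrin argument (mollify the pieces
  of a partition of unity, with errors summing to \<open>\<epsilon>\<close>), the second by writing the operator norm as a
  countable supremum and replacing finite maxima by smooth ones.
\<close>

section \<open>Functions with continuous partial derivatives\<close>

text \<open>The dimension is a term and R^n a set of sequences, so all calculus runs along
  coordinate lines: a gradient is a family of partial derivatives, and mollification is an iteration
  of one-dimensional integrals. Absorbing \<integral> g^p on the left presupposes that it is finite.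
  Hence the moment bounds are proved for bounded functions: t / (1 + a t^2) truncates without
  enlarging the gradient, and Fatou's lemma removes the truncation. The induction over the exponents
  carries 2 \<integral> g^p instead of \<integral> g^p, because (2 \<integral> g^q)^2 is the term
  that the recursion produces. The constant c = 1 / 144: passing from smooth to C^1 functions costs
  a factor 2 on \<sigma>^2, rounded up to \<tau> = 2 \<sigma>; every k is within a factor 2 of some
  2^m, which turns 4 \<tau> 2^m into 8 \<tau> k; and k^k \<le> 3^k k!, so with 1 / (72 \<tau>) the
  k-th term of the exponential series is at most 2 (1/3)^k, and these sum to 1 over k \<ge>
  1.\<close>

lemma openin_Euclidean_space_iff:
  "openin (Euclidean_space n) A \<longleftrightarrow> (\<exists>U. open U \<and> A = topspace (Euclidean_space n) \<inter> U)"
  unfolding topspace_Euclidean_space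
  unfolding Euclidean_space_def euclidean_product_topology openin_open ..

lemma openin_Euclidean_spaceE:
  assumes "openin (Euclidean_space n) A"
  obtains U where "open U" "A = topspace (Euclidean_space n) \<inter> U"
  using assms unfolding openin_Euclidean_space_iff by blast

lemma openin_Euclidean_spaceI:
  "open U \<Longrightarrow> openin (Euclidean_space n) (topspace (Euclidean_space n) \<inter> U)"
  unfolding openin_Euclidean_space_iff by blast

lemma update_in_Euclidean_space [simp]:
  "x \<in> topspace (Euclidean_space n) \<Longrightarrow> i < n \<Longrightarrow> x(i := t) \<in> topspace (Euclidean_space n)"
  by (auto simp: topspace_Euclidean_space)

lemma continuous_on_update:
  fixes x :: "'a :: topological_space \<Rightarrow> nat \<Rightarrow> real"
  assumes "continuous_on S x" "continuous_on S t"
  shows "continuous_on S (\<lambda>z. (x z)(i := t z))"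
proof (rule continuous_on_coordinatewise_then_product)
  fix j
  have "continuous_on S (\<lambda>z. x z j)"
    using assms(1) by (rule continuous_on_product_then_coordinatewise)
  then show "continuous_on S (\<lambda>z. ((x z)(i := t z)) j)"
    using assms(2) by (cases "j = i") auto
qed

text \<open>A partial derivative at x sees only the values on the coordinate line near x. Since
  these points all lie in A, identities valid on A may be differentiated.\<close>

lemma eventually_update_in_open:
  assumes A: "openin (Euclidean_space n) A" and x: "x \<in> A" and i: "i < n"
  shows "\<forall>\<^sub>F t in nhds (x i). x(i := t) \<in> A"
proof -
  obtain U where U: "open U" "A = topspace (Euclidean_space n) \<inter> U"
    using openin_Euclidean_spaceE[OF A] .
  have "continuous_on UNIV (\<lambda>t. x(i := t))"
    by (intro continuous_on_update continuous_intros)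
  then have "open ((\<lambda>t. x(i := t)) -` U)"
    using U(1) open_vimage by blast
  moreover have "x i \<in> (\<lambda>t. x(i := t)) -` U" using x U by simp
  ultimately have "\<forall>\<^sub>F t in nhds (x i). t \<in> (\<lambda>t. x(i := t)) -` U"
    by (rule eventually_nhds_in_open)
  then show ?thesis
  proof eventually_elim
    case (elim t)
    have "x(i := t) \<in> topspace (Euclidean_space n)"
      by (rule update_in_Euclidean_space) (use x U(2) i in blast)+
    with elim U(2) show ?case by blast
  qed
qed

lemma continuous_on_locally:
  assumes A: "A \<subseteq> topspace (Euclidean_space n)"
    and loc: "\<And>x. x \<in> A \<Longrightarrow> \<exists>B. openin (Euclidean_space n) B \<and> x \<in> B \<and> continuous_on B f"
  shows "continuous_on A f"
  unfolding continuous_on_eq_continuous_within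
proof
  fix x assume x: "x \<in> A"
  then obtain B where B: "openin (Euclidean_space n) B" "x \<in> B" "continuous_on B f"
    using loc by blast
  obtain U where U: "open U" "B = topspace (Euclidean_space n) \<inter> U"
    using openin_Euclidean_spaceE[OF B(1)] .
  have "continuous (at x within B) f" using B by (simp add: continuous_on_eq_continuous_within)
  moreover have "at x within B = at x within topspace (Euclidean_space n)"
    by (rule at_within_nhd[of _ U]) (use U B in auto)
  ultimately have "continuous (at x within topspace (Euclidean_space n)) f" by simp
  then show "continuous (at x within A) f" by (rule continuous_within_subset[OF _ A])
qed

text \<open>The derivatives are data: after a product or a composition the gradient is an explicit
  formula whose square sum can be bounded pointwise, where \<open>partial_deriv\<close> would only
  give \<open>deriv\<close> of the composite.\<close>

definition has_partials ::
    "nat \<Rightarrow> (nat \<Rightarrow> real) set \<Rightarrow> ((nat \<Rightarrow> real) \<Rightarrow> real) \<Rightarrow> (nat \<Rightarrow> (nat \<Rightarrow> real) \<Rightarrow> real) \<Rightarrow> bool"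
  where "has_partials n A f f' \<longleftrightarrow> continuous_on A f \<and>
    (\<forall>i<n. continuous_on A (f' i) \<and>
      (\<forall>x\<in>A. ((\<lambda>t. f (x(i := t))) has_real_derivative f' i x) (at (x i))))"

lemma has_partialsI:
  assumes "continuous_on A f" "\<And>i. i < n \<Longrightarrow> continuous_on A (f' i)"
    "\<And>i x. i < n \<Longrightarrow> x \<in> A \<Longrightarrow> ((\<lambda>t. f (x(i := t))) has_real_derivative f' i x) (at (x i))"
  shows "has_partials n A f f'"
  using assms by (auto simp: has_partials_def)

lemma has_partialsD:
  assumes "has_partials n A f f'"
  shows "continuous_on A f" "i < n \<Longrightarrow> continuous_on A (f' i)"
    "i < n \<Longrightarrow> x \<in> A \<Longrightarrow> ((\<lambda>t. f (x(i := t))) has_real_derivative f' i x) (at (x i))"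
  using assms by (auto simp: has_partials_def)

lemma has_partials_partial_deriv:
  assumes "has_partials n A f f'" "i < n" "x \<in> A"
  shows "partial_deriv i f x = f' i x"
  unfolding partial_deriv_def using has_partialsD(3)[OF assms] by (rule DERIV_imp_deriv)

lemma has_partials_subset: "has_partials n A f f' \<Longrightarrow> B \<subseteq> A \<Longrightarrow> has_partials n B f f'"
  unfolding has_partials_def using continuous_on_subset by (metis subsetD)

lemma has_partials_cong:
  assumes f: "has_partials n A f f'" and A: "openin (Euclidean_space n) A"
    and eq: "\<And>x. x \<in> A \<Longrightarrow> g x = f x" "\<And>i x. i < n \<Longrightarrow> x \<in> A \<Longrightarrow> g' i x = f' i x"
  shows "has_partials n A g g'"
proof (rule has_partialsI)
  show "continuous_on A g" using has_partialsD(1)[OF f] eq by (simp cong: continuous_on_cong)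
  fix i assume i: "i < n"
  show "continuous_on A (g' i)" using has_partialsD(2)[OF f i] eq i by (simp cong: continuous_on_cong)
  fix x assume x: "x \<in> A"
  have "\<forall>\<^sub>F t in nhds (x i). g (x(i := t)) = f (x(i := t))"
    using eventually_update_in_open[OF A x i] by eventually_elim (rule eq)
  then show "((\<lambda>t. g (x(i := t))) has_real_derivative g' i x) (at (x i))"
    using has_partialsD(3)[OF f i x] eq(2)[OF i x] by (subst DERIV_cong_ev) auto
qed

lemma has_partials_locally:
  assumes A: "A \<subseteq> topspace (Euclidean_space n)"
    and loc: "\<And>x. x \<in> A \<Longrightarrow> \<exists>B. openin (Euclidean_space n) B \<and> x \<in> B \<and> has_partials n B f f'"
  shows "has_partials n A f f'"
proof (rule has_partialsI)
  show "continuous_on A f"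
    by (rule continuous_on_locally[OF A]) (meson loc has_partialsD(1))
  show "continuous_on A (f' i)" if "i < n" for i
    by (rule continuous_on_locally[OF A]) (meson loc that has_partialsD(2))
  show "((\<lambda>t. f (x(i := t))) has_real_derivative f' i x) (at (x i))" if i: "i < n" and x: "x \<in> A" for i x
  proof -
    obtain B where "x \<in> B" "has_partials n B f f'" using loc[OF x] by blast
    with i show ?thesis using has_partialsD(3) by blast
  qed
qed

lemma has_partials_const: "has_partials n A (\<lambda>x. c) (\<lambda>i x. 0)"
  by (rule has_partialsI) (auto intro!: derivative_eq_intros)

lemma has_partials_add:
  assumes f: "has_partials n A f f'" and g: "has_partials n A g g'"
  shows "has_partials n A (\<lambda>x. f x + g x) (\<lambda>i x. f' i x + g' i x)"
proof (rule has_partialsI)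
  fix i x assume "i < n" "x \<in> A"
  from DERIV_add[OF has_partialsD(3)[OF f this] has_partialsD(3)[OF g this]]
  show "((\<lambda>t. f (x(i := t)) + g (x(i := t))) has_real_derivative f' i x + g' i x) (at (x i))" .
qed (use has_partialsD[OF f] has_partialsD[OF g] in \<open>auto intro!: continuous_intros\<close>)

lemma has_partials_mult:
  assumes f: "has_partials n A f f'" and g: "has_partials n A g g'"
  shows "has_partials n A (\<lambda>x. f x * g x) (\<lambda>i x. f' i x * g x + g' i x * f x)"
proof (rule has_partialsI)
  fix i x assume "i < n" "x \<in> A"
  from DERIV_mult[OF has_partialsD(3)[OF f this] has_partialsD(3)[OF g this]]
  show "((\<lambda>t. f (x(i := t)) * g (x(i := t))) has_real_derivative f' i x * g x + g' i x * f x) (at (x i))"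
    by simp
qed (use has_partialsD[OF f] has_partialsD[OF g] in \<open>auto intro!: continuous_intros\<close>)

text \<open>All compositions below have a function of one real variable outside (powers, square
  roots, cutoffs), so the chain rule is applied on each coordinate line.\<close>

lemma has_partials_compose:
  assumes f: "has_partials n A f f'" 
    and \<phi>: "\<And>y. (\<phi> has_real_derivative \<phi>' y) (at y)" and cont: "continuous_on UNIV \<phi>'"
  shows "has_partials n A (\<lambda>x. \<phi> (f x)) (\<lambda>i x. \<phi>' (f x) * f' i x)"
proof (rule has_partialsI)
  have "continuous_on UNIV \<phi>" 
    by (rule DERIV_continuous_on[where D = \<phi>']) (rule has_field_derivative_at_within[OF \<phi>])
  then show "continuous_on A (\<lambda>x. \<phi> (f x))"
    by (rule continuous_on_compose2[OF _ has_partialsD(1)[OF f]]) simp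
  show "continuous_on A (\<lambda>x. \<phi>' (f x) * f' i x)" if "i < n" for i
    by (intro continuous_on_mult continuous_on_compose2[OF cont has_partialsD(1)[OF f]] has_partialsD(2)[OF f that]) simp
  fix i x assume "i < n" "x \<in> A"
  then have *: "((\<lambda>t. f (x(i := t))) has_real_derivative f' i x) (at (x i))" by (rule has_partialsD(3)[OF f])
  have "(\<phi> has_real_derivative \<phi>' (f x)) (at (f (x(i := x i))))" by (simp add: \<phi>)
  from DERIV_chain2[OF this *]
  show "((\<lambda>t. \<phi> (f (x(i := t)))) has_real_derivative \<phi>' (f x) * f' i x) (at (x i))" .
qed

lemma has_partials_cmult:
  "has_partials n A f f' \<Longrightarrow> has_partials n A (\<lambda>x. c * f x) (\<lambda>i x. c * f' i x)"
  using has_partials_mult[OF has_partials_const, of n A f f' c] by (simp add: mult.commute)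

lemma has_partials_sum:
  assumes "finite I" "\<And>k. k \<in> I \<Longrightarrow> has_partials n A (f k) (f' k)"
  shows "has_partials n A (\<lambda>x. \<Sum>k\<in>I. f k x) (\<lambda>i x. \<Sum>k\<in>I. f' k i x)"
  using assms
proof (induction I rule: finite_induct)
  case (insert k I)
  have "has_partials n A (\<lambda>x. f k x + (\<Sum>k\<in>I. f k x)) (\<lambda>i x. f' k i x + (\<Sum>k\<in>I. f' k i x))"
    by (rule has_partials_add[OF insert.prems insert.IH[OF insert.prems]]) auto
  then show ?case using insert(1,2) by simp
qed (simp add: has_partials_const)

lemma has_partials_coordinate:
  "has_partials n A (\<lambda>x. x j) (\<lambda>i x. if i = j then 1 else 0)"
proof (rule has_partialsI)
  show "((\<lambda>t. (x(i := t)) j) has_real_derivative (if i = j then 1 else 0)) (at (x i))" for i x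
    by (cases "i = j") (auto intro!: derivative_eq_intros)
qed (auto intro!: continuous_on_product_then_coordinatewise continuous_intros)

section \<open>Functions of class C^d: locality and sums\<close>

lemma C_diff_imp_continuous_on: "C_diff n d A f \<Longrightarrow> continuous_on A f"
  by (cases d) auto

lemma C_diff_le: "C_diff n d G f \<Longrightarrow> k \<le> d \<Longrightarrow> C_diff n k G f"
proof (induction k arbitrary: d f)
  case 0
  then show ?case by (simp add: C_diff_imp_continuous_on)
next
  case (Suc k)
  then obtain d' where "d = Suc d'" "k \<le> d'" by (cases d) auto
  with Suc show ?case by auto
qed

lemma C_diff_Suc_imp_has_partials:
  assumes "C_diff n (Suc d) A f"
  shows "has_partials n A f (\<lambda>i. partial_deriv i f)"
proof (rule has_partialsI)
  show "((\<lambda>t. f (x(i := t))) has_real_derivative partial_deriv i f x) (at (x i))"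
    if "i < n" "x \<in> A" for i x
    using assms that DERIV_deriv_iff_real_differentiable unfolding partial_deriv_def by auto
qed (use assms C_diff_imp_continuous_on in auto)

lemma C_diff_cong:
  assumes "C_diff n d A f" "openin (Euclidean_space n) A" "\<And>x. x \<in> A \<Longrightarrow> g x = f x"
  shows "C_diff n d A g"
  using assms
proof (induction d arbitrary: f g)
  case 0
  then show ?case by (simp cong: continuous_on_cong)
next
  case (Suc d)
  have hp: "has_partials n A g (\<lambda>i. partial_deriv i f)"
    by (rule has_partials_cong[OF C_diff_Suc_imp_has_partials[OF Suc.prems(1)] Suc.prems(2)])
      (use Suc.prems in auto)
  have "C_diff n d A (partial_deriv i g)" if "i < n" for i
    by (rule Suc.IH[of "partial_deriv i f"])
      (use Suc.prems that has_partials_partial_deriv[OF hp] in auto)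
  moreover have "(\<lambda>t. g (x(i := t))) differentiable at (x i)" if "i < n" "x \<in> A" for i x
    unfolding real_differentiable_def by (rule exI, rule has_partialsD(3)[OF hp that])
  ultimately show ?case using has_partialsD(1)[OF hp] by simp
qed

text \<open>\<open>partial_deriv i f\<close> agrees with \<open>f' i\<close> only on A, so the
  regularity of order d is carried over by \<open>C_diff_cong\<close>, for which A has to be
  open.\<close>

lemma C_diff_SucI:
  assumes hp: "has_partials n A f f'" and A: "openin (Euclidean_space n) A"
    and f': "\<And>i. i < n \<Longrightarrow> C_diff n d A (f' i)"
  shows "C_diff n (Suc d) A f"
proof -
  have "C_diff n d A (partial_deriv i f)" if "i < n" for i
    by (rule C_diff_cong[OF f'[OF that] A]) (use has_partials_partial_deriv[OF hp] that in auto)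
  moreover have "(\<lambda>t. f (x(i := t))) differentiable at (x i)" if "i < n" "x \<in> A" for i x
    unfolding real_differentiable_def by (rule exI, rule has_partialsD(3)[OF hp that])
  ultimately show ?thesis using has_partialsD(1)[OF hp] by simp
qed

lemma C_diff_subset: "C_diff n d A f \<Longrightarrow> B \<subseteq> A \<Longrightarrow> C_diff n d B f"
  by (induction d arbitrary: f) (auto intro: continuous_on_subset)

text \<open>Serves the series in \<open>smooth_approx\<close>, which near each point is a finite sum
  whose length depends on the point.\<close>

lemma C_diff_locally:
  assumes "A \<subseteq> topspace (Euclidean_space n)"
    and "\<And>x. x \<in> A \<Longrightarrow> \<exists>B. openin (Euclidean_space n) B \<and> x \<in> B \<and> C_diff n d B f"
  shows "C_diff n d A f"
  using assms(2)
proof (induction d arbitrary: f)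
  case 0
  then show ?case using continuous_on_locally[OF assms(1), of f] by simp
next
  case (Suc d)
  have "continuous_on A f"
    by (rule continuous_on_locally[OF assms(1)]) (meson Suc.prems C_diff_imp_continuous_on)
  moreover have "(\<lambda>t. f (x(i := t))) differentiable at (x i)" if "i < n" "x \<in> A" for i x
    using Suc.prems[OF that(2)] that by auto
  moreover have "C_diff n d A (partial_deriv i f)" if "i < n" for i
  proof (rule Suc.IH)
    fix x assume "x \<in> A"
    from Suc.prems[OF this] that
    show "\<exists>B. openin (Euclidean_space n) B \<and> x \<in> B \<and> C_diff n d B (partial_deriv i f)" by auto
  qed
  ultimately show ?case by simp
qed

lemma C_diff_zero:
  assumes "openin (Euclidean_space n) A"
  shows "C_diff n d A (\<lambda>x. 0)"
proof (induction d)
  case (Suc d)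
  show ?case by (rule C_diff_SucI[OF has_partials_const assms Suc.IH])
qed simp

lemma C_diff_add:
  assumes "C_diff n d A f" "C_diff n d A g" "openin (Euclidean_space n) A"
  shows "C_diff n d A (\<lambda>x. f x + g x)"
  using assms
proof (induction d arbitrary: f g)
  case (Suc d)
  show ?case
    by (rule C_diff_SucI[OF has_partials_add[OF C_diff_Suc_imp_has_partials[OF Suc.prems(1)]
            C_diff_Suc_imp_has_partials[OF Suc.prems(2)]] Suc.prems(3)])
      (rule Suc.IH; use Suc.prems in auto)
qed (simp add: continuous_on_add)

lemma C_diff_sum:
  assumes "finite I" "\<And>k. k \<in> I \<Longrightarrow> C_diff n d A (f k)" and A: "openin (Euclidean_space n) A"
  shows "C_diff n d A (\<lambda>x. \<Sum>k\<in>I. f k x)"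
  using assms(1,2)
proof (induction I rule: finite_induct)
  case (insert k I)
  have "C_diff n d A (\<lambda>x. f k x + (\<Sum>k\<in>I. f k x))"
    by (rule C_diff_add[OF insert.prems insert.IH[OF insert.prems] A]) auto
  then show ?case using insert(1,2) by simp
qed (simp add: C_diff_zero[OF A])

section \<open>A smooth bump function on the line\<close>

text \<open>x^(-m) exp(-1/x) for positive x. The power m closes the family under differentiation up
  to linear combinations, so one formula covers all orders.\<close>

definition flat_exp :: "nat \<Rightarrow> real \<Rightarrow> real"
  where "flat_exp m x = (if x > 0 then inverse x ^ m / exp (inverse x) else 0)"

lemma flat_exp_nonneg: "0 \<le> flat_exp m x"
  by (simp add: flat_exp_def)

lemma tendsto_flat: "(flat_exp m \<longlongrightarrow> 0) (at 0)"
proof (rule filterlim_split_at)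
  have "(flat_exp m \<longlongrightarrow> 0) (at_left 0) \<longleftrightarrow> ((\<lambda>x::real. 0::real) \<longlongrightarrow> 0) (at_left 0)"
    by (intro tendsto_cong eventually_at_leftI[of "-1"]) (auto simp: flat_exp_def)
  then show "(flat_exp m \<longlongrightarrow> 0) (at_left 0)" by simp
  have "((\<lambda>x::real. inverse x ^ m / exp (inverse x)) \<longlongrightarrow> 0) (at_right 0)"
    by (rule filterlim_compose[OF tendsto_power_div_exp_0 filterlim_inverse_at_top_right])
  moreover have "(flat_exp m \<longlongrightarrow> 0) (at_right 0) \<longleftrightarrow>
      ((\<lambda>x::real. inverse x ^ m / exp (inverse x)) \<longlongrightarrow> 0) (at_right 0)"
    by (intro tendsto_cong eventually_at_rightI[of _ 1]) (auto simp: flat_exp_def)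
  ultimately show "(flat_exp m \<longlongrightarrow> 0) (at_right 0)" by simp
qed

lemma DERIV_flat: "(flat_exp m has_real_derivative flat_exp (m + 2) x - m * flat_exp (m + 1) x) (at x)"
proof (cases x "0 :: real" rule: linorder_cases)
  case less
  have "\<forall>\<^sub>F y in nhds x. flat_exp m y = 0"
    using eventually_nhds_in_open[of "{..<0}" x] less by (auto elim!: eventually_mono simp: flat_exp_def)
  then have "(flat_exp m has_real_derivative 0) (at x) \<longleftrightarrow> ((\<lambda>y. 0) has_real_derivative 0) (at x)"
    by (intro DERIV_cong_ev) auto
  then show ?thesis using less by (simp add: flat_exp_def)
next
  case equal
  \<comment> \<open>At 0 the difference quotient of \<open>flat_exp m\<close> is exactly
    \<open>flat_exp (m + 1)\<close>; for h = 0 both sides are 0 since 0 / 0 = 0.\<close>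
  have "(\<lambda>h. (flat_exp m (0 + h) - flat_exp m 0) / h) = flat_exp (m + 1)"
    by (auto simp: flat_exp_def fun_eq_iff field_simps)
  then show ?thesis using tendsto_flat[of "m + 1"] equal by (simp add: DERIV_def flat_exp_def)
next
  case greater
  have "\<forall>\<^sub>F y in nhds x. flat_exp m y = inverse y ^ m * exp (- inverse y)"
    using eventually_nhds_in_open[of "{0<..}" x] greater
    by (auto elim!: eventually_mono simp: flat_exp_def exp_minus field_simps)
  moreover have "((\<lambda>y. inverse y ^ m * exp (- inverse y)) has_real_derivative
      flat_exp (m + 2) x - m * flat_exp (m + 1) x) (at x)"
  proof -
    have 1: "((\<lambda>y. inverse y ^ m) has_real_derivative
        m * (- (inverse x ^ Suc (Suc 0)) * inverse x ^ (m - Suc 0))) (at x)"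
      using DERIV_power[OF DERIV_inverse, of x m] greater by simp
    have 2: "((\<lambda>y. exp (- inverse y)) has_real_derivative
        exp (- inverse x) * - (- (inverse x ^ Suc (Suc 0)))) (at x)"
      using DERIV_fun_exp[OF DERIV_minus[OF DERIV_inverse], of x] greater by simp
    have "m * (- (inverse x ^ Suc (Suc 0)) * inverse x ^ (m - Suc 0)) * exp (- inverse x) +
        exp (- inverse x) * - (- (inverse x ^ Suc (Suc 0))) * inverse x ^ m =
        flat_exp (m + 2) x - m * flat_exp (m + 1) x"
      using greater by (cases m) (simp_all add: flat_exp_def exp_minus divide_inverse algebra_simps)
    with DERIV_mult[OF 1 2] show ?thesis by simp
  qed
  ultimately show ?thesis by (subst DERIV_cong_ev) auto
qed

text \<open>
  The derivatives of the bump \<open>exp (-1/(r+x)) exp (-1/(r-x))\<close> are linear combinations of products of two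
  functions \<^const>\<open>flat_exp\<close>; a list of triples \<open>(c, m, k)\<close> encodes such a combination.
\<close>

fun bump_term :: "real \<Rightarrow> real \<times> nat \<times> nat \<Rightarrow> real \<Rightarrow> real"
  where "bump_term r (c, m, k) x = c * (flat_exp m (r + x) * flat_exp k (r - x))"

fun bump_term_deriv :: "real \<times> nat \<times> nat \<Rightarrow> (real \<times> nat \<times> nat) list"
  where "bump_term_deriv (c, m, k) =
    [(c, m + 2, k), (- c * m, m + 1, k), (- c, m, k + 2), (c * k, m, k + 1)]"

definition bump_comb :: "real \<Rightarrow> (real \<times> nat \<times> nat) list \<Rightarrow> real \<Rightarrow> real"
  where "bump_comb r l x = (\<Sum>p\<leftarrow>l. bump_term r p x)"

lemma bump_comb_simps [simp]:
  "bump_comb r [] = (\<lambda>x. 0)"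
  "bump_comb r (p # l) = (\<lambda>x. bump_term r p x + bump_comb r l x)"
  "bump_comb r (l @ l') = (\<lambda>x. bump_comb r l x + bump_comb r l' x)"
  by (auto simp: bump_comb_def fun_eq_iff)

lemma DERIV_bump_term:
  "(bump_term r p has_real_derivative bump_comb r (bump_term_deriv p) x) (at x)"
proof (cases p)
  case (fields c m k)
  have 1: "((\<lambda>x. flat_exp m (r + x)) has_real_derivative
      (flat_exp (m + 2) (r + x) - m * flat_exp (m + 1) (r + x)) * 1) (at x)"
    by (rule DERIV_chain2[OF DERIV_flat]) (auto intro!: derivative_eq_intros)
  have 2: "((\<lambda>x. flat_exp k (r - x)) has_real_derivative
      (flat_exp (k + 2) (r - x) - k * flat_exp (k + 1) (r - x)) * (-1)) (at x)"
    by (rule DERIV_chain2[OF DERIV_flat]) (auto intro!: derivative_eq_intros)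
  have "bump_term r p = (\<lambda>x. c * (flat_exp m (r + x) * flat_exp k (r - x)))"
    using fields by auto
  then show ?thesis using DERIV_cmult[OF DERIV_mult[OF 1 2], of c] fields
    by (simp add: algebra_simps)
qed

lemma DERIV_bump_comb:
  "(bump_comb r l has_real_derivative bump_comb r (concat (map bump_term_deriv l)) x) (at x)"
  by (induction l) (auto intro!: DERIV_add DERIV_bump_term)

lemma bump_comb_eq_0: "r \<le> \<bar>x\<bar> \<Longrightarrow> bump_comb r l x = 0"
proof (induction l)
  case (Cons p l)
  then show ?case by (cases p) (auto simp: flat_exp_def)
qed simp

text \<open>Normalise the bump by its integral. The mass is stated on an interval [-R, R] because
  the mollification integrates there; it is 1 as soon as the translated support fits in.\<close>

lemma smooth_kernel_exists:
  fixes r :: real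
  assumes r: "0 < r"
  obtains \<kappa> :: "nat \<Rightarrow> real \<Rightarrow> real"
  where "\<And>a x. (\<kappa> a has_real_derivative \<kappa> (Suc a) x) (at x)"
    and "\<And>a x. r \<le> \<bar>x\<bar> \<Longrightarrow> \<kappa> a x = 0"
    and "\<And>x. 0 \<le> \<kappa> 0 x"
    and "\<And>y R. \<bar>y\<bar> + r \<le> R \<Longrightarrow> ((\<lambda>s. \<kappa> 0 (y - s)) has_integral 1) {-R..R}"
proof -
  define l where "l a = ((\<lambda>l. concat (map bump_term_deriv l)) ^^ a) [(1, 0, 0)]" for a
  define F where "F a = bump_comb r (l a)" for a
  have F: "(F a has_real_derivative F (Suc a) x) (at x)" for a x
    using DERIV_bump_comb[of r "l a" x] by (simp add: F_def l_def)
  have F_0: "F a x = 0" if "r \<le> \<bar>x\<bar>" for a x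
    using that by (simp add: F_def bump_comb_eq_0)
  have F0: "F 0 x = flat_exp 0 (r + x) * flat_exp 0 (r - x)" for x
    by (simp add: F_def l_def)
  have F_nonneg: "0 \<le> F 0 x" for x by (simp add: F0 flat_exp_nonneg)
  have cont: "continuous_on S (F a)" for a S
    by (rule DERIV_continuous_on[where D = "F (Suc a)"]) (rule has_field_derivative_at_within[OF F])
  define I where "I = integral {-r..r} (F 0)"
  \<comment> \<open>A continuous nonnegative function with integral 0 vanishes identically, so one
    nonzero value makes the normalisation possible.\<close>
  have "F 0 0 \<noteq> 0" using r by (simp add: F0 flat_exp_def)
  moreover have "I = 0 \<longleftrightarrow> (\<forall>x\<in>{-r..r}. F 0 x = 0)"
    unfolding I_def by (rule integral_eq_0_iff[OF cont]) (use r F_nonneg in simp_all)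
  ultimately have "I \<noteq> 0" using r by (metis atLeastAtMost_iff less_eq_real_def neg_le_0_iff_le)
  moreover have "0 \<le> I" unfolding I_def
    by (rule integral_nonneg[OF integrable_continuous_interval[OF cont]]) (rule F_nonneg)
  ultimately have I: "0 < I" by simp
  have int: "(F 0 has_integral I) (cbox (-r) r)"
    unfolding I_def using integrable_continuous_interval[OF cont] by (simp add: integrable_integral)
  show thesis
  proof (rule that[of "\<lambda>a x. F a x / I"])
    show "((\<lambda>x. F a x / I) has_real_derivative F (Suc a) x / I) (at x)" for a x
      by (rule DERIV_cdivide[OF F])
    show "r \<le> \<bar>x\<bar> \<Longrightarrow> F a x / I = 0" for a x by (simp add: F_0)
    show "0 \<le> F 0 x / I" for x using F_nonneg I by simp
    fix y R assume R: "\<bar>y\<bar> + r \<le> R"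
    have "((\<lambda>s. F 0 (-1 * s + y)) has_integral I) ((\<lambda>x. (1 / (-1)) * x - (1 / (-1)) * y) ` cbox (-r) r)"
      using has_integral_affinity[OF int, of "-1" y] by simp
    moreover have "(\<lambda>x. (1 / (-1)) * x - (1 / (-1)) * y) ` cbox (-r) r = {y-r..y+r}"
    proof -
      have "(\<lambda>x. (1 / (-1)) * x - (1 / (-1)) * y) = (-) y" by auto
      then show ?thesis by (simp only: cbox_interval image_diff_atLeastAtMost) simp
    qed
    ultimately have "((\<lambda>s. F 0 (y - s)) has_integral I) {y-r..y+r}" by (simp add: add.commute)
    then have "((\<lambda>s. F 0 (y - s)) has_integral I) {-R..R}"
      by (rule has_integral_on_superset) (rule F_0, use R in auto)
    then show "((\<lambda>s. F 0 (y - s) / I) has_integral 1) {-R..R}"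
      using has_integral_divide[of "\<lambda>s. F 0 (y - s)" I "{-R..R}" I] I by simp
  qed
qed

section \<open>Coordinatewise mollification\<close>

text \<open>Convolution with \<phi> in coordinate i, provided that u vanishes for |x i| \<ge> R. The
  range is a fixed compact interval, which makes continuous data sufficient for differentiation
  under the integral sign.\<close>

definition mollify1 ::
    "real \<Rightarrow> nat \<Rightarrow> (real \<Rightarrow> real) \<Rightarrow> ((nat \<Rightarrow> real) \<Rightarrow> real) \<Rightarrow> (nat \<Rightarrow> real) \<Rightarrow> real"
  where "mollify1 R i \<phi> u x = integral {-R..R} (\<lambda>s. u (x(i := s)) * \<phi> (x i - s))"

lemma continuous_on_compose_update:
  fixes x :: "'a :: topological_space \<Rightarrow> nat \<Rightarrow> real"
  assumes "continuous_on (topspace (Euclidean_space n)) u" "i < n"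
    and "continuous_on S x" "continuous_on S t"
    and "\<And>z. z \<in> S \<Longrightarrow> x z \<in> topspace (Euclidean_space n)"
  shows "continuous_on S (\<lambda>z. u ((x z)(i := t z)))"
  by (rule continuous_on_compose2[OF assms(1) continuous_on_update[OF assms(3,4)]])
    (use assms(2,5) in auto)

lemma continuous_on_mollify1_integrand:
  fixes \<phi> :: "real \<Rightarrow> real"
  assumes u: "continuous_on (topspace (Euclidean_space n)) u" and i: "i < n"
    and \<phi>: "continuous_on UNIV \<phi>" and x: "x \<in> topspace (Euclidean_space n)"
  shows "continuous_on S (\<lambda>s. u (x(i := s)) * \<phi> (y - s))"
proof -
  have 1: "continuous_on S (\<lambda>s. u (x(i := s)))"
    by (rule continuous_on_compose_update[OF u i continuous_on_const continuous_on_id x])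
  have 2: "continuous_on S (\<lambda>s. \<phi> (y - s))"
    by (rule continuous_on_compose2[OF \<phi> continuous_on_diff[OF continuous_on_const continuous_on_id]]) simp
  show ?thesis by (rule continuous_on_mult[OF 1 2])
qed

lemma continuous_on_mollify1:
  fixes \<phi> :: "real \<Rightarrow> real"
  assumes u: "continuous_on (topspace (Euclidean_space n)) u" and i: "i < n"
    and \<phi>: "continuous_on UNIV \<phi>"
  shows "continuous_on (topspace (Euclidean_space n)) (mollify1 R i \<phi> u)"
proof -
  have fst: "continuous_on (topspace (Euclidean_space n) \<times> cbox (-R) R) fst"
    and snd: "continuous_on (topspace (Euclidean_space n) \<times> cbox (-R) R) snd"
    by (intro continuous_on_fst continuous_on_snd continuous_on_id)+
  have 1: "continuous_on (topspace (Euclidean_space n) \<times> cbox (-R) R) (\<lambda>z. u ((fst z)(i := snd z)))"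
    by (rule continuous_on_compose_update[OF u i fst snd]) auto
  have 2: "continuous_on (topspace (Euclidean_space n) \<times> cbox (-R) R) (\<lambda>z. \<phi> (fst z i - snd z))"
    by (rule continuous_on_compose2[OF \<phi> continuous_on_diff[OF
            continuous_on_product_then_coordinatewise[OF fst] snd]]) simp
  have "continuous_on (topspace (Euclidean_space n) \<times> cbox (-R) R)
      (\<lambda>z. u ((fst z)(i := snd z)) * \<phi> (fst z i - snd z))"
    by (rule continuous_on_mult[OF 1 2])
  then have "continuous_on (topspace (Euclidean_space n) \<times> cbox (-R) R)
      (\<lambda>(x, s). u (x(i := s)) * \<phi> (x i - s))"
    by (simp add: case_prod_unfold)
  from integral_continuous_on_param[OF this] show ?thesis
    unfolding mollify1_def[abs_def] by simp
qed

text \<open>In the mollified direction the derivative falls on the kernel, while u is merely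
  continuous: this is the source of smoothness.\<close>

lemma DERIV_mollify1_kernel:
  assumes u: "continuous_on (topspace (Euclidean_space n)) u" and i: "i < n"
    and \<phi>: "\<And>y. (\<phi> has_real_derivative \<phi>' y) (at y)" and \<phi>': "continuous_on UNIV \<phi>'"
    and x: "x \<in> topspace (Euclidean_space n)"
  shows "((\<lambda>t. mollify1 R i \<phi> u (x(i := t))) has_real_derivative mollify1 R i \<phi>' u x) (at (x i))"
proof -
  have c\<phi>: "continuous_on UNIV \<phi>"
    by (rule DERIV_continuous_on[where D = \<phi>']) (rule has_field_derivative_at_within[OF \<phi>])
  have "continuous_on (UNIV \<times> cbox (-R) R) (\<lambda>z. u (x(i := snd z)) * \<phi>' (fst z - snd z))"
    by (intro continuous_on_mult continuous_on_compose_update[OF u i]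
        continuous_on_compose2[OF \<phi>'] continuous_on_const continuous_on_diff
        continuous_on_fst continuous_on_snd continuous_on_id x subset_UNIV)
  then have cont: "continuous_on (UNIV \<times> cbox (-R) R) (\<lambda>(t, s). u (x(i := s)) * \<phi>' (t - s))"
    by (simp add: case_prod_unfold)
  have "((\<lambda>t. integral (cbox (-R) R) (\<lambda>s. u (x(i := s)) * \<phi> (t - s))) has_field_derivative
      integral (cbox (-R) R) (\<lambda>s. u (x(i := s)) * \<phi>' (x i - s))) (at (x i) within UNIV)"
  proof (rule leibniz_rule_field_derivative[OF _ _ cont])
    show "((\<lambda>t. u (x(i := s)) * \<phi> (t - s)) has_real_derivative u (x(i := s)) * \<phi>' (t - s))
        (at t within UNIV)" for t s
    proof -
      have "((\<lambda>t. \<phi> (t - s)) has_real_derivative \<phi>' (t - s) * 1) (at t)"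
        by (rule DERIV_chain2[OF \<phi>]) (auto intro!: derivative_eq_intros)
      then show ?thesis by (intro DERIV_cmult) simp
    qed
    show "(\<lambda>s. u (x(i := s)) * \<phi> (t - s)) integrable_on cbox (-R) R" for t
      by (rule integrable_continuous) (rule continuous_on_mollify1_integrand[OF u i c\<phi> x])
  qed auto
  then show ?thesis by (simp add: mollify1_def)
qed

text \<open>In the other directions the derivative passes to u under the integral, since the updates
  at j and at i commute.\<close>

lemma DERIV_mollify1_inner:
  assumes u: "continuous_on (topspace (Euclidean_space n)) u" and i: "i < n" and j: "j < n" "j \<noteq> i"
    and u': "continuous_on (topspace (Euclidean_space n)) u'"
    and deriv: "\<And>y. y \<in> topspace (Euclidean_space n) \<Longrightarrow>
      ((\<lambda>t. u (y(j := t))) has_real_derivative u' y) (at (y j))"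
    and \<phi>: "continuous_on UNIV \<phi>"
    and x: "x \<in> topspace (Euclidean_space n)"
  shows "((\<lambda>t. mollify1 R i \<phi> u (x(j := t))) has_real_derivative mollify1 R i \<phi> u' x) (at (x j))"
proof -
  have "continuous_on (UNIV \<times> cbox (-R) R) (\<lambda>z. u' ((x(j := fst z))(i := snd z)) * \<phi> (x i - snd z))"
    by (intro continuous_on_mult continuous_on_compose_update[OF u' i] continuous_on_update
        continuous_on_compose2[OF \<phi>] continuous_on_const continuous_on_diff
        continuous_on_fst continuous_on_snd continuous_on_id
        update_in_Euclidean_space x j subset_UNIV)
  then have cont: "continuous_on (UNIV \<times> cbox (-R) R)
      (\<lambda>(t, s). u' ((x(j := t))(i := s)) * \<phi> (x i - s))"
    by (simp add: case_prod_unfold)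
  have "((\<lambda>t. integral (cbox (-R) R) (\<lambda>s. u ((x(j := t))(i := s)) * \<phi> (x i - s))) has_field_derivative
      integral (cbox (-R) R) (\<lambda>s. u' ((x(j := x j))(i := s)) * \<phi> (x i - s))) (at (x j) within UNIV)"
  proof (rule leibniz_rule_field_derivative[OF _ _ cont])
    show "((\<lambda>t. u ((x(j := t))(i := s)) * \<phi> (x i - s)) has_real_derivative
        u' ((x(j := t))(i := s)) * \<phi> (x i - s)) (at t within UNIV)" for t s
    proof -
      have "((\<lambda>t'. u (((x(j := t))(i := s))(j := t'))) has_real_derivative u' ((x(j := t))(i := s)))
          (at (((x(j := t))(i := s)) j))"
        by (rule deriv) (simp add: x i j)
      moreover have "((x(j := t))(i := s))(j := t') = (x(j := t'))(i := s)" for t'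
        using j(2) by (auto simp: fun_eq_iff)
      moreover have "((x(j := t))(i := s)) j = t" using j(2) by simp
      ultimately have "((\<lambda>t'. u ((x(j := t'))(i := s))) has_real_derivative u' ((x(j := t))(i := s))) (at t)"
        by simp
      from DERIV_cmult_right[OF this] show ?thesis by simp
    qed
    show "(\<lambda>s. u ((x(j := t))(i := s)) * \<phi> (x i - s)) integrable_on cbox (-R) R" for t
      by (rule integrable_continuous)
        (rule continuous_on_mollify1_integrand[OF u i \<phi> update_in_Euclidean_space[OF x j(1)]])
  qed auto
  then show ?thesis using j(2) by (simp add: mollify1_def)
qed

text \<open>Integration by parts, with boundary terms that vanish at R and -R. It turns a derivative
  of the kernel back into a derivative of u, so that the gradient of a mollification is a
  mollification of the gradient.\<close>

lemma mollify1_by_parts: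
  assumes u: "continuous_on (topspace (Euclidean_space n)) u" and i: "i < n"
    and u': "continuous_on (topspace (Euclidean_space n)) u'"
    and deriv: "\<And>y. y \<in> topspace (Euclidean_space n) \<Longrightarrow>
      ((\<lambda>t. u (y(i := t))) has_real_derivative u' y) (at (y i))"
    and \<phi>: "\<And>y. (\<phi> has_real_derivative \<phi>' y) (at y)" and \<phi>': "continuous_on UNIV \<phi>'"
    and R: "0 \<le> R" "u (x(i := R)) = 0" "u (x(i := -R)) = 0"
    and x: "x \<in> topspace (Euclidean_space n)"
  shows "mollify1 R i \<phi>' u x = mollify1 R i \<phi> u' x"
proof -
  have c\<phi>: "continuous_on UNIV \<phi>"
    by (rule DERIV_continuous_on[where D = \<phi>']) (rule has_field_derivative_at_within[OF \<phi>])
  define w where "w s = u (x(i := s)) * \<phi> (x i - s)" for s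
  define w' where "w' s = u' (x(i := s)) * \<phi> (x i - s) - u (x(i := s)) * \<phi>' (x i - s)" for s
  have "(w has_real_derivative w' s) (at s)" for s
  proof -
    have "((\<lambda>t. u ((x(i := s))(i := t))) has_real_derivative u' (x(i := s))) (at ((x(i := s)) i))"
      by (rule deriv) (simp add: x i)
    then have 1: "((\<lambda>t. u (x(i := t))) has_real_derivative u' (x(i := s))) (at s)" by simp
    have 2: "((\<lambda>t. \<phi> (x i - t)) has_real_derivative \<phi>' (x i - s) * (-1)) (at s)"
      by (rule DERIV_chain2[OF \<phi>]) (auto intro!: derivative_eq_intros)
    show ?thesis using DERIV_mult[OF 1 2] by (simp add: w_def[abs_def] w'_def mult.commute)
  qed
  then have "(w' has_integral (w R - w (-R))) {-R..R}"
    using R(1) by (intro fundamental_theorem_of_calculus)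
      (simp_all add: has_field_derivative_at_within flip: has_real_derivative_iff_has_vector_derivative)
  then have 0: "integral {-R..R} w' = 0"
    by (simp add: integral_unique w_def R)
  have "(\<lambda>s. u' (x(i := s)) * \<phi> (x i - s)) integrable_on {-R..R}"
    "(\<lambda>s. u (x(i := s)) * \<phi>' (x i - s)) integrable_on {-R..R}"
    by (rule integrable_continuous_interval, rule continuous_on_mollify1_integrand[OF _ i _ x], fact+)+
  from integral_diff[OF this] 0 show ?thesis by (simp add: w'_def[abs_def] mollify1_def)
qed

text \<open>
  \<open>\<kappa> a\<close> is the \<open>a\<close>-th derivative of the kernel, so that \<open>\<alpha>\<close> records the multi-index of a partial derivative
  of the mollified function.
\<close>

primrec mollify ::
    "real \<Rightarrow> (nat \<Rightarrow> real \<Rightarrow> real) \<Rightarrow> (nat \<Rightarrow> nat) \<Rightarrow> nat \<Rightarrow> ((nat \<Rightarrow> real) \<Rightarrow> real) \<Rightarrow> (nat \<Rightarrow> real) \<Rightarrow> real"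
  where
    "mollify R \<kappa> \<alpha> 0 u = u"
  | "mollify R \<kappa> \<alpha> (Suc m) u = mollify1 R m (\<kappa> (\<alpha> m)) (mollify R \<kappa> \<alpha> m u)"

lemma mollify_cong: "(\<And>i. i < m \<Longrightarrow> \<alpha> i = \<beta> i) \<Longrightarrow> mollify R \<kappa> \<alpha> m u = mollify R \<kappa> \<beta> m u"
proof (induction m)
  case (Suc m)
  have "mollify R \<kappa> \<alpha> m u = mollify R \<kappa> \<beta> m u" by (rule Suc.IH) (simp add: Suc.prems)
  then show ?case using Suc.prems[of m] by simp
qed simp

context
  fixes n :: nat and R :: real and \<kappa> :: "nat \<Rightarrow> real \<Rightarrow> real"
  assumes DERIV_\<kappa>: "\<And>a x. (\<kappa> a has_real_derivative \<kappa> (Suc a) x) (at x)"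
begin

lemma continuous_on_\<kappa>: "continuous_on UNIV (\<kappa> a)"
  by (rule DERIV_continuous_on[where D = "\<kappa> (Suc a)"]) (rule has_field_derivative_at_within[OF DERIV_\<kappa>])

lemma continuous_on_mollify:
  assumes u: "continuous_on (topspace (Euclidean_space n)) u"
  shows "m \<le> n \<Longrightarrow> continuous_on (topspace (Euclidean_space n)) (mollify R \<kappa> \<alpha> m u)"
proof (induction m)
  case (Suc m)
  then show ?case
    using continuous_on_mollify1[OF _ _ continuous_on_\<kappa>, of n "mollify R \<kappa> \<alpha> m u" m R "\<alpha> m"] by simp
qed (simp add: u)

text \<open>Each differentiation raises one entry of \<alpha>. The family of all
  \<open>mollify R \<kappa> \<alpha> n u\<close> is therefore closed under differentiation, and
  \<open>C_diff_mollify\<close> is an induction over all \<alpha> at once.\<close>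

lemma DERIV_mollify:
  assumes u: "continuous_on (topspace (Euclidean_space n)) u"
  shows "m \<le> n \<Longrightarrow> i < m \<Longrightarrow> x \<in> topspace (Euclidean_space n) \<Longrightarrow>
    ((\<lambda>t. mollify R \<kappa> \<alpha> m u (x(i := t))) has_real_derivative
      mollify R \<kappa> (\<alpha>(i := Suc (\<alpha> i))) m u x) (at (x i))"
proof (induction m arbitrary: x)
  case (Suc m)
  then have m: "m < n" by simp
  note cont = continuous_on_mollify[OF u less_imp_le[OF m]]
  show ?case
  proof (cases "i = m")
    case True
    \<comment> \<open>The first m mollifications read only entries of \<alpha> below m.\<close>
    have "mollify R \<kappa> (\<alpha>(i := Suc (\<alpha> i))) m u = mollify R \<kappa> \<alpha> m u"
      by (rule mollify_cong) (simp add: True)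
    then have eq: "mollify R \<kappa> (\<alpha>(m := Suc (\<alpha> m))) m u = mollify R \<kappa> \<alpha> m u"
      using True by blast
    show ?thesis
      unfolding True mollify.simps eq fun_upd_same
      by (rule DERIV_mollify1_kernel[OF cont m DERIV_\<kappa> continuous_on_\<kappa> Suc.prems(3)])
  next
    case False
    then have i: "i < m" "i < n" "i \<noteq> m" using Suc.prems by auto
    have "(\<alpha>(i := Suc (\<alpha> i))) m = \<alpha> m" using False by simp
    then show ?thesis
      unfolding mollify.simps
      by (simp only:) (rule DERIV_mollify1_inner[OF cont m i(2,3)
          continuous_on_mollify[OF u less_imp_le[OF m]] Suc.IH[OF less_imp_le[OF m] i(1)]
          continuous_on_\<kappa> Suc.prems(3)])
  qed
qed simp

lemma C_diff_mollify:
  assumes u: "continuous_on (topspace (Euclidean_space n)) u"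
  shows "C_diff n d (topspace (Euclidean_space n)) (mollify R \<kappa> \<alpha> n u)"
proof (induction d arbitrary: \<alpha>)
  case 0
  then show ?case using continuous_on_mollify[OF u] by simp
next
  case (Suc d)
  have "has_partials n (topspace (Euclidean_space n)) (mollify R \<kappa> \<alpha> n u)
      (\<lambda>i. mollify R \<kappa> (\<alpha>(i := Suc (\<alpha> i))) n u)"
    by (rule has_partialsI) (simp_all add: continuous_on_mollify[OF u] DERIV_mollify[OF u])
  from C_diff_SucI[OF this _ Suc.IH] show ?case by simp
qed

text \<open>The first m steps integrate over coordinates below m \<le> j and leave
  \<open>x j\<close> alone. This supplies the boundary zeros for
  \<open>mollify1_by_parts\<close>.\<close>

lemma mollify_vanish:
  assumes "\<And>x. x \<in> topspace (Euclidean_space n) \<Longrightarrow> S \<le> \<bar>x j\<bar> \<Longrightarrow> u x = 0"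
  shows "m \<le> j \<Longrightarrow> m \<le> n \<Longrightarrow> x \<in> topspace (Euclidean_space n) \<Longrightarrow> S \<le> \<bar>x j\<bar> \<Longrightarrow> mollify R \<kappa> \<alpha> m u x = 0"
proof (induction m arbitrary: x)
  case (Suc m)
  have m: "m < n" "m \<noteq> j" "m \<le> j" using Suc.prems by auto
  have "mollify R \<kappa> \<alpha> m u (x(m := s)) = 0" for s
  proof (rule Suc.IH[OF m(3) less_imp_le[OF m(1)] update_in_Euclidean_space[OF Suc.prems(3) m(1)]])
    show "S \<le> \<bar>(x(m := s)) j\<bar>" using Suc.prems(4) m(2) by simp
  qed
  then show ?case by (simp add: mollify1_def)
qed (simp add: assms)

text \<open>The functions of \<open>C_diff_mollify\<close> with the derivatives written the other
  way, on u instead of on the kernel. In this form they can be compared with the derivatives of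
  u.\<close>

lemma has_partials_mollify:
  assumes u: "has_partials n (topspace (Euclidean_space n)) u u'" and R: "0 \<le> R"
    and vanish: "\<And>x i. x \<in> topspace (Euclidean_space n) \<Longrightarrow> i < n \<Longrightarrow> R \<le> \<bar>x i\<bar> \<Longrightarrow> u x = 0"
  shows "m \<le> n \<Longrightarrow> has_partials n (topspace (Euclidean_space n)) (mollify R \<kappa> (\<lambda>_. 0) m u)
    (\<lambda>i. mollify R \<kappa> (\<lambda>_. 0) m (u' i))"
proof (induction m)
  case (Suc m)
  then have m: "m < n" by simp
  note v = has_partialsD[OF Suc.IH[OF less_imp_le[OF m]]]
  have D: "((\<lambda>t. mollify1 R m (\<kappa> 0) (mollify R \<kappa> (\<lambda>_. 0) m u) (x(i := t))) has_real_derivative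
      mollify1 R m (\<kappa> 0) (mollify R \<kappa> (\<lambda>_. 0) m (u' i)) x) (at (x i))"
    if i: "i < n" and x: "x \<in> topspace (Euclidean_space n)" for i x
  proof (cases "i = m")
    case True
    have "mollify1 R m (\<kappa> 1) (mollify R \<kappa> (\<lambda>_. 0) m u) x =
        mollify1 R m (\<kappa> 0) (mollify R \<kappa> (\<lambda>_. 0) m (u' m)) x"
    proof (rule mollify1_by_parts[OF v(1) m v(2)[OF m] v(3)[OF m]])
      show "(\<kappa> 0 has_real_derivative \<kappa> 1 y) (at y)" for y using DERIV_\<kappa>[of 0] by simp
      show "mollify R \<kappa> (\<lambda>_. 0) m u (x(m := R)) = 0"
        by (rule mollify_vanish[where S = R and j = m]) (use vanish m x R in simp_all)
      show "mollify R \<kappa> (\<lambda>_. 0) m u (x(m := -R)) = 0"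
        by (rule mollify_vanish[where S = R and j = m]) (use vanish m x R in simp_all)
    qed (use R x continuous_on_\<kappa> in auto)
    with DERIV_mollify1_kernel[OF v(1) m DERIV_\<kappa> continuous_on_\<kappa> x, of R 0] True
    show ?thesis by simp
  next
    case False
    show ?thesis
      by (rule DERIV_mollify1_inner[OF v(1) m i False v(2)[OF i] v(3)[OF i] continuous_on_\<kappa> x])
  qed
  have "has_partials n (topspace (Euclidean_space n)) (mollify1 R m (\<kappa> 0) (mollify R \<kappa> (\<lambda>_. 0) m u))
      (\<lambda>i. mollify1 R m (\<kappa> 0) (mollify R \<kappa> (\<lambda>_. 0) m (u' i)))"
    by (rule has_partialsI[OF continuous_on_mollify1[OF v(1) m continuous_on_\<kappa>]
          continuous_on_mollify1[OF v(2) m continuous_on_\<kappa>] D])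
  then show ?case by simp
qed (simp add: u)

context
  fixes r :: real
  assumes \<kappa>_support: "\<And>a x. r \<le> \<bar>x\<bar> \<Longrightarrow> \<kappa> a x = 0"
begin

text \<open>The value at x involves u only on the box of radius r around x, and after m steps only
  the first m coordinates have moved.\<close>

lemma mollify_eq_0:
  "m \<le> n \<Longrightarrow> x \<in> topspace (Euclidean_space n) \<Longrightarrow>
    (\<And>y. y \<in> topspace (Euclidean_space n) \<Longrightarrow> \<forall>i<m. \<bar>y i - x i\<bar> < r \<Longrightarrow> \<forall>i\<ge>m. y i = x i \<Longrightarrow> u y = 0) \<Longrightarrow>
    mollify R \<kappa> \<alpha> m u x = 0"
proof (induction m arbitrary: x)
  case 0
  from "0.prems"(3)[OF "0.prems"(2)] show ?case by simp
next
  case (Suc m)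
  have "mollify R \<kappa> \<alpha> m u (x(m := s)) * \<kappa> (\<alpha> m) (x m - s) = 0" for s
  proof (cases "r \<le> \<bar>x m - s\<bar>")
    case False
    have m: "m < n" using Suc.prems(1) by simp
    have "mollify R \<kappa> \<alpha> m u (x(m := s)) = 0"
    proof (rule Suc.IH[OF less_imp_le[OF m] update_in_Euclidean_space[OF Suc.prems(2) m]])
      fix y assume y: "y \<in> topspace (Euclidean_space n)" "\<forall>i<m. \<bar>y i - (x(m := s)) i\<bar> < r"
        "\<forall>i\<ge>m. y i = (x(m := s)) i"
      show "u y = 0"
      proof (rule Suc.prems(3)[OF y(1)])
        show "\<forall>i<Suc m. \<bar>y i - x i\<bar> < r"
          using y(2,3) False by (auto simp: less_Suc_eq abs_minus_commute)
        show "\<forall>i\<ge>Suc m. y i = x i"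
          using y(3) by auto
      qed
    qed
    then show ?thesis by simp
  qed (simp add: \<kappa>_support)
  then have "(\<lambda>s. mollify R \<kappa> \<alpha> m u (x(m := s)) * \<kappa> (\<alpha> m) (x m - s)) = (\<lambda>s. 0)" by (rule ext)
  then show ?case by (simp add: mollify1_def)
qed

text \<open>Each step averages over s within r of \<open>x m\<close>, which adds at most \<omega> to
  the error. Near the ends of [-R, R] the kernel loses mass, but there both functions vanish; this
  is the reason for the margin 2 r.\<close>

lemma mollify_close:
  assumes u: "continuous_on (topspace (Euclidean_space n)) u" and r: "0 < r" and R: "S + 2 * r \<le> R"
    and vanish: "\<And>x i. x \<in> topspace (Euclidean_space n) \<Longrightarrow> i < n \<Longrightarrow> S \<le> \<bar>x i\<bar> \<Longrightarrow> u x = 0"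
    and \<kappa>_nonneg: "\<And>x. 0 \<le> \<kappa> 0 x"
    and \<kappa>_int: "\<And>y. \<bar>y\<bar> + r \<le> R \<Longrightarrow> ((\<lambda>s. \<kappa> 0 (y - s)) has_integral 1) {-R..R}"
    and \<omega>: "\<And>x i s. x \<in> topspace (Euclidean_space n) \<Longrightarrow> i < n \<Longrightarrow> \<bar>s - x i\<bar> < r \<Longrightarrow>
      \<bar>u (x(i := s)) - u x\<bar> \<le> \<omega>"
  shows "m \<le> n \<Longrightarrow> x \<in> topspace (Euclidean_space n) \<Longrightarrow>
    \<bar>mollify R \<kappa> (\<lambda>_. 0) m u x - u x\<bar> \<le> real m * \<omega>"
proof (induction m arbitrary: x)
  case (Suc m)
  define v where "v = mollify R \<kappa> (\<lambda>_. 0) m u"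
  have m: "m < n" and x: "x \<in> topspace (Euclidean_space n)" using Suc.prems by auto
  have v: "continuous_on (topspace (Euclidean_space n)) v"
    unfolding v_def by (rule continuous_on_mollify[OF u]) (use m in simp)
  have close: "\<bar>v y - u y\<bar> \<le> real m * \<omega>" if "y \<in> topspace (Euclidean_space n)" for y
    unfolding v_def by (rule Suc.IH) (use m that in auto)
  have \<omega>0: "0 \<le> \<omega>" using \<omega>[OF x m, of "x m"] r by simp
  show ?case
  proof (cases "\<bar>x m\<bar> + r \<le> R")
    case True
    have i1: "(\<lambda>s. v (x(m := s)) * \<kappa> 0 (x m - s)) integrable_on {-R..R}"
      by (rule integrable_continuous_interval) (rule continuous_on_mollify1_integrand[OF v m continuous_on_\<kappa> x])
    note k1 = \<kappa>_int[OF True]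
    have i2: "((\<lambda>s. u x * \<kappa> 0 (x m - s)) has_integral u x) {-R..R}"
      using has_integral_mult_right[OF k1, of "u x"] by simp
    have i3: "((\<lambda>s. real (Suc m) * \<omega> * \<kappa> 0 (x m - s)) has_integral real (Suc m) * \<omega>) {-R..R}"
      using has_integral_mult_right[OF k1, of "real (Suc m) * \<omega>"] by simp
    have i4: "((\<lambda>s. v (x(m := s)) * \<kappa> 0 (x m - s) - u x * \<kappa> 0 (x m - s)) has_integral
        (mollify1 R m (\<kappa> 0) v x - u x)) {-R..R}"
      unfolding mollify1_def by (rule has_integral_diff[OF integrable_integral[OF i1] i2])
    have "norm (integral {-R..R} (\<lambda>s. v (x(m := s)) * \<kappa> 0 (x m - s) - u x * \<kappa> 0 (x m - s)))
        \<le> integral {-R..R} (\<lambda>s. real (Suc m) * \<omega> * \<kappa> 0 (x m - s))"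
    proof (rule integral_norm_bound_integral)
      fix s
      show "norm (v (x(m := s)) * \<kappa> 0 (x m - s) - u x * \<kappa> 0 (x m - s)) \<le> real (Suc m) * \<omega> * \<kappa> 0 (x m - s)"
      proof (cases "r \<le> \<bar>x m - s\<bar>")
        case False
        have "\<bar>v (x(m := s)) - u (x(m := s))\<bar> \<le> real m * \<omega>" by (rule close) (simp add: x m)
        moreover have "\<bar>u (x(m := s)) - u x\<bar> \<le> \<omega>" by (rule \<omega>[OF x m]) (use False in linarith)
        ultimately have "\<bar>v (x(m := s)) - u x\<bar> \<le> real (Suc m) * \<omega>" by (simp add: algebra_simps)
        then have "\<bar>v (x(m := s)) - u x\<bar> * \<kappa> 0 (x m - s) \<le> real (Suc m) * \<omega> * \<kappa> 0 (x m - s)"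
          by (rule mult_right_mono) (rule \<kappa>_nonneg)
        moreover have "norm (v (x(m := s)) * \<kappa> 0 (x m - s) - u x * \<kappa> 0 (x m - s)) =
            \<bar>v (x(m := s)) - u x\<bar> * \<kappa> 0 (x m - s)"
          unfolding left_diff_distrib[symmetric] real_norm_def abs_mult using \<kappa>_nonneg by simp
        ultimately show ?thesis by simp
      qed (simp add: \<kappa>_support)
    qed (use i3 i4 in blast)+
    then show ?thesis
      unfolding integral_unique[OF i3] integral_unique[OF i4] by (simp add: v_def del: of_nat_Suc)
  next
    case False
    \<comment> \<open>Here |x m| > R - r \<ge> S + r, so every s within r of \<open>x m\<close>
      satisfies |s| \<ge> S.\<close>
    have "v (x(m := s)) * \<kappa> 0 (x m - s) = 0" for s
    proof (cases "r \<le> \<bar>x m - s\<bar>")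
      case False': False
      have "v (x(m := s)) = 0"
        unfolding v_def by (rule mollify_vanish[where S = S and j = m]) (use vanish m x False False' R in simp_all)
      then show ?thesis by simp
    qed (simp add: \<kappa>_support)
    then have "(\<lambda>s. v (x(m := s)) * \<kappa> 0 (x m - s)) = (\<lambda>s. 0)" by (rule ext)
    then have "mollify R \<kappa> (\<lambda>_. 0) (Suc m) u x = 0" by (simp add: mollify1_def v_def)
    moreover have "u x = 0" by (rule vanish[OF x m]) (use False R r in linarith)
    ultimately show ?thesis using \<omega>0 by simp
  qed
qed simp

end

end

section \<open>Smooth approximation of compactly supported C^1 functions\<close>

lemma compact_cube:
  "compact {x \<in> topspace (Euclidean_space n). \<forall>i<n. \<bar>x i\<bar> \<le> a}"
proof -
  \<comment> \<open>Coordinates from n on range over the compact set {0}, so Tychonoff's theorem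
    applies to the full product.\<close>
  have "{x \<in> topspace (Euclidean_space n). \<forall>i<n. \<bar>x i\<bar> \<le> a} =
      PiE UNIV (\<lambda>i. if i < n then {-a..a} else {0::real})"
    by (auto simp: topspace_Euclidean_space PiE_iff abs_le_iff not_less split: if_splits) (metis minus_le_iff not_less)+
  moreover have "compactin (product_topology (\<lambda>i. euclidean) UNIV) (PiE UNIV (\<lambda>i. if i < n then {-a..a} else {0::real}))"
    unfolding compactin_PiE by simp
  ultimately show ?thesis by (simp add: euclidean_product_topology)
qed

lemma uniform_continuity_update:
  fixes u :: "(nat \<Rightarrow> real) \<Rightarrow> real"
  assumes u: "continuous_on (topspace (Euclidean_space n)) u"
    and vanish: "\<And>x i. x \<in> topspace (Euclidean_space n) \<Longrightarrow> i < n \<Longrightarrow> S \<le> \<bar>x i\<bar> \<Longrightarrow> u x = 0"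
    and \<omega>: "0 < \<omega>"
  shows "\<forall>\<^sub>F r in at_right 0. \<forall>x\<in>topspace (Euclidean_space n). \<forall>i<n. \<forall>s.
    \<bar>s - x i\<bar> < r \<longrightarrow> \<bar>u (x(i := s)) - u x\<bar> \<le> \<omega>"
proof -
  \<comment> \<open>Radius S + 1, not S: a point outside C still has some |x j| \<ge> S after a
    shift by |t| < 1, so u vanishes before and after the shift, and uniformity is needed on the
    compact cube only.\<close>
  define C where "C = {x \<in> topspace (Euclidean_space n). \<forall>i<n. \<bar>x i\<bar> \<le> S + 1}"
  have C: "compact C" unfolding C_def by (rule compact_cube)
  have ev: "\<forall>\<^sub>F t in nhds 0. \<forall>x\<in>topspace (Euclidean_space n). \<bar>u (x(i := x i + t)) - u x\<bar> \<le> \<omega>"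
    if i: "i < n" for i
  proof -
    have fst: "continuous_on (UNIV \<times> C) fst" and snd: "continuous_on (UNIV \<times> C) snd"
      by (intro continuous_on_fst continuous_on_snd continuous_on_id)+
    have 1: "continuous_on (UNIV \<times> C) (\<lambda>z :: real \<times> (nat \<Rightarrow> real). u ((snd z)(i := snd z i + fst z)))"
      by (rule continuous_on_compose_update[OF u i snd continuous_on_add[OF
              continuous_on_product_then_coordinatewise[OF snd] fst]]) (auto simp: C_def)
    have 2: "continuous_on (UNIV \<times> C) (\<lambda>z :: real \<times> (nat \<Rightarrow> real). u (snd z))"
      by (rule continuous_on_compose2[OF u snd]) (auto simp: C_def)
    obtain X where X: "0 \<in> X" "open X" "\<forall>t\<in>X \<inter> UNIV. \<forall>x\<in>C.
        dist (u ((snd (t, x))(i := snd (t, x) i + fst (t, x))) - u (snd (t, x)))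
          (u ((snd (0::real, x))(i := snd (0::real, x) i + fst (0::real, x))) - u (snd (0::real, x))) \<le> \<omega>"
      using continuous_on_prod_compactE[OF continuous_on_diff[OF 1 2] C UNIV_I \<omega>] by blast
    have "\<forall>\<^sub>F t in nhds 0. t \<in> X" by (rule eventually_nhds_in_open[OF X(2,1)])
    moreover have "\<forall>\<^sub>F t::real in nhds 0. \<bar>t\<bar> < 1"
      using eventually_nhds_in_open[of "{-1<..<1::real}" 0] by (auto elim: eventually_mono)
    ultimately show ?thesis
    proof eventually_elim
      case (elim t)
      show ?case
      proof
        fix x assume x: "x \<in> topspace (Euclidean_space n)"
        show "\<bar>u (x(i := x i + t)) - u x\<bar> \<le> \<omega>"
        proof (cases "x \<in> C")
          case True
          then show ?thesis using X(3) elim(1) by (auto simp: dist_real_def)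
        next
          case False
          then obtain j where j: "j < n" "S + 1 < \<bar>x j\<bar>" using x by (auto simp: C_def not_le)
          have "u x = 0" by (rule vanish[OF x j(1)]) (use j in simp)
          moreover have "u (x(i := x i + t)) = 0"
            by (rule vanish[OF update_in_Euclidean_space[OF x i] j(1)]) (use j elim(2) in auto)
          ultimately show ?thesis using \<omega> by simp
        qed
      qed
    qed
  qed
  have "\<forall>\<^sub>F t in nhds 0. \<forall>i\<in>{..<n}. \<forall>x\<in>topspace (Euclidean_space n). \<bar>u (x(i := x i + t)) - u x\<bar> \<le> \<omega>"
    by (rule eventually_ball_finite) (use ev in auto)
  then obtain d where d: "d > 0" "\<And>t i x. dist t 0 < d \<Longrightarrow> i < n \<Longrightarrow> x \<in> topspace (Euclidean_space n) \<Longrightarrow>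
      \<bar>u (x(i := x i + t)) - u x\<bar> \<le> \<omega>"
    unfolding eventually_nhds_metric by auto
  have "\<forall>x\<in>topspace (Euclidean_space n). \<forall>i<n. \<forall>s. \<bar>s - x i\<bar> < r \<longrightarrow> \<bar>u (x(i := s)) - u x\<bar> \<le> \<omega>"
    if "r < d" for r
    using d(2)[of "s - x i" i x for s x i] that by (force simp: dist_real_def)
  then show ?thesis
    using eventually_at_right_less[of 0] d(1) unfolding eventually_at_right_field by blast
qed

text \<open>Mollification at a small scale. The last property limits how far the support spreads; it
  will keep an infinite sum of such functions locally finite.\<close>

lemma smooth_approx_compact_support:
  assumes u: "has_partials n (topspace (Euclidean_space n)) u u'"
    and S: "0 \<le> S" "\<And>x i. x \<in> topspace (Euclidean_space n) \<Longrightarrow> i < n \<Longrightarrow> S \<le> \<bar>x i\<bar> \<Longrightarrow> u x = 0"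
    and \<epsilon>: "0 < \<epsilon>" and \<rho>: "0 < \<rho>"
  obtains h h' where "\<And>d. C_diff n d (topspace (Euclidean_space n)) h"
    and "has_partials n (topspace (Euclidean_space n)) h h'"
    and "\<And>x. x \<in> topspace (Euclidean_space n) \<Longrightarrow> \<bar>h x - u x\<bar> \<le> \<epsilon>"
    and "\<And>x i. x \<in> topspace (Euclidean_space n) \<Longrightarrow> i < n \<Longrightarrow> \<bar>h' i x - u' i x\<bar> \<le> \<epsilon>"
    and "\<And>x. x \<in> topspace (Euclidean_space n) \<Longrightarrow>
      (\<And>y. y \<in> topspace (Euclidean_space n) \<Longrightarrow> \<forall>i<n. \<bar>y i - x i\<bar> < \<rho> \<Longrightarrow> u y = 0) \<Longrightarrow> h x = 0"
proof -
  note cont = has_partialsD(1,2)[OF u]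
  have vanish: "u x = 0" if "x \<in> topspace (Euclidean_space n)" "i < n" "S + 1 \<le> \<bar>x i\<bar>" for x i
    by (rule S(2)[OF that(1,2)]) (use that(3) in simp)
  \<comment> \<open>At distance 1 beyond S, u is 0 along a whole piece of the coordinate line, and
    so is its derivative. Hence the radius S + 1 serves for u and for all
    \<open>u' i\<close>.\<close>
  have vanish': "u' i x = 0" if x: "x \<in> topspace (Euclidean_space n)" and i: "i < n" and j: "j < n" "S + 1 \<le> \<bar>x j\<bar>" for x i j
  proof -
    have "\<forall>\<^sub>F t in nhds (x i). \<bar>t - x i\<bar> < 1"
      using eventually_nhds_in_open[of "{x i - 1<..<x i + 1}" "x i"] by (auto elim: eventually_mono)
    then have "\<forall>\<^sub>F t in nhds (x i). u (x(i := t)) = 0"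
    proof eventually_elim
      case (elim t)
      show ?case
        by (rule S(2)[OF update_in_Euclidean_space[OF x i] j(1)]) (use j elim in auto)
    qed
    then have "((\<lambda>t. u (x(i := t))) has_real_derivative 0) (at (x i)) \<longleftrightarrow>
        ((\<lambda>t. 0) has_real_derivative 0) (at (x i))"
      by (intro DERIV_cong_ev) auto
    then have "((\<lambda>t. u (x(i := t))) has_real_derivative 0) (at (x i))" by simp
    with has_partialsD(3)[OF u i x] show ?thesis by (rule DERIV_unique)
  qed
  \<comment> \<open>\<open>mollify_close\<close> loses n \<omega>; dividing by n + 1 also covers n =
    0.\<close>
  define \<omega> where "\<omega> = \<epsilon> / (n + 1)"
  have \<omega>: "0 < \<omega>" "real n * \<omega> \<le> \<epsilon>" using \<epsilon> by (auto simp: \<omega>_def field_simps)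
  define MU where "MU w r \<longleftrightarrow> (\<forall>x\<in>topspace (Euclidean_space n). \<forall>i<n. \<forall>s.
      \<bar>s - x i\<bar> < r \<longrightarrow> \<bar>w (x(i := s)) - w x\<bar> \<le> \<omega>)" for w :: "(nat \<Rightarrow> real) \<Rightarrow> real" and r
  have "\<forall>\<^sub>F r in at_right 0. \<forall>i\<in>{..<n}. MU (u' i) r"
  proof (rule eventually_ball_finite[OF finite_lessThan], rule ballI)
    fix i assume "i \<in> {..<n}"
    then have i: "i < n" by simp
    show "\<forall>\<^sub>F r in at_right 0. MU (u' i) r"
      unfolding MU_def by (rule uniform_continuity_update[OF cont(2)[OF i] vanish'[OF _ i] \<omega>(1)])
  qed
  moreover have "\<forall>\<^sub>F r in at_right 0. MU u r"
    unfolding MU_def by (rule uniform_continuity_update[OF cont(1) vanish \<omega>(1)])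
  moreover have "\<forall>\<^sub>F r in at_right (0::real). r \<in> {0<..<\<rho>}"
    by (rule eventually_at_right_real[OF \<rho>])
  ultimately have "\<forall>\<^sub>F r in at_right 0. (\<forall>i\<in>{..<n}. MU (u' i) r) \<and> MU u r \<and> r \<in> {0<..<\<rho>}"
    by (intro eventually_conj)
  then obtain r where MU: "\<forall>i\<in>{..<n}. MU (u' i) r" "MU u r" and "r \<in> {0<..<\<rho>}"
    using eventually_happens'[OF trivial_limit_at_right_real] by blast
  then have r: "0 < r" "r < \<rho>" by simp_all
  have mod_u: "\<bar>u (x(i := s)) - u x\<bar> \<le> \<omega>"
    if "x \<in> topspace (Euclidean_space n)" "i < n" "\<bar>s - x i\<bar> < r" for x i s
    using MU(2) that unfolding MU_def by blast
  have mod_u': "\<bar>u' i (x(j := s)) - u' i x\<bar> \<le> \<omega>"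
    if i: "i < n" and "x \<in> topspace (Euclidean_space n)" "j < n" "\<bar>s - x j\<bar> < r" for i x j s
  proof -
    have "MU (u' i) r" using MU(1) i by simp
    then show ?thesis using that unfolding MU_def by blast
  qed
  define R where "R = S + 1 + 2 * r"
  have R: "0 \<le> R" "S + 1 + 2 * r \<le> R" "S + 1 \<le> R" using S(1) r by (auto simp: R_def)
  obtain \<kappa> :: "nat \<Rightarrow> real \<Rightarrow> real"
    where \<kappa>: "\<And>a x. (\<kappa> a has_real_derivative \<kappa> (Suc a) x) (at x)"
      "\<And>a x. r \<le> \<bar>x\<bar> \<Longrightarrow> \<kappa> a x = 0" "\<And>x. 0 \<le> \<kappa> 0 x"
      "\<And>y R. \<bar>y\<bar> + r \<le> R \<Longrightarrow> ((\<lambda>s. \<kappa> 0 (y - s)) has_integral 1) {-R..R}"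
    using smooth_kernel_exists[OF r(1)] by blast
  show thesis
  proof (rule that)
    show "C_diff n d (topspace (Euclidean_space n)) (mollify R \<kappa> (\<lambda>_. 0) n u)" for d
      by (rule C_diff_mollify[where \<kappa> = \<kappa>, OF \<kappa>(1) cont(1)])
    show "has_partials n (topspace (Euclidean_space n)) (mollify R \<kappa> (\<lambda>_. 0) n u)
        (\<lambda>i. mollify R \<kappa> (\<lambda>_. 0) n (u' i))"
      by (rule has_partials_mollify[where \<kappa> = \<kappa>, OF \<kappa>(1) u R(1) _ order_refl])
        (use R(3) in \<open>auto intro: S(2)\<close>)
    show "\<bar>mollify R \<kappa> (\<lambda>_. 0) n u x - u x\<bar> \<le> \<epsilon>" if "x \<in> topspace (Euclidean_space n)" for x
      by (rule order_trans[OF _ \<omega>(2)], rule mollify_close[where \<kappa> = \<kappa>, OF \<kappa>(1,2) cont(1) r(1) R(2) vanish \<kappa>(3,4) mod_u order_refl that])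
    show "\<bar>mollify R \<kappa> (\<lambda>_. 0) n (u' i) x - u' i x\<bar> \<le> \<epsilon>"
      if "x \<in> topspace (Euclidean_space n)" "i < n" for x i
      by (rule order_trans[OF _ \<omega>(2)], rule mollify_close[where \<kappa> = \<kappa>, OF \<kappa>(1,2) cont(2)[OF that(2)] r(1) R(2)
            vanish'[OF _ that(2)] \<kappa>(3,4) mod_u'[OF that(2)] order_refl that(1)])
    show "mollify R \<kappa> (\<lambda>_. 0) n u x = 0" if x: "x \<in> topspace (Euclidean_space n)"
      and 0: "\<And>y. y \<in> topspace (Euclidean_space n) \<Longrightarrow> \<forall>i<n. \<bar>y i - x i\<bar> < \<rho> \<Longrightarrow> u y = 0" for x
    proof (rule mollify_eq_0[where \<kappa> = \<kappa>, OF \<kappa>(1,2) order_refl x])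
      fix y assume y: "y \<in> topspace (Euclidean_space n)" "\<forall>i<n. \<bar>y i - x i\<bar> < r"
      show "u y = 0" by (rule 0[OF y(1)]) (use y(2) r(2) in fastforce)
    qed
  qed
qed

section \<open>Smooth approximation on open sets\<close>

text \<open>A cylinder: coordinates from n on are free. It is thus open in the product topology, and
  its intersection with \<open>topspace (Euclidean_space n)\<close> is the box.\<close>

definition cube :: "nat \<Rightarrow> (nat \<Rightarrow> real) \<Rightarrow> real \<Rightarrow> (nat \<Rightarrow> real) set"
  where "cube n a r = {x. \<forall>i<n. \<bar>x i - a i\<bar> < r}"

lemma open_cube: "open (cube n a r)"
proof -
  have "cube n a r = (\<Inter>i\<in>{..<n}. {x. \<bar>x i - a i\<bar> < r})" by (auto simp: cube_def)
  moreover have "open {x :: nat \<Rightarrow> real. \<bar>x i - a i\<bar> < r}" for i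
    by (intro open_Collect_less continuous_on_rabs continuous_on_diff continuous_on_const
        continuous_on_product_coordinates)
  ultimately show ?thesis by (simp add: open_INT)
qed

lemma openin_Euclidean_space_cube:
  assumes G: "openin (Euclidean_space n) G" and x: "x \<in> G"
  obtains r where "0 < r" "topspace (Euclidean_space n) \<inter> cube n x r \<subseteq> G"
proof -
  obtain U where U: "open U" "G = topspace (Euclidean_space n) \<inter> U"
    using openin_Euclidean_spaceE[OF G] .
  have "openin (product_topology (\<lambda>i. euclidean) UNIV) U" "x \<in> U"
    using U x by (auto simp: euclidean_product_topology)
  from product_topology_open_contains_basis[OF this]
  obtain X where X: "x \<in> PiE UNIV X" "\<And>i. open (X i)" "PiE UNIV X \<subseteq> U" by auto
  have "\<exists>r>0. \<forall>t. \<bar>t - x i\<bar> < r \<longrightarrow> t \<in> X i" for i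
    using X(2)[of i] X(1) by (auto simp: open_dist dist_real_def PiE_iff)
  then obtain r where r: "\<And>i. 0 < r i" "\<And>i t. \<bar>t - x i\<bar> < r i \<Longrightarrow> t \<in> X i" by metis
  define \<delta> where "\<delta> = Min (insert 1 (r ` {..<n}))"
  have \<delta>: "0 < \<delta>" "\<And>i. i < n \<Longrightarrow> \<delta> \<le> r i"
    unfolding \<delta>_def using r(1) by (auto simp: Min_gr_iff)
  show thesis
  proof (rule that[OF \<delta>(1)])
    show "topspace (Euclidean_space n) \<inter> cube n x \<delta> \<subseteq> G"
    proof
      fix y assume y: "y \<in> topspace (Euclidean_space n) \<inter> cube n x \<delta>"
      have "y i \<in> X i" for i
      proof (cases "i < n")
        case True
        then have "\<bar>y i - x i\<bar> < r i" using y \<delta>(2)[OF True] by (auto simp: cube_def)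
        then show ?thesis by (rule r(2))
      next
        case False
        then have "y i = x i" using y U x by (auto simp: topspace_Euclidean_space)
        then show ?thesis using X(1) by (auto simp: PiE_iff)
      qed
      then have "y \<in> U" using X(3) by (auto simp: PiE_iff)
      then show "y \<in> G" using y U(2) by blast
    qed
  qed
qed

section \<open>A partition of unity of class C^1 and the approximation on open sets\<close>

lemma has_partials_prod:
  assumes "finite I" "\<And>k. k \<in> I \<Longrightarrow> \<exists>f'. has_partials n A (f k) f'"
  shows "\<exists>f'. has_partials n A (\<lambda>x. \<Prod>k\<in>I. f k x) f'"
  using assms
proof (induction I rule: finite_induct)
  case empty
  then show ?case using has_partials_const[of n A 1] by auto
next
  case (insert k I)
  obtain f' where f': "has_partials n A (f k) f'" using insert.prems[of k] by auto
  obtain g' where g': "has_partials n A (\<lambda>x. \<Prod>k\<in>I. f k x) g'" using insert.IH insert.prems by blast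
  from has_partials_mult[OF f' g'] show ?case using insert(1,2) by auto
qed

lemma has_partials_canonical:
  assumes "has_partials n A f f'" "openin (Euclidean_space n) A"
  shows "has_partials n A f (\<lambda>i. partial_deriv i f)"
  by (rule has_partials_cong[OF assms]) (simp_all add: has_partials_partial_deriv[OF assms(1)])

text \<open>Building block of the cutoffs. These are only C^1, like the function that they multiply;
  mollification restores smoothness.\<close>

lemma DERIV_max_0_sq: "((\<lambda>y :: real. (max 0 y)\<^sup>2) has_real_derivative 2 * max 0 y) (at y)"
proof (cases y "0::real" rule: linorder_cases)
  case less
  have "\<forall>\<^sub>F z in nhds y. (max 0 z)\<^sup>2 = 0"
    using eventually_nhds_in_open[of "{..<0}" y] less by (auto elim!: eventually_mono)
  then have "((\<lambda>y :: real. (max 0 y)\<^sup>2) has_real_derivative 0) (at y) \<longleftrightarrow> ((\<lambda>y. 0) has_real_derivative 0) (at y)"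
    by (intro DERIV_cong_ev) auto
  then show ?thesis using less by simp
next
  case greater
  have "\<forall>\<^sub>F z in nhds y. (max 0 z)\<^sup>2 = z\<^sup>2"
    using eventually_nhds_in_open[of "{0<..}" y] greater by (auto elim!: eventually_mono)
  then have "((\<lambda>y :: real. (max 0 y)\<^sup>2) has_real_derivative 2 * y) (at y) \<longleftrightarrow> ((\<lambda>y. y\<^sup>2) has_real_derivative 2 * y) (at y)"
    by (intro DERIV_cong_ev) auto
  moreover have "((\<lambda>y. y\<^sup>2) has_real_derivative 2 * y) (at y)" by (auto intro!: derivative_eq_intros)
  ultimately show ?thesis using greater by simp
next
  case equal
  have "((\<lambda>h :: real. max 0 h) \<longlongrightarrow> max 0 0) (at 0)"
    by (intro tendsto_max tendsto_const tendsto_ident_at)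
  moreover have "(\<lambda>h :: real. ((max 0 (0 + h))\<^sup>2 - (max 0 0)\<^sup>2) / h) = (\<lambda>h. max 0 h)"
    by (auto simp: fun_eq_iff max_def power2_eq_square)
  ultimately have "((\<lambda>y :: real. (max 0 y)\<^sup>2) has_real_derivative 0) (at 0)"
    unfolding DERIV_def by simp
  then show ?thesis using equal by simp
qed

lemma cube_bump_exists:
  assumes \<delta>: "0 < \<delta>"
  obtains b where "\<And>A. \<exists>b'. has_partials n A b b'"
    and "\<And>x. x \<in> cube n a \<delta> \<Longrightarrow> b x = (1 :: real)"
    and "\<And>x i. i < n \<Longrightarrow> 2 * \<delta> \<le> \<bar>x i - a i\<bar> \<Longrightarrow> b x = 0"
proof -
  define \<gamma> where "\<gamma> y = (max 0 y)\<^sup>2" for y :: real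
  have D: "(\<gamma> has_real_derivative 2 * max 0 y) (at y)" for y
    unfolding \<gamma>_def[abs_def] by (rule DERIV_max_0_sq)
  have C: "continuous_on UNIV (\<lambda>y :: real. 2 * max 0 y)"
    by (intro continuous_on_mult continuous_on_max continuous_on_const continuous_on_id)
  define c where "c i x = (x i + - a i) * (1 / \<delta>)" for i and x :: "nat \<Rightarrow> real"
  \<comment> \<open>For |c| \<le> 1 the inner \<gamma> is 0 and B = 1; for |c| \<ge> 2 the inner
    \<gamma> is at least 9, the outer argument is negative, and B = 0.\<close>
  define B where "B i x = \<gamma> (1 + (-1) * \<gamma> (c i x * c i x + (-1)))" for i x
  have B: "\<exists>b'. has_partials n A (B i) b'" for i A
  proof -
    have 1: "\<exists>p. has_partials n A (c i) p"
      unfolding c_def[abs_def]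
      by (rule exI, rule has_partials_mult, rule has_partials_add, rule has_partials_coordinate,
          rule has_partials_const, rule has_partials_const)
    then obtain p where p: "has_partials n A (c i) p" ..
    have 2: "has_partials n A (\<lambda>x. c i x * c i x + (-1)) (\<lambda>j x. p j x * c i x + p j x * c i x + 0)"
      by (rule has_partials_add[OF has_partials_mult[OF p p] has_partials_const])
    obtain q where q: "has_partials n A (\<lambda>x. \<gamma> (c i x * c i x + (-1))) q"
      using has_partials_compose[OF 2 D C] by blast
    have 3: "has_partials n A (\<lambda>x. 1 + (-1) * \<gamma> (c i x * c i x + (-1))) (\<lambda>j x. 0 + (-1) * q j x)"
      by (rule has_partials_add[OF has_partials_const has_partials_cmult[OF q]])
    show ?thesis unfolding B_def[abs_def] using has_partials_compose[OF 3 D C] by blast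
  qed
  show thesis
  proof (rule that)
    show "\<exists>b'. has_partials n A (\<lambda>x. \<Prod>i<n. B i x) b'" for A
      by (rule has_partials_prod[OF finite_lessThan B])
    show "(\<Prod>i<n. B i x) = 1" if x: "x \<in> cube n a \<delta>" for x
    proof (rule prod.neutral, rule ballI)
      fix i assume "i \<in> {..<n}"
      then have "\<bar>x i - a i\<bar> < \<delta>" using x by (simp add: cube_def)
      then have "\<bar>c i x\<bar> < 1" using \<delta> by (simp add: c_def abs_mult)
      then have "c i x * c i x \<le> 1" using abs_square_le_1[of "c i x"] by (simp add: power2_eq_square)
      then show "B i x = 1" by (simp add: B_def \<gamma>_def max_def)
    qed
    show "(\<Prod>i<n. B i x) = 0" if i: "i < n" and x: "2 * \<delta> \<le> \<bar>x i - a i\<bar>" for x i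
    proof -
      have "2 \<le> \<bar>c i x\<bar>" using \<delta> x by (simp add: c_def abs_mult field_simps)
      then have "2 * 2 \<le> \<bar>c i x\<bar> * \<bar>c i x\<bar>" by (intro mult_mono) auto
      then have 3: "3 \<le> c i x * c i x - 1" by (simp add: abs_mult_self)
      then have "3 * 3 \<le> (c i x * c i x - 1) * (c i x * c i x - 1)" by (intro mult_mono) auto
      with 3 have "B i x = 0" by (simp add: B_def \<gamma>_def max_def power2_eq_square)
      with i show ?thesis by (intro prod_zero) auto
    qed
  qed
qed

text \<open>Telescoping. If \<open>b j = 1\<close> for some j < N, the product on the right vanishes
  and the sum is 1.\<close>

lemma sum_partition_of_unity:
  fixes b :: "nat \<Rightarrow> real"
  shows "(\<Sum>k<N. b k * (\<Prod>j<k. 1 - b j)) = 1 - (\<Prod>k<N. 1 - b k)"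
  by (induction N) (simp_all add: algebra_simps)

lemma sum_half_powers: "(\<Sum>k<N. \<epsilon> * (1/2) ^ Suc k) = \<epsilon> * (1 - (1/2::real) ^ N)"
  by (induction N) (simp_all add: field_simps)

text \<open>The pieces \<open>\<psi> k * g\<close> are extended by 0 to all of R^n, and the
  approximant of the k-th one may enlarge the support by at most 1 / (k + 1). The shrinking
  enlargement keeps the approximants locally finite, so their sum is smooth on G.\<close>

lemma smooth_approx:
  assumes G: "openin (Euclidean_space n) G" and g: "has_partials n G g g'" and \<epsilon>: "0 < \<epsilon>"
  obtains f where "smooth n G f" "\<And>x. x \<in> G \<Longrightarrow> \<bar>f x - g x\<bar> \<le> \<epsilon>"
    "\<And>x i. x \<in> G \<Longrightarrow> i < n \<Longrightarrow> \<bar>partial_deriv i f x - g' i x\<bar> \<le> \<epsilon>"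
proof (cases "G = {}")
  case True
  have "smooth n G (\<lambda>x. 0)" unfolding smooth_def using C_diff_zero[OF G] by blast
  then show thesis by (rule that) (simp_all add: True)
next
  case G_nonempty: False
  let ?E = "topspace (Euclidean_space n)"
  have GE: "G \<subseteq> ?E" using openin_subset[OF G] .
  \<comment> \<open>The factor 2 leaves room for the cutoff: it is 1 on a cube and 0 from twice the
    radius on, and the closed cube of twice the radius still lies in G.\<close>
  have "\<exists>\<delta>>0. \<forall>y\<in>?E. (\<forall>i<n. \<bar>y i - x i\<bar> \<le> 2 * \<delta>) \<longrightarrow> y \<in> G" if x: "x \<in> G" for x
  proof -
    obtain r where r: "0 < r" "?E \<inter> cube n x r \<subseteq> G" using openin_Euclidean_space_cube[OF G x] .
    have "y \<in> G" if "y \<in> ?E" "\<forall>i<n. \<bar>y i - x i\<bar> \<le> 2 * (r / 3)" for y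
    proof -
      have "\<bar>y i - x i\<bar> < r" if "i < n" for i
      proof -
        have "\<bar>y i - x i\<bar> \<le> 2 * (r / 3)" using \<open>\<forall>i<n. \<bar>y i - x i\<bar> \<le> 2 * (r / 3)\<close> that by blast
        with r(1) show ?thesis by simp
      qed
      then show ?thesis using r(2) \<open>y \<in> ?E\<close> by (auto simp: cube_def)
    qed
    then show ?thesis using r(1) by (intro exI[of _ "r / 3"]) auto
  qed
  then obtain \<Delta> where \<Delta>: "\<And>x. x \<in> G \<Longrightarrow> 0 < \<Delta> x"
    "\<And>x y. x \<in> G \<Longrightarrow> y \<in> ?E \<Longrightarrow> \<forall>i<n. \<bar>y i - x i\<bar> \<le> 2 * \<Delta> x \<Longrightarrow> y \<in> G" by metis
  \<comment> \<open>Countably many of these cubes cover G. Their centres are listed by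
    \<open>from_nat_into\<close>, possibly with repetitions, so that finite and infinite covers are
    treated alike.\<close>
  have "\<And>S. S \<in> (\<lambda>x. cube n x (\<Delta> x)) ` G \<Longrightarrow> open S" using open_cube by auto
  then obtain F where F: "F \<subseteq> (\<lambda>x. cube n x (\<Delta> x)) ` G" "countable F" "\<Union>F = \<Union>((\<lambda>x. cube n x (\<Delta> x)) ` G)"
    by (rule Lindelof)
  have "\<exists>A. countable A \<and> A \<subseteq> G \<and> F = (\<lambda>x. cube n x (\<Delta> x)) ` A"
    using F(1,2) countable_subset_image[of F "\<lambda>x. cube n x (\<Delta> x)" G] by simp
  then obtain A where A: "countable A" "A \<subseteq> G" "F = (\<lambda>x. cube n x (\<Delta> x)) ` A" by blast
  have cover: "\<exists>a\<in>A. x \<in> cube n a (\<Delta> a)" if "x \<in> G" for x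
  proof -
    have "x \<in> cube n x (\<Delta> x)" using \<Delta>(1)[OF that] by (simp add: cube_def)
    then have "x \<in> \<Union>F" using F(3) that by blast
    then show ?thesis using A(3) by blast
  qed
  then have "A \<noteq> {}" using G_nonempty by blast
  define a where "a = from_nat_into A"
  define \<delta> where "\<delta> k = \<Delta> (a k)" for k
  have aG: "a k \<in> G" for k using from_nat_into[OF \<open>A \<noteq> {}\<close>] A(2) by (auto simp: a_def)
  have \<delta>: "0 < \<delta> k" for k using \<Delta>(1)[OF aG] by (simp add: \<delta>_def)
  have inG: "y \<in> G" if "y \<in> ?E" "\<forall>i<n. \<bar>y i - a k i\<bar> \<le> 2 * \<delta> k" for y k
    using \<Delta>(2)[OF aG that(1)] that(2) by (simp add: \<delta>_def)
  have cover: "\<exists>j. x \<in> cube n (a j) (\<delta> j)" if x: "x \<in> G" for x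
    using cover[OF x] from_nat_into_surj[OF A(1)] unfolding a_def \<delta>_def by metis
  have "\<exists>b :: (nat \<Rightarrow> real) \<Rightarrow> real. (\<forall>A. \<exists>b'. has_partials n A b b') \<and> (\<forall>x\<in>cube n (a k) (\<delta> k). b x = 1) \<and>
      (\<forall>x. \<forall>i<n. 2 * \<delta> k \<le> \<bar>x i - a k i\<bar> \<longrightarrow> b x = 0)" for k
    by (rule cube_bump_exists[OF \<delta>[of k], of n "a k"]) (rule exI, intro conjI allI ballI impI, assumption+)
  then obtain b :: "nat \<Rightarrow> (nat \<Rightarrow> real) \<Rightarrow> real"
    where b: "\<And>k A. \<exists>b'. has_partials n A (b k) b'" "\<And>k x. x \<in> cube n (a k) (\<delta> k) \<Longrightarrow> b k x = 1"
      "\<And>k x i. i < n \<Longrightarrow> 2 * \<delta> k \<le> \<bar>x i - a k i\<bar> \<Longrightarrow> b k x = 0" by metis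
  \<comment> \<open>On the j-th cube \<open>b j = 1\<close>, so \<open>\<psi> k\<close> vanishes
    there for all k > j. This makes the sum locally finite although the cubes may overlap infinitely
    often.\<close>
  define \<psi> where "\<psi> k x = b k x * (\<Prod>j<k. 1 + (-1) * b j x)" for k x
  have \<psi>_partials: "\<exists>p. has_partials n A (\<psi> k) p" for k A
  proof -
    have "\<exists>p. has_partials n A (\<lambda>x. \<Prod>j<k. 1 + (-1) * b j x) p"
    proof (rule has_partials_prod)
      fix j
      obtain b' where "has_partials n A (b j) b'" using b(1) by blast
      from has_partials_add[OF has_partials_const has_partials_cmult[OF this]]
      show "\<exists>p. has_partials n A (\<lambda>x. 1 + (-1) * b j x) p" by blast
    qed simp
    then obtain p where p: "has_partials n A (\<lambda>x. \<Prod>j<k. 1 + (-1) * b j x) p" by blast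
    obtain b' where b': "has_partials n A (b k) b'" using b(1) by blast
    from has_partials_mult[OF b' p] show ?thesis unfolding \<psi>_def[abs_def] by blast
  qed
  have \<psi>_0: "\<psi> k x = 0" if "i < n" "2 * \<delta> k \<le> \<bar>x i - a k i\<bar>" for k x i
    using b(3)[where k = k and x = x and i = i, OF that] by (simp add: \<psi>_def)
  have \<psi>_0': "\<psi> k x = 0" if "j < k" "x \<in> cube n (a j) (\<delta> j)" for j k x
    using b(2)[OF that(2)] that(1) by (auto simp: \<psi>_def intro!: prod_zero)
  have \<psi>_sum: "(\<Sum>k<N. \<psi> k x) = 1" if "j < N" "x \<in> cube n (a j) (\<delta> j)" for j N x
  proof -
    have "(\<Sum>k<N. \<psi> k x) = 1 - (\<Prod>k<N. 1 - b k x)"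
      using sum_partition_of_unity[of "\<lambda>k. b k x" N] by (simp add: \<psi>_def)
    moreover have "(\<Prod>k<N. 1 - b k x) = 0" using b(2)[OF that(2)] that(1) by (auto intro!: prod_zero)
    ultimately show ?thesis by simp
  qed
  define u where "u k x = (if x \<in> G then \<psi> k x * g x else 0)" for k x
  \<comment> \<open>The extension by 0 is C^1: off G some coordinate leaves the closed cube of
    radius \<open>2 * \<delta> k\<close>. This persists on a neighbourhood, and
    \<open>\<psi> k\<close> vanishes there.\<close>
  have u_partials: "has_partials n ?E (u k) (\<lambda>i. partial_deriv i (u k))" for k
  proof (rule has_partials_locally[OF subset_refl])
    fix x assume x: "x \<in> ?E"
    show "\<exists>B. openin (Euclidean_space n) B \<and> x \<in> B \<and> has_partials n B (u k) (\<lambda>i. partial_deriv i (u k))"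
    proof (cases "x \<in> G")
      case True
      obtain p where "has_partials n G (\<psi> k) p" using \<psi>_partials by blast
      from has_partials_mult[OF this g]
      have "has_partials n G (u k) (\<lambda>i x. p i x * g x + g' i x * \<psi> k x)"
        by (rule has_partials_cong[OF _ G]) (simp_all add: u_def)
      from has_partials_canonical[OF this G] G True show ?thesis by blast
    next
      case False
      then obtain i where i: "i < n" "2 * \<delta> k < \<bar>x i - a k i\<bar>" using inG[OF x] by (meson not_le)
      define B where "B = ?E \<inter> {y. 2 * \<delta> k < \<bar>y i - a k i\<bar>}"
      have "open {y :: nat \<Rightarrow> real. 2 * \<delta> k < \<bar>y i - a k i\<bar>}"
        by (intro open_Collect_less continuous_on_rabs continuous_on_diff continuous_on_const
            continuous_on_product_coordinates)
      then have B: "openin (Euclidean_space n) B" unfolding B_def by (rule openin_Euclidean_spaceI)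
      have "u k y = 0" if "y \<in> B" for y
        using \<psi>_0[OF i(1), of k y] that by (simp add: u_def B_def)
      then have "has_partials n B (u k) (\<lambda>i x. 0)"
        by (intro has_partials_cong[OF has_partials_const[of n B 0] B]) simp_all
      from has_partials_canonical[OF this B] B x i(2) show ?thesis unfolding B_def by blast
    qed
  qed
  define S where "S k = 2 * \<delta> k + (\<Sum>i<n. \<bar>a k i\<bar>)" for k
  have S: "0 \<le> S k" for k using \<delta>[of k] by (auto simp: S_def intro!: add_nonneg_nonneg sum_nonneg)
  have u_0: "u k x = 0" if "i < n" "S k \<le> \<bar>x i\<bar>" for k x i
  proof -
    have "\<bar>a k i\<bar> \<le> (\<Sum>i<n. \<bar>a k i\<bar>)" using that(1) by (intro member_le_sum) auto
    then have "2 * \<delta> k \<le> \<bar>x i - a k i\<bar>" using that(2) by (simp add: S_def)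
    from \<psi>_0[where k = k and x = x, OF that(1) this] show ?thesis by (simp add: u_def)
  qed
  define P where "P k h h' \<longleftrightarrow> (\<forall>d. C_diff n d ?E h) \<and> has_partials n ?E h h' \<and>
      (\<forall>x\<in>?E. \<bar>h x - u k x\<bar> \<le> \<epsilon> * (1/2) ^ Suc k) \<and>
      (\<forall>x\<in>?E. \<forall>i<n. \<bar>h' i x - partial_deriv i (u k) x\<bar> \<le> \<epsilon> * (1/2) ^ Suc k) \<and>
      (\<forall>x\<in>?E. (\<forall>y\<in>?E. (\<forall>i<n. \<bar>y i - x i\<bar> < 1 / (real k + 1)) \<longrightarrow> u k y = 0) \<longrightarrow> h x = 0)" for k h h'
  have "\<exists>h h'. P k h h'" for k
  proof (rule smooth_approx_compact_support[OF u_partials[of k] S[of k]])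
    show "u k x = 0" if "i < n" "S k \<le> \<bar>x i\<bar>" for x i by (rule u_0[where k = k and x = x, OF that])
    show "0 < \<epsilon> * (1/2) ^ Suc k" using \<epsilon> by simp
    show "0 < 1 / (real k + 1)" by simp
  next
    fix h h'
    assume "\<And>d. C_diff n d ?E h" "has_partials n ?E h h'"
      "\<And>x. x \<in> ?E \<Longrightarrow> \<bar>h x - u k x\<bar> \<le> \<epsilon> * (1/2) ^ Suc k"
      "\<And>x i. x \<in> ?E \<Longrightarrow> i < n \<Longrightarrow> \<bar>h' i x - partial_deriv i (u k) x\<bar> \<le> \<epsilon> * (1/2) ^ Suc k"
      "\<And>x. x \<in> ?E \<Longrightarrow> (\<And>y. y \<in> ?E \<Longrightarrow> \<forall>i<n. \<bar>y i - x i\<bar> < 1 / (real k + 1) \<Longrightarrow> u k y = 0) \<Longrightarrow> h x = 0"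
    then have "P k h h'" unfolding P_def by (intro conjI allI ballI impI) blast+
    then show ?thesis by blast
  qed
  then obtain h h' where P: "\<And>k. P k (h k) (h' k)" by metis
  have h: "C_diff n d ?E (h k)" "has_partials n ?E (h k) (h' k)"
    "x \<in> ?E \<Longrightarrow> \<bar>h k x - u k x\<bar> \<le> \<epsilon> * (1/2) ^ Suc k"
    "x \<in> ?E \<Longrightarrow> i < n \<Longrightarrow> \<bar>h' k i x - partial_deriv i (u k) x\<bar> \<le> \<epsilon> * (1/2) ^ Suc k"
    "x \<in> ?E \<Longrightarrow> (\<And>y. y \<in> ?E \<Longrightarrow> \<forall>i<n. \<bar>y i - x i\<bar> < 1 / (real k + 1) \<Longrightarrow> u k y = 0) \<Longrightarrow> h k x = 0"
    for k d x i
    using P[of k] unfolding P_def by blast+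
  define f where "f x = (\<Sum>k. h k x)" for x
  have local: "\<exists>V N. openin (Euclidean_space n) V \<and> x \<in> V \<and> V \<subseteq> G \<and>
      (\<forall>y\<in>V. f y = (\<Sum>k<N. h k y)) \<and> (\<forall>y\<in>V. g y = (\<Sum>k<N. u k y))" if x: "x \<in> G" for x
  proof -
    obtain j where j: "x \<in> cube n (a j) (\<delta> j)" using cover[OF x] by blast
    define Q where "Q = ?E \<inter> cube n (a j) (\<delta> j)"
    have Q: "openin (Euclidean_space n) Q" unfolding Q_def by (rule openin_Euclidean_spaceI[OF open_cube])
    have QG: "Q \<subseteq> G"
    proof
      fix y assume y: "y \<in> Q"
      then have "\<forall>i<n. \<bar>y i - a j i\<bar> \<le> 2 * \<delta> j" using \<delta>[of j] by (auto simp: Q_def cube_def intro: less_imp_le)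
      with y show "y \<in> G" using inG by (auto simp: Q_def)
    qed
    have "x \<in> Q" using x j GE by (auto simp: Q_def)
    then obtain r where r: "0 < r" "?E \<inter> cube n x r \<subseteq> Q" using openin_Euclidean_space_cube[OF Q] by blast
    \<comment> \<open>Half the radius: a point within 1 / (k + 1) < r / 2 of V in every coordinate
      is still in Q, where \<open>u k\<close> vanishes for k \<ge> N. Hence \<open>h k\<close>
      vanishes on V.\<close>
    define V where "V = ?E \<inter> cube n x (r / 2)"
    have V: "openin (Euclidean_space n) V" unfolding V_def by (rule openin_Euclidean_spaceI[OF open_cube])
    have xV: "x \<in> V" using r(1) x GE by (auto simp: V_def cube_def)
    have VQ: "V \<subseteq> Q"
    proof -
      have "cube n x (r / 2) \<subseteq> cube n x r" using r(1) by (auto simp: cube_def intro: less_trans)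
      then show ?thesis using r(2) by (auto simp: V_def)
    qed
    obtain M :: nat where M: "1 / (real M + 1) < r / 2"
      using reals_Archimedean[of "r / 2"] r(1) by (auto simp: inverse_eq_divide add.commute)
    define N where "N = max M (Suc j)"
    have u_N: "u k y = 0" if "N \<le> k" "y \<in> Q" for k y
      using \<psi>_0'[of j k y] that by (simp add: u_def Q_def N_def)
    have h_N: "h k y = 0" if k: "N \<le> k" and y: "y \<in> V" for k y
    proof (rule h(5))
      show "y \<in> ?E" using y by (simp add: V_def)
      fix z assume z: "z \<in> ?E" "\<forall>i<n. \<bar>z i - y i\<bar> < 1 / (real k + 1)"
      have "1 / (real k + 1) \<le> 1 / (real M + 1)" using k by (intro divide_left_mono) (auto simp: N_def)
      then have k: "1 / (real k + 1) < r / 2" using M by simp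
      have "\<bar>z i - x i\<bar> < r" if "i < n" for i
      proof -
        have "\<bar>z i - y i\<bar> < r / 2" using z(2) that k by (meson less_trans)
        moreover have "\<bar>y i - x i\<bar> < r / 2" using y that by (simp add: V_def cube_def)
        ultimately show ?thesis by linarith
      qed
      then have "z \<in> Q" using z(1) r(2) by (auto simp: cube_def)
      then show "u k z = 0" by (rule u_N[OF \<open>N \<le> k\<close>])
    qed
    have "f y = (\<Sum>k<N. h k y)" if "y \<in> V" for y
      unfolding f_def by (rule suminf_finite) (use h_N[OF _ that] in auto)
    moreover have "g y = (\<Sum>k<N. u k y)" if y: "y \<in> V" for y
    proof -
      have "y \<in> G" "y \<in> cube n (a j) (\<delta> j)" using y VQ QG by (auto simp: Q_def)
      moreover have "j < N" by (simp add: N_def)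
      ultimately have "(\<Sum>k<N. \<psi> k y) * g y = g y" using \<psi>_sum by simp
      with \<open>y \<in> G\<close> show ?thesis by (simp add: u_def sum_distrib_right)
    qed
    ultimately show ?thesis using V xV VQ QG by blast
  qed
  \<comment> \<open>The bound does not depend on the number of terms, which varies from point to
    point.\<close>
  have err: "\<bar>(\<Sum>k<N. p k) - (\<Sum>k<N. q k)\<bar> \<le> \<epsilon>" if "\<And>k. \<bar>p k - q k\<bar> \<le> \<epsilon> * (1/2) ^ Suc k" for p q N
  proof -
    have "\<bar>(\<Sum>k<N. p k) - (\<Sum>k<N. q k)\<bar> \<le> (\<Sum>k<N. \<epsilon> * (1/2) ^ Suc k)"
      unfolding sum_subtractf[symmetric] by (rule order_trans[OF sum_abs sum_mono]) (rule that)
    also have "\<dots> = \<epsilon> * (1 - (1/2) ^ N)" by (rule sum_half_powers)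
    also have "\<dots> \<le> \<epsilon> * 1" by (rule mult_left_mono) (use \<epsilon> in auto)
    finally show ?thesis by simp
  qed
  show thesis
  proof (rule that)
    have "C_diff n d G f" for d
    proof (rule C_diff_locally[OF GE])
      fix x assume "x \<in> G"
      from local[OF this] obtain V N where V: "openin (Euclidean_space n) V" "x \<in> V" "V \<subseteq> G"
        "\<And>y. y \<in> V \<Longrightarrow> f y = (\<Sum>k<N. h k y)" by blast
      have "V \<subseteq> ?E" using V(3) GE by blast
      have "C_diff n d V (\<lambda>y. \<Sum>k<N. h k y)"
        by (rule C_diff_sum[OF finite_lessThan C_diff_subset[OF h(1) \<open>V \<subseteq> ?E\<close>] V(1)])
      from C_diff_cong[OF this V(1,4)] V(1,2)
      show "\<exists>B. openin (Euclidean_space n) B \<and> x \<in> B \<and> C_diff n d B f" by blast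
    qed
    then show "smooth n G f" by (simp add: smooth_def)
  next
    fix x assume x: "x \<in> G"
    then have xE: "x \<in> ?E" using GE by blast
    from local[OF x] obtain V N where V: "openin (Euclidean_space n) V" "x \<in> V" "V \<subseteq> G"
      "\<And>y. y \<in> V \<Longrightarrow> f y = (\<Sum>k<N. h k y)" "\<And>y. y \<in> V \<Longrightarrow> g y = (\<Sum>k<N. u k y)" by blast
    show "\<bar>f x - g x\<bar> \<le> \<epsilon>"
      unfolding V(4)[OF V(2)] V(5)[OF V(2)] by (rule err) (rule h(3)[OF xE])
    fix i assume i: "i < n"
    have VE: "V \<subseteq> ?E" using V(3) GE by blast
    have "has_partials n V f (\<lambda>i x. \<Sum>k<N. h' k i x)"
      by (rule has_partials_cong[OF has_partials_sum[OF finite_lessThan has_partials_subset[OF h(2) VE]] V(1)])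
        (simp_all add: V(4))
    from has_partials_partial_deriv[OF this i V(2)]
    have 1: "partial_deriv i f x = (\<Sum>k<N. h' k i x)" .
    have "has_partials n V g (\<lambda>i x. \<Sum>k<N. partial_deriv i (u k) x)"
      by (rule has_partials_cong[OF has_partials_sum[OF finite_lessThan has_partials_subset[OF u_partials VE]] V(1)])
        (simp_all add: V(5))
    from has_partials_partial_deriv[OF this i V(2)] has_partials_partial_deriv[OF g i x]
    have 2: "g' i x = (\<Sum>k<N. partial_deriv i (u k) x)" by simp
    show "\<bar>partial_deriv i f x - g' i x\<bar> \<le> \<epsilon>"
      unfolding 1 2 by (rule err) (rule h(4)[OF xE i])
  qed
qed

section \<open>The Poincare inequality for continuously differentiable functions\<close>

lemma borel_measurable_borel_prob_on:
  fixes f :: "(nat \<Rightarrow> real) \<Rightarrow> real"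
  assumes "borel_prob_on G M" "continuous_on G f"
  shows "f \<in> borel_measurable M"
proof -
  have "f \<in> borel_measurable (restrict_space borel G)"
    by (rule borel_measurable_continuous_on_restrict[OF assms(2)])
  moreover have "sets M = sets (restrict_space borel G)" using assms(1) by (simp add: borel_prob_on_def)
  ultimately show ?thesis using measurable_cong_sets[of M "restrict_space borel G" borel borel] by simp
qed

lemma euclidean_norm_gradient_sq:
  "(euclidean_norm n (gradient n f x))\<^sup>2 = (\<Sum>i<n. (partial_deriv i f x)\<^sup>2)"
  by (simp add: euclidean_norm_def L2_set_def gradient_def sum_nonneg)

text \<open>
  The majorant \<open>K\<close> is required to be integrable because the Bochner integral of a non-integrable function is \<open>0\<close>.
\<close>

definition poincare_C1 ::
    "nat \<Rightarrow> (nat \<Rightarrow> real) set \<Rightarrow> (nat \<Rightarrow> real) measure \<Rightarrow> real \<Rightarrow> bool"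
  where "poincare_C1 n G M C \<longleftrightarrow> (\<forall>w w' K. has_partials n G w w' \<longrightarrow> bounded (w ` G) \<longrightarrow> integrable M K \<longrightarrow>
    (\<forall>x\<in>G. (\<Sum>i<n. (w' i x)\<^sup>2) \<le> K x) \<longrightarrow> Var M w \<le> C * (\<integral>x. K x \<partial>M))"

text \<open>Since |a^2 - c^2| = |c - a| |a + c|, both parts of the variance change by at most
  \<epsilon> (2 B + 1).\<close>

lemma Var_close:
  assumes "prob_space M" and v: "v \<in> borel_measurable M" and w: "w \<in> borel_measurable M"
    and B: "\<And>x. x \<in> space M \<Longrightarrow> \<bar>w x\<bar> \<le> B"
    and close: "\<And>x. x \<in> space M \<Longrightarrow> \<bar>v x - w x\<bar> \<le> \<epsilon>" and \<epsilon>: "\<epsilon> \<le> 1"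
  shows "Var M w \<le> Var M v + 2 * \<epsilon> * (2 * B + 1)"
proof -
  interpret prob_space M by fact
  obtain x0 where x0: "x0 \<in> space M" using not_empty by blast
  have \<epsilon>0: "0 \<le> \<epsilon>" using close[OF x0] by simp
  have B0: "0 \<le> B" using B[OF x0] by simp
  have Bv: "\<bar>v x\<bar> \<le> B + 1" if "x \<in> space M" for x using B[OF that] close[OF that] \<epsilon> by simp
  have int: "integrable M w" "integrable M v" "integrable M (\<lambda>x. (w x)\<^sup>2)" "integrable M (\<lambda>x. (v x)\<^sup>2)"
  proof -
    show "integrable M w" by (rule integrable_const_bound[where B = B]) (use B w in auto)
    show "integrable M v" by (rule integrable_const_bound[where B = "B + 1"]) (use Bv v in auto)
    show "integrable M (\<lambda>x. (w x)\<^sup>2)"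
      by (rule integrable_const_bound[where B = "B\<^sup>2"]) (use B B0 w in \<open>auto simp: abs_le_square_iff[symmetric]\<close>)
    show "integrable M (\<lambda>x. (v x)\<^sup>2)"
      by (rule integrable_const_bound[where B = "(B + 1)\<^sup>2"]) (use Bv B0 v in \<open>auto simp: abs_le_square_iff[symmetric]\<close>)
  qed
  have prod: "\<bar>a\<^sup>2 - c\<^sup>2\<bar> \<le> \<epsilon> * (2 * B + 1)" if "\<bar>a\<bar> \<le> B" "\<bar>c\<bar> \<le> B + 1" "\<bar>c - a\<bar> \<le> \<epsilon>" for a c :: real
  proof -
    have "\<bar>a\<^sup>2 - c\<^sup>2\<bar> = \<bar>c - a\<bar> * \<bar>a + c\<bar>"
      unfolding abs_mult[symmetric] by (simp add: power2_eq_square algebra_simps abs_minus_commute)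
    also have "\<dots> \<le> \<epsilon> * (2 * B + 1)" by (rule mult_mono) (use that \<epsilon>0 in auto)
    finally show ?thesis .
  qed
  have "\<bar>(\<integral>x. (w x)\<^sup>2 \<partial>M) - (\<integral>x. (v x)\<^sup>2 \<partial>M)\<bar> = \<bar>\<integral>x. (w x)\<^sup>2 - (v x)\<^sup>2 \<partial>M\<bar>"
    using int by simp
  also have "\<dots> \<le> (\<integral>x. \<bar>(w x)\<^sup>2 - (v x)\<^sup>2\<bar> \<partial>M)" by (rule integral_abs_bound)
  also have "\<dots> \<le> (\<integral>x. \<epsilon> * (2 * B + 1) \<partial>M)"
    by (rule integral_mono) (use int prod B Bv close in auto)
  finally have 1: "\<bar>(\<integral>x. (w x)\<^sup>2 \<partial>M) - (\<integral>x. (v x)\<^sup>2 \<partial>M)\<bar> \<le> \<epsilon> * (2 * B + 1)" by (simp add: prob_space)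
  have abs_int: "\<bar>\<integral>x. p x \<partial>M\<bar> \<le> c" if "integrable M p" "\<And>x. x \<in> space M \<Longrightarrow> \<bar>p x\<bar> \<le> c" for p and c :: real
  proof -
    have "\<bar>\<integral>x. p x \<partial>M\<bar> \<le> (\<integral>x. \<bar>p x\<bar> \<partial>M)" by (rule integral_abs_bound)
    also have "\<dots> \<le> (\<integral>x. c \<partial>M)" by (rule integral_mono) (use that in auto)
    finally show ?thesis by (simp add: prob_space)
  qed
  have "\<bar>(\<integral>x. w x \<partial>M)\<^sup>2 - (\<integral>x. v x \<partial>M)\<^sup>2\<bar> \<le> \<epsilon> * (2 * B + 1)"
  proof (rule prod)
    show "\<bar>\<integral>x. w x \<partial>M\<bar> \<le> B" by (rule abs_int[OF int(1) B])
    show "\<bar>\<integral>x. v x \<partial>M\<bar> \<le> B + 1" by (rule abs_int[OF int(2) Bv])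
    have "\<bar>\<integral>x. v x - w x \<partial>M\<bar> \<le> \<epsilon>" by (rule abs_int) (use int close in auto)
    then show "\<bar>(\<integral>x. v x \<partial>M) - (\<integral>x. w x \<partial>M)\<bar> \<le> \<epsilon>" using int by simp
  qed
  with 1 show ?thesis unfolding Var_def by linarith
qed

text \<open>The partial derivatives of the approximant differ from \<open>w'\<close> by at most
  \<epsilon>, and b^2 \<le> 2 a^2 + 2 (b - a)^2 separates the error: hence the factor 2. Letting
  \<epsilon> tend to 0 removes the remaining terms.\<close>

lemma poincare_ineq_imp_C1:
  assumes G: "openin (Euclidean_space n) G" and M: "borel_prob_on G M"
    and P: "poincare_ineq n G M C" and C: "0 \<le> C"
  shows "poincare_C1 n G M (2 * C)"
  unfolding poincare_C1_def
proof (intro allI impI)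
  fix w w' K
  assume w: "has_partials n G w w'" and bdd: "bounded (w ` G)" and K: "integrable M K"
    and w'K: "\<forall>x\<in>G. (\<Sum>i<n. (w' i x)\<^sup>2) \<le> K x"
  interpret prob_space M using M by (simp add: borel_prob_on_def)
  have sp: "space M = G" using M by (simp add: borel_prob_on_def)
  obtain B where B: "\<And>x. x \<in> G \<Longrightarrow> \<bar>w x\<bar> \<le> B" using bdd by (auto simp: bounded_iff)
  obtain x0 where "x0 \<in> G" using not_empty sp by blast
  then have B0: "0 \<le> B" using B by fastforce
  have K0: "0 \<le> K x" if "x \<in> G" for x
    using w'K that by (meson order_trans sum_nonneg zero_le_power2)
  have main: "Var M w \<le> 2 * C * (\<integral>x. K x \<partial>M) + \<epsilon> * (2 * C * n + 4 * B + 2)" if \<epsilon>: "0 < \<epsilon>" "\<epsilon> \<le> 1" for \<epsilon>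
  proof -
    obtain f where f: "smooth n G f" "\<And>x. x \<in> G \<Longrightarrow> \<bar>f x - w x\<bar> \<le> \<epsilon>"
      "\<And>x i. x \<in> G \<Longrightarrow> i < n \<Longrightarrow> \<bar>partial_deriv i f x - w' i x\<bar> \<le> \<epsilon>"
      using smooth_approx[OF G w \<epsilon>(1)] by blast
    have "\<bar>f x\<bar> \<le> B + 1" if "x \<in> G" for x using f(2)[OF that] B[OF that] \<epsilon> by simp
    then have f_bdd: "bounded (f ` G)" by (auto simp: bounded_iff)
    have "(\<integral>\<^sup>+x. ennreal ((euclidean_norm n (gradient n f x))\<^sup>2) \<partial>M) \<le> (\<integral>\<^sup>+x. ennreal (2 * K x + 2 * n * \<epsilon>\<^sup>2) \<partial>M)"
    proof (intro nn_integral_mono ennreal_leI)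
      fix x assume "x \<in> space M"
      then have x: "x \<in> G" by (simp add: sp)
      have "(\<Sum>i<n. (partial_deriv i f x)\<^sup>2) \<le> (\<Sum>i<n. 2 * (w' i x)\<^sup>2 + 2 * \<epsilon>\<^sup>2)"
      proof (rule sum_mono)
        fix i assume "i \<in> {..<n}"
        then have "\<bar>partial_deriv i f x - w' i x\<bar> \<le> \<epsilon>" using f(3)[OF x] by simp
        then have "(partial_deriv i f x - w' i x)\<^sup>2 \<le> \<epsilon>\<^sup>2" using \<epsilon> by (simp add: abs_le_square_iff[symmetric])
        moreover have "(partial_deriv i f x)\<^sup>2 \<le> 2 * (w' i x)\<^sup>2 + 2 * (partial_deriv i f x - w' i x)\<^sup>2"
          using zero_le_power2[of "2 * w' i x - partial_deriv i f x"]
          by (simp add: power2_eq_square algebra_simps)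
        ultimately show "(partial_deriv i f x)\<^sup>2 \<le> 2 * (w' i x)\<^sup>2 + 2 * \<epsilon>\<^sup>2" by linarith
      qed
      also have "\<dots> = 2 * (\<Sum>i<n. (w' i x)\<^sup>2) + 2 * n * \<epsilon>\<^sup>2" by (simp add: sum.distrib sum_distrib_left)
      also have "\<dots> \<le> 2 * K x + 2 * n * \<epsilon>\<^sup>2" using w'K x by simp
      finally show "(euclidean_norm n (gradient n f x))\<^sup>2 \<le> 2 * K x + 2 * n * \<epsilon>\<^sup>2"
        by (simp add: euclidean_norm_gradient_sq)
    qed
    also have "\<dots> = ennreal (\<integral>x. 2 * K x + 2 * n * \<epsilon>\<^sup>2 \<partial>M)"
      by (rule nn_integral_eq_integral) (use K K0 sp in auto)
    finally have grad: "(\<integral>\<^sup>+x. ennreal ((euclidean_norm n (gradient n f x))\<^sup>2) \<partial>M) \<le>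
      ennreal (\<integral>x. 2 * K x + 2 * n * \<epsilon>\<^sup>2 \<partial>M)" .
    have "ennreal (Var M f) \<le> ennreal C * (\<integral>\<^sup>+x. ennreal ((euclidean_norm n (gradient n f x))\<^sup>2) \<partial>M)"
      using P f(1) f_bdd unfolding poincare_ineq_def by blast
    also have "\<dots> \<le> ennreal C * ennreal (\<integral>x. 2 * K x + 2 * n * \<epsilon>\<^sup>2 \<partial>M)"
      by (rule mult_left_mono[OF grad]) simp
    also have "\<dots> = ennreal (C * (\<integral>x. 2 * K x + 2 * n * \<epsilon>\<^sup>2 \<partial>M))"
      using C by (simp add: ennreal_mult')
    finally have "Var M f \<le> C * (\<integral>x. 2 * K x + 2 * n * \<epsilon>\<^sup>2 \<partial>M)"
      by (rule ennreal_le_iff[THEN iffD1, rotated])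
        (use C K0 sp in \<open>auto intro!: mult_nonneg_nonneg integral_nonneg\<close>)
    also have "(\<integral>x. 2 * K x + 2 * n * \<epsilon>\<^sup>2 \<partial>M) = 2 * (\<integral>x. K x \<partial>M) + 2 * n * \<epsilon>\<^sup>2"
      using K by (simp add: prob_space)
    finally have 1: "Var M f \<le> 2 * C * (\<integral>x. K x \<partial>M) + 2 * C * n * \<epsilon>\<^sup>2" by (simp add: algebra_simps)
    have "\<epsilon>\<^sup>2 \<le> \<epsilon>" using \<epsilon> by (simp add: power2_eq_square mult_left_le)
    then have 2: "2 * C * n * \<epsilon>\<^sup>2 \<le> 2 * C * n * \<epsilon>" using C by (intro mult_left_mono) auto
    have "C_diff n 0 G f" using f(1) unfolding smooth_def by blast
    then have fm: "f \<in> borel_measurable M" by (intro borel_measurable_borel_prob_on[OF M]) simp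
    have "Var M w \<le> Var M f + 2 * \<epsilon> * (2 * B + 1)"
      by (rule Var_close[OF prob_space_axioms fm borel_measurable_borel_prob_on[OF M has_partialsD(1)[OF w]] _ _ \<epsilon>(2)])
        (use B f(2) sp in auto)
    with 1 2 show ?thesis by (simp add: algebra_simps)
  qed
  show "Var M w \<le> 2 * C * (\<integral>x. K x \<partial>M)"
  proof (rule field_le_epsilon)
    fix e :: real assume e: "0 < e"
    define D where "D = 2 * C * n + 4 * B + 2"
    have D: "0 < D" using C B0 by (auto simp: D_def intro!: add_nonneg_pos add_nonneg_nonneg)
    define \<epsilon> where "\<epsilon> = min 1 (e / D)"
    have "0 < \<epsilon>" "\<epsilon> \<le> 1" using e D by (auto simp: \<epsilon>_def)
    moreover have "\<epsilon> * D \<le> e / D * D" using D by (intro mult_right_mono) (auto simp: \<epsilon>_def)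
    ultimately show "Var M w \<le> 2 * C * (\<integral>x. K x \<partial>M) + e" using main[of \<epsilon>] D by (simp add: D_def)
  qed
qed

section \<open>The moment recursion\<close>

lemma power_mixed_le:
  fixes a b :: real
  assumes "0 \<le> a" "0 \<le> b" "1 \<le> q"
  shows "a ^ (2 * q - 2) * b\<^sup>2 \<le> a ^ (2 * q) + b ^ (2 * q)"
proof -
  have e: "2 * q = (2 * q - 2) + 2" using assms(3) by simp
  show ?thesis
  proof (cases "a \<le> b")
    case True
    have "a ^ (2 * q - 2) * b\<^sup>2 \<le> b ^ (2 * q - 2) * b\<^sup>2"
      by (intro mult_right_mono power_mono) (use True assms in auto)
    also have "\<dots> = b ^ (2 * q)" by (subst (2) e) (simp only: power_add)
    finally show ?thesis using assms by (simp add: add_increasing)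
  next
    case False
    have "a ^ (2 * q - 2) * b\<^sup>2 \<le> a ^ (2 * q - 2) * a\<^sup>2"
      by (intro mult_left_mono power_mono) (use False assms in auto)
    also have "\<dots> = a ^ (2 * q)" by (subst (2) e) (simp only: power_add)
    finally show ?thesis using assms by (simp add: add_increasing2)
  qed
qed

text \<open>Boundedness of g makes \<integral> g^(2q) finite, so the quarter of it that Young's
  inequality puts on the right may be moved to the left.\<close>

lemma moment_recursion:
  assumes M: "borel_prob_on G M" and P: "poincare_C1 n G M (\<tau>\<^sup>2)" and \<tau>: "0 < \<tau>"
    and g: "has_partials n G g g'" and bdd: "bounded (g ` G)"
    and H: "\<And>x. x \<in> G \<Longrightarrow> 0 \<le> H x" "\<And>x. x \<in> G \<Longrightarrow> (\<Sum>i<n. (g' i x)\<^sup>2) \<le> (H x)\<^sup>2"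
    and q: "1 \<le> q" and intH: "integrable M (\<lambda>x. H x ^ (2 * q))"
  shows "2 * (\<integral>x. g x ^ (2 * q) \<partial>M) \<le> (2 * (\<integral>x. g x ^ q \<partial>M))\<^sup>2 + (\<tau> * (2 * q)) ^ (2 * q) * (\<integral>x. H x ^ (2 * q) \<partial>M)"
proof -
  interpret prob_space M using M by (simp add: borel_prob_on_def)
  have sp: "space M = G" using M by (simp add: borel_prob_on_def)
  obtain B where B: "\<And>x. x \<in> G \<Longrightarrow> \<bar>g x\<bar> \<le> B" using bdd by (auto simp: bounded_iff)
  have gm: "g \<in> borel_measurable M" by (rule borel_measurable_borel_prob_on[OF M has_partialsD(1)[OF g]])
  have intg: "integrable M (\<lambda>x. g x ^ k)" for k
    by (rule integrable_const_bound[where B = "B ^ k"]) (use B sp gm in \<open>auto simp: power_abs intro!: power_mono\<close>)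
  \<comment> \<open>For this A the gradient term \<tau>^2 q^2 g^(2q-2) H^2 is a quarter of g^(2q-2)
    (A H)^2, to which \<open>power_mixed_le\<close> applies; K is the resulting majorant.\<close>
  define A where "A = \<tau> * (2 * q)"
  have A: "0 < A" using \<tau> q by (simp add: A_def)
  define K where "K x = (g x ^ (2 * q) + A ^ (2 * q) * H x ^ (2 * q)) / (4 * \<tau>\<^sup>2)" for x
  have K: "integrable M K" unfolding K_def using intg intH by auto
  have D: "((\<lambda>y. y ^ q) has_real_derivative q * y ^ (q - 1)) (at y)" for y :: real
    by (auto intro!: derivative_eq_intros)
  have w: "has_partials n G (\<lambda>x. g x ^ q) (\<lambda>i x. q * g x ^ (q - 1) * g' i x)"
    by (rule has_partials_compose[OF g D])
      (intro continuous_on_mult continuous_on_const continuous_on_power continuous_on_id)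
  have "Var M (\<lambda>x. g x ^ q) \<le> \<tau>\<^sup>2 * (\<integral>x. K x \<partial>M)"
  proof (rule P[unfolded poincare_C1_def, rule_format, OF w _ K])
    show "bounded ((\<lambda>x. g x ^ q) ` G)"
      unfolding bounded_iff using B by (intro exI[of _ "B ^ q"]) (auto simp: power_abs intro!: power_mono)
    fix x assume x: "x \<in> G"
    have "(\<Sum>i<n. (q * g x ^ (q - 1) * g' i x)\<^sup>2) = (q * g x ^ (q - 1))\<^sup>2 * (\<Sum>i<n. (g' i x)\<^sup>2)"
      by (simp add: power_mult_distrib sum_distrib_left)
    also have "\<dots> \<le> (q * g x ^ (q - 1))\<^sup>2 * (H x)\<^sup>2" by (rule mult_left_mono[OF H(2)[OF x]]) simp
    also have "\<dots> = (\<bar>g x\<bar> ^ (2 * q - 2) * (A * H x)\<^sup>2) / (4 * \<tau>\<^sup>2)"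
    proof -
      have "(g x ^ (q - 1))\<^sup>2 = \<bar>g x\<bar> ^ (2 * q - 2)"
        by (simp add: power_mult[symmetric] mult.commute diff_mult_distrib2 power_even_abs)
      then show ?thesis using \<tau> by (simp add: A_def power_mult_distrib field_simps)
    qed
    also have "\<dots> \<le> (\<bar>g x\<bar> ^ (2 * q) + (A * H x) ^ (2 * q)) / (4 * \<tau>\<^sup>2)"
      by (intro divide_right_mono power_mixed_le q) (use A H(1)[OF x] in auto)
    also have "\<dots> = K x" by (simp add: K_def power_mult_distrib power_even_abs)
    finally show "(\<Sum>i<n. (q * g x ^ (q - 1) * g' i x)\<^sup>2) \<le> K x" .
  qed
  also have "(\<integral>x. K x \<partial>M) = ((\<integral>x. g x ^ (2 * q) \<partial>M) + A ^ (2 * q) * (\<integral>x. H x ^ (2 * q) \<partial>M)) / (4 * \<tau>\<^sup>2)"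
    unfolding K_def using intg intH by simp
  also have "\<tau>\<^sup>2 * \<dots> = ((\<integral>x. g x ^ (2 * q) \<partial>M) + A ^ (2 * q) * (\<integral>x. H x ^ (2 * q) \<partial>M)) / 4"
    using \<tau> by (simp add: field_simps)
  finally have "(\<integral>x. g x ^ (2 * q) \<partial>M) - (\<integral>x. g x ^ q \<partial>M)\<^sup>2 \<le>
      ((\<integral>x. g x ^ (2 * q) \<partial>M) + A ^ (2 * q) * (\<integral>x. H x ^ (2 * q) \<partial>M)) / 4"
    by (simp add: Var_def power_mult[symmetric] mult.commute)
  moreover have "0 \<le> A ^ (2 * q) * (\<integral>x. H x ^ (2 * q) \<partial>M)"
    using A H(1) sp by (intro mult_nonneg_nonneg integral_nonneg) auto
  moreover have "0 \<le> (\<integral>x. g x ^ q \<partial>M)\<^sup>2" by simp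
  \<comment> \<open>Absorption gives 3 X \<le> 4 Y + Z. The weaker 2 X is kept because 4 Y = (2
    \<integral> g^q)^2 is the square of the same expression at half the exponent.\<close>
  moreover have "2 * X \<le> 4 * Y + Z" if "X - Y \<le> (X + Z) / 4" "0 \<le> Z" "0 \<le> Y" for X Y Z :: real
    using that by (simp add: field_simps)
  ultimately have "2 * (\<integral>x. g x ^ (2 * q) \<partial>M) \<le> 4 * (\<integral>x. g x ^ q \<partial>M)\<^sup>2 + A ^ (2 * q) * (\<integral>x. H x ^ (2 * q) \<partial>M)"
    by blast
  then show ?thesis by (simp add: A_def power_mult_distrib)
qed

section \<open>Growth of moments and exponential integrability\<close>

text \<open>
  \<open>\<parallel>h\<parallel>\<^sub>p \<le> (4\<tau>p)\<^sup>e\<close> for the exponents \<open>p = 2\<^sup>m\<close>, \<open>m \<ge> 1\<close>; they are even, so no absolute value is needed.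
\<close>

definition even_moments :: "'a measure \<Rightarrow> real \<Rightarrow> ('a \<Rightarrow> real) \<Rightarrow> nat \<Rightarrow> bool"
  where "even_moments M \<tau> h e \<longleftrightarrow>
    (\<forall>m\<ge>1. (\<integral>\<^sup>+x. ennreal (h x ^ (2 ^ m)) \<partial>M) \<le> ennreal (((4 * \<tau> * 2 ^ m) ^ e) ^ (2 ^ m)))"

lemma power_add_power_le:
  fixes a b :: real
  assumes "0 \<le> a" "0 \<le> b" "1 \<le> p"
  shows "a ^ p + b ^ p \<le> (a + b) ^ p"
  using assms(3)
proof (induction p rule: nat_induct_at_least)
  case (Suc p)
  have "a ^ Suc p + b ^ Suc p \<le> (a + b) * (a ^ p + b ^ p)"
    using assms(1,2) by (simp add: algebra_simps)
  also have "\<dots> \<le> (a + b) * (a + b) ^ p" using assms(1,2) Suc.IH by (intro mult_left_mono) auto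
  finally show ?case by simp
qed simp

lemma even_moments_integrable:
  assumes "even_moments M \<tau> H e" "H \<in> borel_measurable M" "0 < \<tau>" "1 \<le> m"
  shows "integrable M (\<lambda>x. H x ^ (2 ^ m))" "(\<integral>x. H x ^ (2 ^ m) \<partial>M) \<le> ((4 * \<tau> * 2 ^ m) ^ e) ^ (2 ^ m)"
proof -
  have nn: "0 \<le> H x ^ (2 ^ m)" for x using assms(4) by (intro zero_le_even_power) auto
  have bound: "(\<integral>\<^sup>+x. ennreal (H x ^ (2 ^ m)) \<partial>M) \<le> ennreal (((4 * \<tau> * 2 ^ m) ^ e) ^ (2 ^ m))"
    using assms by (simp add: even_moments_def)
  show "integrable M (\<lambda>x. H x ^ (2 ^ m))"
    by (rule integrableI_nonneg)
      (use assms(2) nn le_less_trans[OF bound ennreal_less_top] in auto)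
  show "(\<integral>x. H x ^ (2 ^ m) \<partial>M) \<le> ((4 * \<tau> * 2 ^ m) ^ e) ^ (2 ^ m)"
    by (subst integral_eq_nn_integral) (use assms nn bound in \<open>auto intro: enn2real_leI\<close>)
qed

text \<open>Induction on the exponent with e fixed: squaring the induction hypothesis bounds the
  first term of \<open>moment_recursion\<close>, and the moments of H bound the second.\<close>

lemma even_moments_bounded_step:
  assumes M: "borel_prob_on G M" and P: "poincare_C1 n G M (\<tau>\<^sup>2)" and \<tau>: "0 < \<tau>"
    and g: "has_partials n G g g'" and bdd: "bounded (g ` G)"
    and H: "\<And>x. x \<in> G \<Longrightarrow> 0 \<le> H x" "\<And>x. x \<in> G \<Longrightarrow> (\<Sum>i<n. (g' i x)\<^sup>2) \<le> (H x)\<^sup>2"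
    and Hm: "H \<in> borel_measurable M" "even_moments M \<tau> H e"
    and base: "2 * (\<integral>x. (g x)\<^sup>2 \<partial>M) \<le> ((8 * \<tau>) ^ Suc e)\<^sup>2"
    and m: "1 \<le> m"
  shows "2 * (\<integral>x. g x ^ (2 ^ m) \<partial>M) \<le> ((4 * \<tau> * 2 ^ m) ^ Suc e) ^ (2 ^ m)"
  using m
proof (induction m rule: nat_induct_at_least)
  case base
  then show ?case using \<open>2 * _ \<le> _\<close> by (simp add: mult.commute)
next
  case (Suc m)
  define q :: nat where "q = 2 ^ m"
  \<comment> \<open>In terms of T the two contributions are the (2q)-th powers of (T/2)^(e+1) and
    (T/4) T^e, whose bases add up to at most (1/2 + 1/4) T^(e+1). So the constant 4 in
    \<open>even_moments\<close> leaves enough room.\<close>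
  define T where "T = 4 * \<tau> * 2 ^ Suc m"
  have T: "0 < T" using \<tau> by (simp add: T_def)
  have q: "1 \<le> q" "2 * q = 2 ^ Suc m" by (simp_all add: q_def)
  have "1 \<le> Suc m" by simp
  note intH = even_moments_integrable[OF Hm(2,1) \<tau> this, folded q(2)]
  have "0 \<le> 2 * (\<integral>x. g x ^ q \<partial>M)"
    using Suc.hyps by (intro mult_nonneg_nonneg Bochner_Integration.integral_nonneg zero_le_even_power) (auto simp: q_def)
  then have "(2 * (\<integral>x. g x ^ q \<partial>M))\<^sup>2 \<le> (((4 * \<tau> * 2 ^ m) ^ Suc e) ^ q)\<^sup>2"
    using Suc.IH by (intro power_mono) (simp_all only: q_def)
  also have "4 * \<tau> * 2 ^ m = T / 2" by (simp add: T_def)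
  also have "(((T / 2) ^ Suc e) ^ q)\<^sup>2 = ((T / 2) ^ Suc e) ^ (2 * q)"
    by (simp only: power_mult[of _ q 2] mult.commute[of 2 q])
  finally have 1: "(2 * (\<integral>x. g x ^ q \<partial>M))\<^sup>2 \<le> ((T / 2) ^ Suc e) ^ (2 * q)" .
  have "real (2 * q) = 2 ^ Suc m" unfolding q(2) by simp
  then have 2: "\<tau> * real (2 * q) = T / 4" by (simp add: T_def)
  have 3: "(T / 4) ^ (2 * q) * (\<integral>x. H x ^ (2 * q) \<partial>M) \<le> (T / 4) ^ (2 * q) * (T ^ e) ^ (2 * q)"
    using intH(2) T by (intro mult_left_mono) (simp_all add: T_def)
  have "2 * (\<integral>x. g x ^ (2 * q) \<partial>M) \<le> (2 * (\<integral>x. g x ^ q \<partial>M))\<^sup>2 + (T / 4) ^ (2 * q) * (\<integral>x. H x ^ (2 * q) \<partial>M)"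
    unfolding 2[symmetric] by (rule moment_recursion[OF M P \<tau> g bdd H q(1) intH(1)])
  also have "\<dots> \<le> ((T / 2) ^ Suc e) ^ (2 * q) + (T / 4) ^ (2 * q) * (T ^ e) ^ (2 * q)"
    by (rule add_mono[OF 1 3])
  also have "\<dots> = ((T / 2) ^ Suc e) ^ (2 * q) + (T / 4 * T ^ e) ^ (2 * q)"
    by (simp only: power_mult_distrib)
  also have "\<dots> \<le> ((T / 2) ^ Suc e + T / 4 * T ^ e) ^ (2 * q)"
    using T q(1) by (intro power_add_power_le) auto
  also have "\<dots> \<le> (T ^ Suc e) ^ (2 * q)"
  proof (rule power_mono)
    have Z: "Z / 2 + Z / 4 \<le> Z" if "0 \<le> Z" for Z :: real using that by simp
    have "T ^ Suc e / 2 ^ Suc e \<le> T ^ Suc e / 2 ^ 1"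
      using T by (intro divide_left_mono power_increasing) auto
    then have "(T / 2) ^ Suc e \<le> T ^ Suc e / 2" unfolding power_divide by simp
    moreover have "T / 4 * T ^ e = T ^ Suc e / 4" by simp
    ultimately have "(T / 2) ^ Suc e + T / 4 * T ^ e \<le> T ^ Suc e / 2 + T ^ Suc e / 4" by (intro add_mono) simp_all
    also have "\<dots> \<le> T ^ Suc e" by (rule Z) (use T in simp)
    finally show "(T / 2) ^ Suc e + T / 4 * T ^ e \<le> T ^ Suc e" .
  qed (use T in auto)
  finally show ?case by (simp only: q(2) T_def)
qed

text \<open>Fatou's lemma: the bounds for the bounded approximants do not depend on N. The L^2 bound
  that starts the induction is asked for large N only, because it will come from limits.\<close>

lemma even_moments_step:
  assumes M: "borel_prob_on G M" and P: "poincare_C1 n G M (\<tau>\<^sup>2)" and \<tau>: "0 < \<tau>"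
    and g: "\<And>N. has_partials n G (g N) (g' N)" and bdd: "\<And>N. bounded (g N ` G)"
    and H: "\<And>x. x \<in> G \<Longrightarrow> 0 \<le> H x" "\<And>N x. x \<in> G \<Longrightarrow> (\<Sum>i<n. (g' N i x)\<^sup>2) \<le> (H x)\<^sup>2"
    and Hm: "H \<in> borel_measurable M" "even_moments M \<tau> H e"
    and lim: "\<And>x. x \<in> G \<Longrightarrow> (\<lambda>N. g N x) \<longlonglongrightarrow> h x"
    and base: "\<forall>\<^sub>F N in sequentially. 2 * (\<integral>x. (g N x)\<^sup>2 \<partial>M) \<le> ((8 * \<tau>) ^ Suc e)\<^sup>2"
  shows "even_moments M \<tau> h (Suc e)"
  unfolding even_moments_def
proof (intro allI impI)
  fix m :: nat assume m: "1 \<le> m"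
  interpret prob_space M using M by (simp add: borel_prob_on_def)
  have sp: "space M = G" using M by (simp add: borel_prob_on_def)
  define p :: nat where "p = 2 ^ m"
  have p: "even p" using m by (simp add: p_def)
  define C where "C = ((4 * \<tau> * 2 ^ m) ^ Suc e) ^ p"
  have gm: "g N \<in> borel_measurable M" for N
    by (rule borel_measurable_borel_prob_on[OF M has_partialsD(1)[OF g]])
  have "(\<integral>\<^sup>+x. ennreal (h x ^ p) \<partial>M) = (\<integral>\<^sup>+x. liminf (\<lambda>N. ennreal (g N x ^ p)) \<partial>M)"
  proof (rule nn_integral_cong)
    fix x assume "x \<in> space M"
    then have "(\<lambda>N. ennreal (g N x ^ p)) \<longlonglongrightarrow> ennreal (h x ^ p)"
      using lim sp by (intro tendsto_ennrealI tendsto_power) auto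
    then show "ennreal (h x ^ p) = liminf (\<lambda>N. ennreal (g N x ^ p))"
      using lim_imp_Liminf[OF sequentially_bot] by metis
  qed
  also have "\<dots> \<le> liminf (\<lambda>N. \<integral>\<^sup>+x. ennreal (g N x ^ p) \<partial>M)"
    by (rule nn_integral_liminf) (use gm in measurable)
  also have "\<dots> \<le> limsup (\<lambda>N. \<integral>\<^sup>+x. ennreal (g N x ^ p) \<partial>M)"
    by (rule Liminf_le_Limsup) simp
  also have "\<dots> \<le> ennreal C"
  proof (rule Limsup_bounded)
    show "\<forall>\<^sub>F N in sequentially. (\<integral>\<^sup>+x. ennreal (g N x ^ p) \<partial>M) \<le> ennreal C"
      using base
    proof eventually_elim
      case (elim N)
      obtain B where B: "\<And>x. x \<in> G \<Longrightarrow> \<bar>g N x\<bar> \<le> B" using bdd[of N] by (auto simp: bounded_iff)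
      have int: "integrable M (\<lambda>x. g N x ^ p)"
        by (rule integrable_const_bound[where B = "B ^ p"]) (use B sp gm in \<open>auto simp: power_abs intro!: power_mono\<close>)
      have nn: "0 \<le> (\<integral>x. g N x ^ p \<partial>M)" using p by (intro Bochner_Integration.integral_nonneg zero_le_even_power)
      have "2 * (\<integral>x. g N x ^ p \<partial>M) \<le> C"
        unfolding p_def C_def by (rule even_moments_bounded_step[OF M P \<tau> g bdd H Hm elim m])
      then have "(\<integral>x. g N x ^ p \<partial>M) \<le> C" using nn by linarith
      moreover have "(\<integral>\<^sup>+x. ennreal (g N x ^ p) \<partial>M) = ennreal (\<integral>x. g N x ^ p \<partial>M)"
        by (rule nn_integral_eq_integral[OF int]) (use p in \<open>auto intro: zero_le_even_power\<close>)
      ultimately show ?case by (simp add: ennreal_leI)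
    qed
  qed
  finally show "(\<integral>\<^sup>+x. ennreal (h x ^ 2 ^ m) \<partial>M) \<le> ennreal (((4 * \<tau> * 2 ^ m) ^ Suc e) ^ 2 ^ m)"
    by (simp only: p_def C_def)
qed

section \<open>From moments to the exponential\<close>

lemma ex_power2_between:
  assumes "1 \<le> k"
  shows "\<exists>m\<ge>1. k \<le> 2 ^ m \<and> 2 ^ m \<le> 2 * (k :: nat)"
  using assms
proof (induction k rule: nat_induct_at_least)
  case base
  then show ?case by (intro exI[of _ 1]) auto
next
  case (Suc k)
  then obtain m where m: "1 \<le> m" "k \<le> 2 ^ m" "2 ^ m \<le> 2 * k" by auto
  show ?case
  proof (cases "Suc k \<le> 2 ^ m")
    case True
    with m show ?thesis by (intro exI[of _ m]) auto
  next
    case False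
    with m have "2 ^ m = k" by simp
    with m show ?thesis by (intro exI[of _ "Suc m"]) auto
  qed
qed

text \<open>k^k / k! is a single term of the series of exp k, and e \<le> 3.\<close>

lemma power_div_fact_le: "(real k / 9) ^ k / fact k \<le> (1 / 3) ^ k"
proof -
  have "(\<Sum>j\<in>{k}. real k ^ j /\<^sub>R fact j) \<le> (\<Sum>j. real k ^ j /\<^sub>R fact j)"
    by (rule sum_le_suminf[OF sums_summable[OF exp_converges]]) auto
  also have "\<dots> = exp (real k)" using exp_converges sums_unique by metis
  also have "\<dots> = exp 1 ^ k" by (simp add: exp_of_nat_mult[symmetric])
  also have "\<dots> \<le> 3 ^ k" by (intro power_mono exp_le) simp
  finally have "real k ^ k / fact k \<le> 3 ^ k" by (simp add: divide_inverse mult.commute)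
  then have "real k ^ k / fact k / 9 ^ k \<le> 3 ^ k / 9 ^ k" by (intro divide_right_mono) auto
  also have "(3 :: real) ^ k / 9 ^ k = (1 / 3) ^ k" by (simp flip: power_divide)
  finally show ?thesis by (simp add: power_divide mult.commute)
qed

lemma exp_integral_le_2:
  assumes "prob_space M" and f: "f \<in> borel_measurable M" and d: "1 \<le> d" and \<tau>: "0 < \<tau>"
    and mom: "even_moments M \<tau> f d"
  shows "(\<integral>\<^sup>+x. ennreal (exp (1 / (72 * \<tau>) * \<bar>f x\<bar> powr (1 / real d))) \<partial>M) \<le> 2"
proof -
  interpret prob_space M by fact
  define y where "y x = \<bar>f x\<bar> powr (1 / real d)" for x
  have y0: "0 \<le> y x" for x by (simp add: y_def)
  have yd: "y x ^ d = \<bar>f x\<bar>" for x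
  proof (cases "f x = 0")
    case False
    then have "y x ^ d = y x powr real d" by (simp add: y_def powr_realpow)
    then show ?thesis using d by (simp add: y_def powr_powr)
  qed (use d in \<open>simp add: y_def\<close>)
  have ym: "y \<in> borel_measurable M" unfolding y_def using f by measurable
  have mom_y: "(\<integral>\<^sup>+x. ennreal (y x ^ k) \<partial>M) \<le> ennreal (2 * (8 * \<tau> * k) ^ k)" if k: "1 \<le> k" for k
  proof -
    obtain m where m: "1 \<le> m" "k \<le> 2 ^ m" "2 ^ m \<le> 2 * k" using ex_power2_between[OF k] by blast
    define p :: nat where "p = 2 ^ m"
    define s where "s = 4 * \<tau> * 2 ^ m"
    have s: "0 < s" using \<tau> by (simp add: s_def)
    have kdp: "k \<le> d * p"
    proof -
      have "k \<le> p" using m(2) by (simp add: p_def)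
      also have "p \<le> d * p" using d by (cases d) auto
      finally show ?thesis .
    qed
    \<comment> \<open>Pointwise interpolation: (y/s)^k is at most 1 if y \<le> s, and at most
      (y/s)^(d p) otherwise, as k \<le> d p. Since \<integral> f^p \<le> s^(d p), the right side
      integrates to at most 2 s^k.\<close>
    have pw: "y x ^ k \<le> s ^ k + s ^ k / s ^ (d * p) * f x ^ p" for x
    proof -
      have fp: "f x ^ p = y x ^ (d * p)"
        using m(1) by (simp add: power_mult yd p_def power_even_abs)
      show ?thesis
      proof (cases "y x \<le> s")
        case True
        then have "y x ^ k \<le> s ^ k" using y0 by (intro power_mono)
        then show ?thesis using s y0 by (simp add: fp add_increasing2)
      next
        case False
        then have "1 \<le> y x / s" using s by simp
        then have "(y x / s) ^ k \<le> (y x / s) ^ (d * p)" using kdp by (intro power_increasing)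
        then have "s ^ k * (y x / s) ^ k \<le> s ^ k * (y x / s) ^ (d * p)" using s by (intro mult_left_mono) auto
        then have "y x ^ k \<le> s ^ k / s ^ (d * p) * f x ^ p" using s by (simp add: fp power_divide)
        then show ?thesis using s by (simp add: add_increasing)
      qed
    qed
    have fp0: "0 \<le> f x ^ p" for x using m(1) by (intro zero_le_even_power) (simp add: p_def)
    note int = even_moments_integrable[OF mom f \<tau> m(1), folded p_def s_def]
    have "(\<integral>\<^sup>+x. ennreal (y x ^ k) \<partial>M) \<le> (\<integral>\<^sup>+x. ennreal (s ^ k + s ^ k / s ^ (d * p) * f x ^ p) \<partial>M)"
      by (intro nn_integral_mono ennreal_leI pw)
    also have "\<dots> = ennreal (\<integral>x. s ^ k + s ^ k / s ^ (d * p) * f x ^ p \<partial>M)"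
      by (rule nn_integral_eq_integral) (use int(1) s fp0 in auto)
    also have "\<dots> \<le> ennreal (2 * (8 * \<tau> * k) ^ k)"
    proof (rule ennreal_leI)
      have "(\<integral>x. s ^ k + s ^ k / s ^ (d * p) * f x ^ p \<partial>M) = s ^ k + s ^ k / s ^ (d * p) * (\<integral>x. f x ^ p \<partial>M)"
        using int(1) by (simp add: prob_space)
      also have "\<dots> \<le> s ^ k + s ^ k / s ^ (d * p) * (s ^ d) ^ p"
        using int(2) s by (intro add_left_mono mult_left_mono) auto
      also have "\<dots> = 2 * s ^ k" using s by (simp add: power_mult)
      also have "\<dots> \<le> 2 * (8 * \<tau> * k) ^ k"
      proof -
        have "(2::real) ^ m \<le> 2 * k" using m(3) by (metis of_nat_le_iff of_nat_mult of_nat_numeral of_nat_power)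
        then have "s \<le> 8 * \<tau> * k" using \<tau> by (simp add: s_def)
        then show ?thesis using s by (intro mult_left_mono power_mono) auto
      qed
      finally show "(\<integral>x. s ^ k + s ^ k / s ^ (d * p) * f x ^ p \<partial>M) \<le> 2 * (8 * \<tau> * k) ^ k" .
    qed
    finally show ?thesis .
  qed
  \<comment> \<open>72 = 8 * 9: the base 8 \<tau> k of the k-th moment becomes k / 9, as
    \<open>power_div_fact_le\<close> expects.\<close>
  define a where "a = 1 / (72 * \<tau>)"
  have a: "0 < a" using \<tau> by (simp add: a_def)
  \<comment> \<open>1 + 2 (1/3 + 1/9 + ...) = 2; the ratio 1/3 is chosen for this total.\<close>
  define b where "b k = (if k = 0 then 1 else 2 * (1 / 3 :: real) ^ k)" for k :: nat
  have "(\<lambda>k. (2 / 3) * (1 / 3 :: real) ^ k) sums ((2 / 3) * (1 / (1 - 1 / 3)))"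
    by (intro sums_mult geometric_sums) simp
  then have "(\<lambda>k. b (Suc k)) sums 1" by (simp add: b_def)
  then have b_sums: "b sums 2" using sums_Suc[of b 1] by (simp add: b_def)
  have term_le: "(\<integral>\<^sup>+x. ennreal ((a * y x) ^ k /\<^sub>R fact k) \<partial>M) \<le> ennreal (b k)" for k
  proof (cases "k = 0")
    case True
    then show ?thesis by (simp add: b_def emeasure_space_1)
  next
    case False
    have "(\<integral>\<^sup>+x. ennreal ((a * y x) ^ k /\<^sub>R fact k) \<partial>M) = (\<integral>\<^sup>+x. ennreal (a ^ k / fact k) * ennreal (y x ^ k) \<partial>M)"
      using a y0 by (intro nn_integral_cong) (simp add: power_mult_distrib divide_inverse mult_ac flip: ennreal_mult')
    also have "\<dots> = ennreal (a ^ k / fact k) * (\<integral>\<^sup>+x. ennreal (y x ^ k) \<partial>M)"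
      using ym by (intro nn_integral_cmult) measurable
    also have "\<dots> \<le> ennreal (a ^ k / fact k) * ennreal (2 * (8 * \<tau> * k) ^ k)"
      by (rule mult_left_mono[OF mom_y]) (use False in auto)
    also have "\<dots> = ennreal (a ^ k / fact k * (2 * (8 * \<tau> * k) ^ k))"
      by (rule ennreal_mult'[symmetric]) (use a in simp)
    also have "a ^ k / fact k * (2 * (8 * \<tau> * k) ^ k) = 2 * ((real k / 9) ^ k / fact k)"
    proof -
      have "a * (8 * \<tau> * k) = real k / 9" using \<tau> by (simp add: a_def)
      then have "a ^ k * (8 * \<tau> * k) ^ k = (real k / 9) ^ k" by (simp only: power_mult_distrib[symmetric])
      then show ?thesis by simp
    qed
    also have "ennreal \<dots> \<le> ennreal (b k)"
      using power_div_fact_le[of k] False by (intro ennreal_leI) (simp add: b_def)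
    finally show ?thesis .
  qed
  have "(\<integral>\<^sup>+x. ennreal (exp (a * y x)) \<partial>M) = (\<integral>\<^sup>+x. (\<Sum>k. ennreal ((a * y x) ^ k /\<^sub>R fact k)) \<partial>M)"
    by (intro nn_integral_cong suminf_ennreal_eq[symmetric] exp_converges) (use a y0 in auto)
  also have "\<dots> = (\<Sum>k. \<integral>\<^sup>+x. ennreal ((a * y x) ^ k /\<^sub>R fact k) \<partial>M)"
    by (rule nn_integral_suminf) (use ym in measurable)
  also have "\<dots> \<le> (\<Sum>k. ennreal (b k))" by (intro suminf_le term_le) auto
  also have "\<dots> = ennreal 2" by (rule suminf_ennreal_eq[OF _ b_sums]) (simp add: b_def)
  finally show ?thesis by (simp add: a_def y_def)
qed

section \<open>Operator norms of derivatives\<close>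

text \<open>Vectors with index from k on are unconstrained, as \<open>deriv_form n k\<close> ignores
  them; for k = 0 every v belongs to the set.\<close>

definition unit_tuples :: "nat \<Rightarrow> nat \<Rightarrow> (nat \<Rightarrow> nat \<Rightarrow> real) set"
  where "unit_tuples n k =
    {v. \<forall>j<k. v j \<in> topspace (Euclidean_space n) \<and> euclidean_norm n (v j) = 1}"

lemma op_norm_eq: "op_norm n k f x = Sup (deriv_form n k f x ` unit_tuples n k)"
  unfolding op_norm_def unit_tuples_def by (rule arg_cong[of _ _ Sup]) auto

lemma euclidean_norm_eq_1_iff: "euclidean_norm n v = 1 \<longleftrightarrow> (\<Sum>i<n. (v i)\<^sup>2) = 1"
  by (simp add: euclidean_norm_def L2_set_def)

lemma abs_component_le_1:
  assumes "euclidean_norm n v = 1" "i < n"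
  shows "\<bar>v i\<bar> \<le> 1"
proof -
  have "(v i)\<^sup>2 \<le> (\<Sum>i<n. (v i)\<^sup>2)" by (rule member_le_sum) (use assms(2) in auto)
  then show ?thesis using assms(1) by (simp add: euclidean_norm_eq_1_iff abs_square_le_1)
qed

lemma finite_multi_indices: "finite {is. length is = k \<and> set is \<subseteq> {..<n :: nat}}"
  using finite_lists_length_eq[OF finite_lessThan[of n], of k] by (simp add: conj_commute)

lemma abs_deriv_form_le:
  assumes "v \<in> unit_tuples n k"
  shows "\<bar>deriv_form n k f x v\<bar> \<le> (\<Sum>is\<in>{is. length is = k \<and> set is \<subseteq> {..<n}}. \<bar>iter_partial is f x\<bar>)"
  unfolding deriv_form_def
proof (rule order_trans[OF sum_abs sum_mono])
  fix "is" assume "is": "is \<in> {is. length is = k \<and> set is \<subseteq> {..<n}}"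
  have "\<bar>\<Prod>j<k. v j (is ! j)\<bar> \<le> 1"
    unfolding abs_prod
  proof (rule prod_le_1)
    fix j assume "j \<in> {..<k}"
    moreover from this have "is ! j \<in> set is" using "is" by simp
    moreover have "set is \<subseteq> {..<n}" using "is" by simp
    ultimately have "is ! j \<in> {..<n}" "euclidean_norm n (v j) = 1"
      using assms by (auto simp only: unit_tuples_def subset_iff mem_Collect_eq lessThan_iff)
    then show "0 \<le> \<bar>v j (is ! j)\<bar> \<and> \<bar>v j (is ! j)\<bar> \<le> 1" using abs_component_le_1 by simp
  qed
  then show "\<bar>iter_partial is f x * (\<Prod>j<k. v j (is ! j))\<bar> \<le> \<bar>iter_partial is f x\<bar>"
    by (simp add: abs_mult mult_left_le)
qed

lemma bdd_above_deriv_form: "bdd_above (deriv_form n k f x ` unit_tuples n k)"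
  by (rule bdd_aboveI2[OF order_trans[OF abs_ge_self abs_deriv_form_le]])

lemma deriv_form_le_op_norm: "v \<in> unit_tuples n k \<Longrightarrow> deriv_form n k f x v \<le> op_norm n k f x"
  unfolding op_norm_eq by (rule cSUP_upper[OF _ bdd_above_deriv_form])

text \<open>\<open>iter_partial\<close> applies the head of the index list last. So slot 0 is the
  direction in which the k-form of the remaining vectors is differentiated, and the inner sum is the
  i-th partial derivative of that form.\<close>

lemma deriv_form_Suc:
  "deriv_form n (Suc k) f x v =
    (\<Sum>i<n. v 0 i * (\<Sum>is\<in>{is. length is = k \<and> set is \<subseteq> {..<n}}.
      iter_partial (i # is) f x * (\<Prod>j<k. v (Suc j) (is ! j))))"
proof -
  let ?L = "\<lambda>k. {is. length is = k \<and> set is \<subseteq> {..<n}}"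
  have L: "?L (Suc k) = (\<lambda>(i, is). i # is) ` ({..<n} \<times> ?L k)"
    by (auto simp: length_Suc_conv image_iff)
  have "deriv_form n (Suc k) f x v =
      (\<Sum>(i, is)\<in>{..<n} \<times> ?L k. iter_partial (i # is) f x * (\<Prod>j<Suc k. v j ((i # is) ! j)))"
    unfolding deriv_form_def L
    by (subst sum.reindex) (auto simp: inj_on_def case_prod_unfold simp del: prod.lessThan_Suc)
  also have "\<dots> = (\<Sum>i<n. \<Sum>is\<in>?L k. iter_partial (i # is) f x * (\<Prod>j<Suc k. v j ((i # is) ! j)))"
    by (rule sum.cartesian_product[symmetric])
  also have "\<dots> = (\<Sum>i<n. v 0 i * (\<Sum>is\<in>?L k. iter_partial (i # is) f x * (\<Prod>j<k. v (Suc j) (is ! j))))"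
    by (simp add: prod.lessThan_Suc_shift sum_distrib_left mult_ac del: prod.lessThan_Suc)
  finally show ?thesis .
qed

text \<open>Flip the sign of \<open>v 0\<close>. This requires a slot:
  \<open>op_norm n 0 f x\<close> is f x itself, possibly negative.\<close>

lemma abs_deriv_form_le_op_norm:
  assumes v: "v \<in> unit_tuples n (Suc k)"
  shows "\<bar>deriv_form n (Suc k) f x v\<bar> \<le> op_norm n (Suc k) f x"
proof -
  have "v(0 := \<lambda>i. - v 0 i) \<in> unit_tuples n (Suc k)"
    using v by (auto simp: unit_tuples_def euclidean_norm_eq_1_iff topspace_Euclidean_space)
  from deriv_form_le_op_norm[OF this, of f x]
  have "- deriv_form n (Suc k) f x v \<le> op_norm n (Suc k) f x"
    unfolding deriv_form_Suc by (simp add: sum_negf)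
  then show ?thesis using deriv_form_le_op_norm[OF v, of f x] by linarith
qed

lemma unit_tuples_nonempty: "1 \<le> n \<Longrightarrow> unit_tuples n k \<noteq> {}"
proof -
  assume n: "1 \<le> n"
  have "(\<Sum>i<n. (if i = 0 then 1 else 0 :: real)\<^sup>2) = (\<Sum>i<n. if i = 0 then 1 else 0)"
    by (intro sum.cong) auto
  also have "\<dots> = 1" using n by (simp add: sum.delta)
  finally have "(\<lambda>j i. if i = 0 then 1 else 0) \<in> unit_tuples n k"
    using n by (auto simp: unit_tuples_def euclidean_norm_eq_1_iff topspace_Euclidean_space)
  then show ?thesis by blast
qed

lemma op_norm_nonneg: "1 \<le> n \<Longrightarrow> 0 \<le> op_norm n (Suc k) f x"
  using unit_tuples_nonempty[of n "Suc k"] abs_deriv_form_le_op_norm[of _ n k f x]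
  by (meson abs_ge_zero all_not_in_conv order_trans)

text \<open>The form is continuous in v, so a countable dense set of tuples, chosen independently of
  f and x, approaches the supremum. It yields both the measurability of the operator norm and its
  approximation by finite maxima.\<close>

lemma dense_unit_tuples:
  assumes n: "1 \<le> n"
  obtains V :: "nat \<Rightarrow> nat \<Rightarrow> nat \<Rightarrow> real"
  where "\<And>j. V j \<in> unit_tuples n k"
    and "\<And>f x c. c < op_norm n k f x \<Longrightarrow> \<exists>j. c < deriv_form n k f x (V j)"
proof -
  obtain T where T: "countable T" "T \<subseteq> unit_tuples n k" "unit_tuples n k \<subseteq> closure T"
    using separable by blast
  have ne: "T \<noteq> {}" using T(3) unit_tuples_nonempty[OF n, of k] by auto
  show thesis
  proof (rule that)
    show "from_nat_into T j \<in> unit_tuples n k" for j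
      using from_nat_into[OF ne] T(2) by blast
    fix f x c assume c: "c < op_norm n k f x"
    obtain v where v: "v \<in> unit_tuples n k" "c < deriv_form n k f x v"
      using c unfolding op_norm_eq less_cSUP_iff[OF unit_tuples_nonempty[OF n] bdd_above_deriv_form] by auto
    have coord: "continuous_on UNIV (\<lambda>v :: nat \<Rightarrow> nat \<Rightarrow> real. v j i)" for i j
      by (rule continuous_on_product_then_coordinatewise[OF continuous_on_product_then_coordinatewise[OF continuous_on_id]])
    have "continuous_on UNIV (deriv_form n k f x)"
      unfolding deriv_form_def[abs_def]
      by (intro continuous_on_sum continuous_on_mult continuous_on_const continuous_on_prod coord)
    then have "open {u. c < deriv_form n k f x u}"
      by (intro open_Collect_less continuous_on_const)
    moreover have "v \<in> closure T" using v T(3) by blast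
    ultimately have "T \<inter> {u. c < deriv_form n k f x u} \<noteq> {}"
      using v(2) open_Int_closure_eq_empty[of "{u. c < deriv_form n k f x u}" T] by auto
    then obtain u where "u \<in> T" "c < deriv_form n k f x u" by auto
    then show "\<exists>j. c < deriv_form n k f x (from_nat_into T j)"
      using from_nat_into_surj[OF T(1)] by metis
  qed
qed

lemma C_diff_iter_partial:
  assumes "C_diff n (k + d) G f"
  shows "length is = k \<Longrightarrow> set is \<subseteq> {..<n} \<Longrightarrow> C_diff n d G (iter_partial is f)"
  using assms
proof (induction "is" arbitrary: k d)
  case (Cons i "is")
  then obtain k' where k: "k = Suc k'" "length is = k'" by auto
  have "C_diff n (Suc d) G (iter_partial is f)"
    by (rule Cons.IH[OF k(2)]) (use Cons.prems k in auto)
  then show ?case using Cons.prems by simp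
qed simp

lemma has_partials_deriv_form:
  assumes "C_diff n (Suc k) G f"
  shows "has_partials n G (\<lambda>x. deriv_form n k f x v)
    (\<lambda>i x. \<Sum>is\<in>{is. length is = k \<and> set is \<subseteq> {..<n}}. iter_partial (i # is) f x * (\<Prod>j<k. v j (is ! j)))"
  unfolding deriv_form_def
proof (rule has_partials_sum[OF finite_multi_indices])
  fix "is" assume "is \<in> {is. length is = k \<and> set is \<subseteq> {..<n}}"
  then have "C_diff n (Suc 0) G (iter_partial is f)"
    using C_diff_iter_partial[of n k "Suc 0" G f "is"] assms by simp
  from has_partials_cmult[OF C_diff_Suc_imp_has_partials[OF this], of "\<Prod>j<k. v j (is ! j)"]
  show "has_partials n G (\<lambda>x. iter_partial is f x * (\<Prod>j<k. v j (is ! j)))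
      (\<lambda>i x. iter_partial (i # is) f x * (\<Prod>j<k. v j (is ! j)))"
    by (simp add: mult.commute)
qed

text \<open>Duality: with D the gradient of the k-form and w = D / |D| in the new slot 0,
  \<open>deriv_form_Suc\<close> gives |D| as a value of the (k+1)-form on unit vectors.\<close>

lemma gradient_deriv_form_le:
  assumes v: "v \<in> unit_tuples n k"
  shows "(\<Sum>i<n. (\<Sum>is\<in>{is. length is = k \<and> set is \<subseteq> {..<n}}.
      iter_partial (i # is) f x * (\<Prod>j<k. v j (is ! j)))\<^sup>2) \<le> (op_norm n (Suc k) f x)\<^sup>2"
proof -
  define D where "D i = (\<Sum>is\<in>{is. length is = k \<and> set is \<subseteq> {..<n}}.
      iter_partial (i # is) f x * (\<Prod>j<k. v j (is ! j)))" for i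
  define r where "r = sqrt (\<Sum>i<n. (D i)\<^sup>2)"
  have r2: "(\<Sum>i<n. (D i)\<^sup>2) = r\<^sup>2" unfolding r_def by (simp add: sum_nonneg)
  have r0: "0 \<le> r" unfolding r_def by (simp add: sum_nonneg)
  have "r\<^sup>2 \<le> (op_norm n (Suc k) f x)\<^sup>2"
  proof (cases "r = 0")
    case False
    define w where "w i = (if i < n then D i / r else 0)" for i
    have "(\<Sum>i<n. (w i)\<^sup>2) = (\<Sum>i<n. (D i)\<^sup>2) / r\<^sup>2"
      by (simp add: w_def power_divide sum_divide_distrib)
    then have "(\<Sum>i<n. (w i)\<^sup>2) = 1" using False by (simp add: r2)
    then have "case_nat w v \<in> unit_tuples n (Suc k)"
      using v by (auto simp: unit_tuples_def euclidean_norm_eq_1_iff topspace_Euclidean_space w_def split: nat.split)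
    from deriv_form_le_op_norm[OF this, of f x]
    have "(\<Sum>i<n. w i * D i) \<le> op_norm n (Suc k) f x" by (simp add: deriv_form_Suc D_def)
    moreover have "(\<Sum>i<n. w i * D i) = (\<Sum>i<n. (D i)\<^sup>2) / r"
      by (simp add: w_def power2_eq_square sum_divide_distrib)
    ultimately have "r \<le> op_norm n (Suc k) f x"
      using False unfolding r2 by (simp add: power2_eq_square)
    then show ?thesis by (rule power_mono[OF _ r0])
  qed simp
  then show ?thesis by (simp only: r2[symmetric] D_def)
qed

lemma borel_measurable_op_norm:
  assumes M: "borel_prob_on G M" and n: "1 \<le> n" and f: "C_diff n k G f"
  shows "op_norm n k f \<in> borel_measurable M"
proof -
  obtain V :: "nat \<Rightarrow> nat \<Rightarrow> nat \<Rightarrow> real" where V: "\<And>j. V j \<in> unit_tuples n k"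
    "\<And>f x c. c < op_norm n k f x \<Longrightarrow> \<exists>j. c < deriv_form n k f x (V j)"
    using dense_unit_tuples[OF n] by blast
  have bdd: "bdd_above (range (\<lambda>j. deriv_form n k f x (V j)))" for x
    by (rule bdd_aboveI2[OF deriv_form_le_op_norm[OF V(1)]])
  have "continuous_on G (\<lambda>x. deriv_form n k f x (V j))" for j
    unfolding deriv_form_def
  proof (intro continuous_on_sum continuous_on_mult continuous_on_const)
    fix "is" assume "is \<in> {is. length is = k \<and> set is \<subseteq> {..<n}}"
    then have "C_diff n 0 G (iter_partial is f)" using C_diff_iter_partial[of n k 0 G f "is"] f by simp
    then show "continuous_on G (\<lambda>x. iter_partial is f x)" by simp
  qed
  then have "(\<lambda>x. deriv_form n k f x (V j)) \<in> borel_measurable M" for j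
    by (rule borel_measurable_borel_prob_on[OF M])
  then have "(\<lambda>x. SUP j. deriv_form n k f x (V j)) \<in> borel_measurable M"
    using bdd by (intro borel_measurable_cSUP) auto
  moreover have "(SUP j. deriv_form n k f x (V j)) = op_norm n k f x" for x
  proof (rule antisym)
    show "(SUP j. deriv_form n k f x (V j)) \<le> op_norm n k f x"
      by (rule cSUP_least) (auto intro: deriv_form_le_op_norm V(1))
    show "op_norm n k f x \<le> (SUP j. deriv_form n k f x (V j))"
    proof (rule dense_le)
      fix c assume "c < op_norm n k f x"
      then obtain j where "c < deriv_form n k f x (V j)" using V(2) by blast
      then show "c \<le> (SUP j. deriv_form n k f x (V j))"
        using cSUP_upper[OF UNIV_I bdd] by (meson less_imp_le order_trans)
    qed
  qed
  ultimately show ?thesis by simp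
qed

section \<open>Descent along the derivatives\<close>

text \<open>Convexity of the square. It is applied to the gradient of a smoothed maximum, a convex
  combination of the two given gradients.\<close>

lemma sum_sq_convex_le:
  fixes a b :: "nat \<Rightarrow> real"
  assumes "0 \<le> l" "l \<le> 1" "(\<Sum>i<n. (a i)\<^sup>2) \<le> C" "(\<Sum>i<n. (b i)\<^sup>2) \<le> C"
  shows "(\<Sum>i<n. (l * a i + (1 - l) * b i)\<^sup>2) \<le> C"
proof -
  have "(\<Sum>i<n. (l * a i + (1 - l) * b i)\<^sup>2) \<le> (\<Sum>i<n. l * (a i)\<^sup>2 + (1 - l) * (b i)\<^sup>2)"
  proof (rule sum_mono)
    fix i
    have "l * (a i)\<^sup>2 + (1 - l) * (b i)\<^sup>2 - (l * a i + (1 - l) * b i)\<^sup>2 = l * (1 - l) * (a i - b i)\<^sup>2"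
      by (simp add: power2_eq_square algebra_simps)
    moreover have "0 \<le> l * (1 - l) * (a i - b i)\<^sup>2" using assms by simp
    ultimately show "(l * a i + (1 - l) * b i)\<^sup>2 \<le> l * (a i)\<^sup>2 + (1 - l) * (b i)\<^sup>2" by linarith
  qed
  also have "\<dots> = l * (\<Sum>i<n. (a i)\<^sup>2) + (1 - l) * (\<Sum>i<n. (b i)\<^sup>2)"
    by (simp add: sum.distrib sum_distrib_left)
  also have "\<dots> \<le> l * C + (1 - l) * C"
    using assms by (intro add_mono mult_left_mono) auto
  finally show ?thesis by (simp add: algebra_simps)
qed

lemma has_partials_smooth_max:
  assumes f: "has_partials n G f f'" "\<And>x. x \<in> G \<Longrightarrow> (\<Sum>i<n. (f' i x)\<^sup>2) \<le> C x"
    and g: "has_partials n G g g'" "\<And>x. x \<in> G \<Longrightarrow> (\<Sum>i<n. (g' i x)\<^sup>2) \<le> C x"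
    and \<epsilon>: "0 < \<epsilon>"
  obtains h h' where "has_partials n G h h'" "\<And>x. x \<in> G \<Longrightarrow> (\<Sum>i<n. (h' i x)\<^sup>2) \<le> C x"
    "\<And>x. max (f x) (g x) \<le> h x" "\<And>x. h x \<le> max (f x) (g x) + \<epsilon>"
proof -
  \<comment> \<open>max(f, g) = (f + g + |f - g|) / 2 with the absolute value replaced by s. Its
    derivative q = y / s y lies in [-1, 1], so the two gradients get the weights (1 + q) / 2 and (1
    - q) / 2.\<close>
  define s where "s y = sqrt (y\<^sup>2 + \<epsilon>\<^sup>2)" for y
  have s_pos: "0 < s y" for y using \<epsilon> by (simp add: s_def add_nonneg_pos)
  have s_ge: "\<bar>y\<bar> \<le> s y" for y unfolding s_def by (rule real_le_rsqrt) simp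
  have s_le: "s y \<le> \<bar>y\<bar> + \<epsilon>" for y
    unfolding s_def by (rule real_le_lsqrt) (use \<epsilon> in \<open>auto simp: power2_sum\<close>)
  have D: "(s has_real_derivative y / s y) (at y)" for y
  proof -
    have "0 < y\<^sup>2 + \<epsilon>\<^sup>2" using \<epsilon> by (simp add: add_nonneg_pos)
    then show ?thesis unfolding s_def[abs_def]
      by (auto intro!: derivative_eq_intros simp: field_simps)
  qed
  have cs: "continuous_on UNIV s"
    by (rule DERIV_continuous_on[where D = "\<lambda>y. y / s y"]) (rule has_field_derivative_at_within[OF D])
  have C: "continuous_on UNIV (\<lambda>y. y / s y)"
    by (intro continuous_on_divide continuous_on_id cs ballI) (use s_pos in \<open>auto simp: less_le\<close>)
  define \<delta> where "\<delta> x = f x + (-1) * g x" for x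
  have \<delta>: "has_partials n G \<delta> (\<lambda>i x. f' i x + (-1) * g' i x)"
    unfolding \<delta>_def[abs_def] by (rule has_partials_add[OF f(1) has_partials_cmult[OF g(1)]])
  note h = has_partials_cmult[OF has_partials_add[OF has_partials_add[OF f(1) g(1)] has_partials_compose[OF \<delta> D C]], of "1/2"]
  show thesis
  proof (rule that[OF h])
    fix x assume x: "x \<in> G"
    define q where "q = \<delta> x / s (\<delta> x)"
    define l where "l = (1 + q) / 2"
    have "\<bar>q\<bar> \<le> 1" using s_ge[of "\<delta> x"] s_pos[of "\<delta> x"] by (simp add: q_def abs_divide)
    then have l: "0 \<le> l" "l \<le> 1" unfolding l_def by auto
    have eq: "1 / 2 * (f' i x + g' i x + \<delta> x / s (\<delta> x) * (f' i x + (-1) * g' i x)) = l * f' i x + (1 - l) * g' i x" for i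
      unfolding q_def[symmetric] by (simp add: l_def field_simps)
    show "(\<Sum>i<n. (1 / 2 * (f' i x + g' i x + \<delta> x / s (\<delta> x) * (f' i x + (-1) * g' i x)))\<^sup>2) \<le> C x"
      unfolding eq by (rule sum_sq_convex_le[OF l f(2)[OF x] g(2)[OF x]])
  next
    fix x
    show "max (f x) (g x) \<le> 1 / 2 * (f x + g x + s (\<delta> x))"
      using s_ge[of "\<delta> x"] by (auto simp: \<delta>_def max_def)
    show "1 / 2 * (f x + g x + s (\<delta> x)) \<le> max (f x) (g x) + \<epsilon>"
      using s_le[of "\<delta> x"] \<epsilon> by (auto simp: \<delta>_def max_def)
  qed
qed

text \<open>Iterating \<open>has_partials_smooth_max\<close> leaves the gradient bound C unchanged;
  only the tolerances add up, so the induction hypothesis and the new maximum get \<epsilon> / 2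
  each.\<close>

lemma has_partials_smooth_Max:
  assumes u: "\<And>j :: nat. has_partials n G (u j) (u' j)" "\<And>j x. x \<in> G \<Longrightarrow> (\<Sum>i<n. (u' j i x)\<^sup>2) \<le> C x"
    and \<epsilon>: "0 < \<epsilon>"
  shows "\<exists>g g'. has_partials n G g g' \<and> (\<forall>x\<in>G. (\<Sum>i<n. (g' i x)\<^sup>2) \<le> C x) \<and>
    (\<forall>x. \<forall>j\<le>N. u j x \<le> g x) \<and> (\<forall>x. \<exists>j\<le>N. g x \<le> u j x + \<epsilon>)"
  using \<epsilon>
proof (induction N arbitrary: \<epsilon>)
  case 0
  then show ?case using u by (intro exI[of _ "u 0"] exI[of _ "u' 0"]) auto
next
  case (Suc N)
  have \<epsilon>2: "0 < \<epsilon> / 2" using Suc.prems by simp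
  from Suc.IH[OF this] obtain g g' where g: "has_partials n G g g'"
    "\<And>x. x \<in> G \<Longrightarrow> (\<Sum>i<n. (g' i x)\<^sup>2) \<le> C x"
    "\<And>x j. j \<le> N \<Longrightarrow> u j x \<le> g x" "\<And>x. \<exists>j\<le>N. g x \<le> u j x + \<epsilon> / 2" by blast
  obtain h h' where h: "has_partials n G h h'" "\<And>x. x \<in> G \<Longrightarrow> (\<Sum>i<n. (h' i x)\<^sup>2) \<le> C x"
    "\<And>x. max (g x) (u (Suc N) x) \<le> h x" "\<And>x. h x \<le> max (g x) (u (Suc N) x) + \<epsilon> / 2"
    using has_partials_smooth_max[OF g(1,2) u(1,2) \<epsilon>2] by blast
  have "u j x \<le> h x" if "j \<le> Suc N" for j x
    using that h(3)[of x] g(3)[of j x] by (cases "j = Suc N") auto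
  moreover have "\<exists>j\<le>Suc N. h x \<le> u j x + \<epsilon>" for x
  proof (cases "g x \<le> u (Suc N) x")
    case True
    then show ?thesis using h(4)[of x] \<epsilon>2 by (intro exI[of _ "Suc N"]) auto
  next
    case False
    obtain j where "j \<le> N" "g x \<le> u j x + \<epsilon> / 2" using g(4) by blast
    then show ?thesis using h(4)[of x] False by (intro exI[of _ j]) auto
  qed
  ultimately show ?case using h(1,2) by blast
qed

text \<open>For a > 0 a bounded C^1 function with derivative in [-1, 1], tending to t as a tends to
  0. Cutting off at a level would not be C^1.\<close>

definition truncate :: "real \<Rightarrow> real \<Rightarrow> real"
  where "truncate a t = t / (1 + a * t\<^sup>2)"

lemma abs_truncate_le:
  assumes "0 < a"
  shows "\<bar>truncate a t\<bar> \<le> \<bar>t\<bar>" "\<bar>truncate a t\<bar> \<le> 1 + 1 / a"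
proof -
  have p: "1 \<le> 1 + a * t\<^sup>2" using assms by simp
  then have eq: "\<bar>truncate a t\<bar> = \<bar>t\<bar> / (1 + a * t\<^sup>2)" by (simp add: truncate_def abs_divide)
  show "\<bar>truncate a t\<bar> \<le> \<bar>t\<bar>" unfolding eq using p by (simp add: divide_le_eq mult_le_cancel_left1)
  have "\<bar>t\<bar> \<le> (1 + 1 / a) * (1 + a * t\<^sup>2)"
  proof (cases "\<bar>t\<bar> \<le> 1")
    case True
    have "1 * 1 \<le> (1 + 1 / a) * (1 + a * t\<^sup>2)" by (rule mult_mono) (use assms p in auto)
    with True show ?thesis by simp
  next
    case False
    then have "\<bar>t\<bar> * 1 \<le> \<bar>t\<bar> * \<bar>t\<bar>" by (intro mult_left_mono) auto
    then have "\<bar>t\<bar> \<le> t\<^sup>2" by (simp add: power2_eq_square abs_mult_self)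
    moreover have "(1 + 1 / a) * (1 + a * t\<^sup>2) = 1 + 1 / a + a * t\<^sup>2 + t\<^sup>2"
      using assms by (simp add: field_simps)
    moreover have "0 \<le> 1 / a" "0 \<le> a * t\<^sup>2" using assms by auto
    ultimately show ?thesis by linarith
  qed
  then show "\<bar>truncate a t\<bar> \<le> 1 + 1 / a" unfolding eq using p by (simp add: divide_le_eq)
qed

lemma has_partials_truncate:
  assumes f: "has_partials n G f f'" "\<And>x. x \<in> G \<Longrightarrow> (\<Sum>i<n. (f' i x)\<^sup>2) \<le> C x" and a: "0 < a"
  obtains g' where "has_partials n G (\<lambda>x. truncate a (f x)) g'" "\<And>x. x \<in> G \<Longrightarrow> (\<Sum>i<n. (g' i x)\<^sup>2) \<le> C x"
    "bounded ((\<lambda>x. truncate a (f x)) ` G)"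
proof -
  define \<phi> where "\<phi> y = (1 - a * y\<^sup>2) / (1 + a * y\<^sup>2)\<^sup>2" for y
  have p: "1 \<le> 1 + a * y\<^sup>2" for y using a by simp
  have nz: "1 + a * y\<^sup>2 \<noteq> 0" for y using p[of y] by linarith
  have D: "(truncate a has_real_derivative \<phi> y) (at y)" for y
    unfolding truncate_def[abs_def] \<phi>_def using nz[of y]
    by (auto intro!: derivative_eq_intros simp: power2_eq_square algebra_simps)
  have C: "continuous_on UNIV \<phi>"
    unfolding \<phi>_def[abs_def]
    by (intro continuous_on_divide continuous_on_diff continuous_on_add continuous_on_mult continuous_on_power
        continuous_on_const continuous_on_id ballI) (use nz in auto)
  have \<phi>1: "(\<phi> y)\<^sup>2 \<le> 1" for y
  proof -
    have "\<bar>1 - a * y\<^sup>2\<bar> \<le> (1 + a * y\<^sup>2) * 1" using a p[of y] by (simp add: abs_le_iff)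
    also have "\<dots> \<le> (1 + a * y\<^sup>2)\<^sup>2" unfolding power2_eq_square[of "1 + _"] using p[of y] by (intro mult_left_mono) auto
    finally have "\<bar>\<phi> y\<bar> \<le> 1" using nz[of y] by (simp add: \<phi>_def abs_divide divide_le_eq)
    then show ?thesis by (simp add: abs_square_le_1)
  qed
  show thesis
  proof (rule that[OF has_partials_compose[OF f(1) D C]])
    fix x assume x: "x \<in> G"
    have "(\<Sum>i<n. (\<phi> (f x) * f' i x)\<^sup>2) = (\<phi> (f x))\<^sup>2 * (\<Sum>i<n. (f' i x)\<^sup>2)"
      by (simp add: power_mult_distrib sum_distrib_left)
    also have "\<dots> \<le> 1 * (\<Sum>i<n. (f' i x)\<^sup>2)" by (rule mult_right_mono[OF \<phi>1]) (simp add: sum_nonneg)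
    also have "\<dots> \<le> C x" using f(2)[OF x] by simp
    finally show "(\<Sum>i<n. (\<phi> (f x) * f' i x)\<^sup>2) \<le> C x" .
  next
    show "bounded ((\<lambda>x. truncate a (f x)) ` G)"
      unfolding bounded_iff using abs_truncate_le(2)[OF a] by auto
  qed
qed

lemma tendsto_truncate:
  assumes "(\<lambda>N. t N) \<longlonglongrightarrow> l"
  shows "(\<lambda>N. truncate (1 / (real N + 1)) (t N)) \<longlonglongrightarrow> l"
proof -
  have "(\<lambda>N. 1 / (real N + 1)) \<longlonglongrightarrow> 0"
    using LIMSEQ_inverse_real_of_nat by (simp add: inverse_eq_divide add.commute)
  then have "(\<lambda>N. t N / (1 + 1 / (real N + 1) * (t N)\<^sup>2)) \<longlonglongrightarrow> l / (1 + 0 * l\<^sup>2)"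
    by (intro tendsto_divide tendsto_add tendsto_mult tendsto_power tendsto_const assms) auto
  then show ?thesis by (simp add: truncate_def)
qed

text \<open>The operator norm of order k is the limit of smoothed maxima of finitely many forms,
  whose gradients are bounded by the operator norm of order k + 1; truncation makes them bounded.
  The L^2 hypothesis supplies the start of the moment induction.\<close>

lemma even_moments_deriv:
  assumes M: "borel_prob_on G M" and n: "1 \<le> n"
    and P: "poincare_C1 n G M (\<tau>\<^sup>2)" and \<tau>: "0 < \<tau>"
    and f: "C_diff n (Suc k) G f" and k: "1 \<le> k"
    and L2: "(\<integral>\<^sup>+x. ennreal ((op_norm n k f x)\<^sup>2) \<partial>M) \<le> ennreal ((\<tau> ^ Suc e)\<^sup>2)"
    and mom: "even_moments M \<tau> (op_norm n (Suc k) f) e"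
  shows "even_moments M \<tau> (op_norm n k f) (Suc e)"
proof -
  interpret prob_space M using M by (simp add: borel_prob_on_def)
  obtain k' where k': "k = Suc k'" using k by (cases k) auto
  define h where "h = op_norm n k f"
  have hm: "h \<in> borel_measurable M"
    unfolding h_def by (rule borel_measurable_op_norm[OF M n C_diff_le[OF f]]) simp
  obtain V :: "nat \<Rightarrow> nat \<Rightarrow> nat \<Rightarrow> real" where V: "\<And>j. V j \<in> unit_tuples n k"
    "\<And>f x c. c < op_norm n k f x \<Longrightarrow> \<exists>j. c < deriv_form n k f x (V j)"
    using dense_unit_tuples[OF n] by blast
  define u where "u j x = deriv_form n k f x (V j)" for j x
  have u_abs: "\<bar>u j x\<bar> \<le> h x" for j x
    unfolding u_def h_def k' by (rule abs_deriv_form_le_op_norm) (use V(1) k' in simp)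
  \<comment> \<open>More forms and a smaller tolerance at the same time: this makes
    \<open>g N\<close> converge to h.\<close>
  define Q where "Q N g g' \<longleftrightarrow> has_partials n G g g' \<and> (\<forall>x\<in>G. (\<Sum>i<n. (g' i x)\<^sup>2) \<le> (op_norm n (Suc k) f x)\<^sup>2) \<and>
      (\<forall>x. \<forall>j\<le>N. u j x \<le> g x) \<and> (\<forall>x. \<exists>j\<le>N. g x \<le> u j x + 1 / (real N + 1))" for N g g'
  have "\<exists>g g'. Q N g g'" for N
    unfolding Q_def
  proof (rule has_partials_smooth_Max)
    show "has_partials n G (u j) (\<lambda>i x. \<Sum>is\<in>{is. length is = k \<and> set is \<subseteq> {..<n}}.
        iter_partial (i # is) f x * (\<Prod>l<k. V j l (is ! l)))" for j
      unfolding u_def[abs_def] by (rule has_partials_deriv_form[OF f])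
    show "(\<Sum>i<n. (\<Sum>is\<in>{is. length is = k \<and> set is \<subseteq> {..<n}}.
        iter_partial (i # is) f x * (\<Prod>l<k. V j l (is ! l)))\<^sup>2) \<le> (op_norm n (Suc k) f x)\<^sup>2" for j x
      by (rule gradient_deriv_form_le[OF V(1)])
  qed simp
  then obtain g g' where Q: "\<And>N. Q N (g N) (g' N)" by metis
  have g_ge: "u j x \<le> g N x" if "j \<le> N" for j N x using Q[of N] that unfolding Q_def by blast
  have g_le: "g N x \<le> h x + 1 / (real N + 1)" for N x
  proof -
    obtain j where "g N x \<le> u j x + 1 / (real N + 1)" using Q[of N] unfolding Q_def by blast
    then show ?thesis using u_abs[of j x] by linarith
  qed
  \<comment> \<open>The lower bound is \<open>g N x \<ge> u 0 x \<ge> - h x\<close>.\<close>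
  have g_abs: "\<bar>g N x\<bar> \<le> h x + 1 / (real N + 1)" for N x
  proof -
    have "0 \<le> 1 / (real N + 1)" by simp
    then show ?thesis using g_le[of N x] g_ge[of 0 N x] u_abs[of 0 x] unfolding abs_le_iff by linarith
  qed
  have inv_lim: "(\<lambda>N. 1 / (real N + 1)) \<longlonglongrightarrow> 0"
    using LIMSEQ_inverse_real_of_nat by (simp add: inverse_eq_divide add.commute)
  have g_lim: "(\<lambda>N. g N x) \<longlonglongrightarrow> h x" for x
  proof (rule order_tendstoI)
    fix c assume "c < h x"
    then obtain j where "c < u j x" using V(2) unfolding h_def u_def by blast
    then show "\<forall>\<^sub>F N in sequentially. c < g N x"
      by (intro eventually_mono[OF eventually_ge_at_top[of j]] less_le_trans[OF _ g_ge])
  next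
    fix c assume "h x < c"
    have "(\<lambda>N. h x + 1 / (real N + 1)) \<longlonglongrightarrow> h x + 0" by (intro tendsto_add tendsto_const inv_lim)
    then have "\<forall>\<^sub>F N in sequentially. h x + 1 / (real N + 1) < c"
      using \<open>h x < c\<close> by (intro order_tendstoD(2)) auto
    then show "\<forall>\<^sub>F N in sequentially. g N x < c" by (rule eventually_mono) (use g_le le_less_trans in blast)
  qed
  define t where "t N x = truncate (1 / (real N + 1)) (g N x)" for N x
  have "\<exists>t'. has_partials n G (t N) t' \<and> (\<forall>x\<in>G. (\<Sum>i<n. (t' i x)\<^sup>2) \<le> (op_norm n (Suc k) f x)\<^sup>2) \<and>
      bounded (t N ` G)" for N
  proof -
    have "has_partials n G (g N) (g' N)" "\<And>x. x \<in> G \<Longrightarrow> (\<Sum>i<n. (g' N i x)\<^sup>2) \<le> (op_norm n (Suc k) f x)\<^sup>2"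
      using Q[of N] unfolding Q_def by blast+
    then show ?thesis unfolding t_def[abs_def]
      by (rule has_partials_truncate[where a = "1 / (real N + 1)"]) auto
  qed
  then obtain t' where t': "\<And>N. has_partials n G (t N) (t' N)"
    "\<And>N x. x \<in> G \<Longrightarrow> (\<Sum>i<n. (t' N i x)\<^sup>2) \<le> (op_norm n (Suc k) f x)\<^sup>2" "\<And>N. bounded (t N ` G)" by metis
  have h2: "integrable M (\<lambda>x. (h x)\<^sup>2)" "(\<integral>x. (h x)\<^sup>2 \<partial>M) \<le> (\<tau> ^ Suc e)\<^sup>2"
  proof -
    note L2' = L2[folded h_def]
    show "integrable M (\<lambda>x. (h x)\<^sup>2)"
      by (rule integrableI_nonneg) (use hm le_less_trans[OF L2' ennreal_less_top] in auto)
    show "(\<integral>x. (h x)\<^sup>2 \<partial>M) \<le> (\<tau> ^ Suc e)\<^sup>2"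
      by (subst integral_eq_nn_integral) (use hm L2' in \<open>auto intro: enn2real_leI\<close>)
  qed
  \<comment> \<open>Once 1 / (N + 1) < \<tau>^(e+1), the bound (h + 1/(N+1))^2 \<le> 2 h^2 + 2 /
    (N+1)^2 leads to 8 \<tau>^(2(e+1)), and 8 \<le> 8^(2(e+1)).\<close>
  have "(\<lambda>N. (1 / (real N + 1))\<^sup>2) \<longlonglongrightarrow> 0\<^sup>2" by (intro tendsto_power inv_lim)
  then have "\<forall>\<^sub>F N in sequentially. (1 / (real N + 1))\<^sup>2 < (\<tau> ^ Suc e)\<^sup>2"
    by (rule order_tendstoD(2)) (use \<tau> in simp)
  then have base: "\<forall>\<^sub>F N in sequentially. 2 * (\<integral>x. (t N x)\<^sup>2 \<partial>M) \<le> ((8 * \<tau>) ^ Suc e)\<^sup>2"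
  proof eventually_elim
    case (elim N)
    have "(t N x)\<^sup>2 \<le> 2 * (h x)\<^sup>2 + 2 * (1 / (real N + 1))\<^sup>2" for x
    proof -
      have "\<bar>t N x\<bar> \<le> h x + 1 / (real N + 1)"
        unfolding t_def by (rule order_trans[OF abs_truncate_le(1) g_abs]) simp
      then have "(t N x)\<^sup>2 \<le> (h x + 1 / (real N + 1))\<^sup>2"
        by (simp add: abs_le_square_iff[symmetric])
      also have "\<dots> \<le> 2 * (h x)\<^sup>2 + 2 * (1 / (real N + 1))\<^sup>2"
        using zero_le_power2[of "h x - 1 / (real N + 1)"] by (simp add: power2_sum power2_diff)
      finally show ?thesis .
    qed
    then have "(\<integral>x. (t N x)\<^sup>2 \<partial>M) \<le> (\<integral>x. 2 * (h x)\<^sup>2 + 2 * (1 / (real N + 1))\<^sup>2 \<partial>M)"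
      using h2(1) by (intro integral_mono') auto
    also have "\<dots> = 2 * (\<integral>x. (h x)\<^sup>2 \<partial>M) + 2 * (1 / (real N + 1))\<^sup>2"
      using h2(1) by (simp add: prob_space)
    finally have "2 * (\<integral>x. (t N x)\<^sup>2 \<partial>M) \<le> 8 * (\<tau> ^ Suc e)\<^sup>2" using h2(2) elim by linarith
    also have "\<dots> \<le> (8 ^ Suc e)\<^sup>2 * (\<tau> ^ Suc e)\<^sup>2"
    proof (rule mult_right_mono)
      have "(8::real) ^ 1 \<le> 8 ^ (2 * Suc e)" by (rule power_increasing) auto
      then show "(8::real) \<le> (8 ^ Suc e)\<^sup>2" by (simp add: power_mult[symmetric] mult.commute)
    qed simp
    also have "\<dots> = ((8 * \<tau>) ^ Suc e)\<^sup>2" by (simp add: power_mult_distrib)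
    finally show ?case .
  qed
  have "even_moments M \<tau> h (Suc e)"
  proof (rule even_moments_step[OF M P \<tau> t'(1,3) _ t'(2) _ mom _ base])
    show "0 \<le> op_norm n (Suc k) f x" for x by (rule op_norm_nonneg[OF n])
    show "op_norm n (Suc k) f \<in> borel_measurable M" by (rule borel_measurable_op_norm[OF M n f])
    show "(\<lambda>N. t N x) \<longlonglongrightarrow> h x" for x unfolding t_def by (rule tendsto_truncate[OF g_lim])
  qed
  then show ?thesis by (simp add: h_def)
qed

text \<open>There is no L^2 hypothesis on f. The start of the induction comes from the Poincare
  inequality for the truncations of f together with the vanishing mean.\<close>

lemma even_moments_centered:
  assumes M: "borel_prob_on G M" and n: "1 \<le> n"
    and P: "poincare_C1 n G M (\<tau>\<^sup>2)" and \<tau>: "0 < \<tau>"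
    and f: "C_diff n (Suc 0) G f" and int: "integrable M f" "(\<integral>x. f x \<partial>M) = 0"
    and mom: "even_moments M \<tau> (op_norm n (Suc 0) f) e"
  shows "even_moments M \<tau> f (Suc e)"
proof -
  interpret prob_space M using M by (simp add: borel_prob_on_def)
  define H where "H = op_norm n (Suc 0) f"
  have Hm: "H \<in> borel_measurable M" unfolding H_def by (rule borel_measurable_op_norm[OF M n f])
  have H0: "0 \<le> H x" for x unfolding H_def by (rule op_norm_nonneg[OF n])
  have grad: "(\<Sum>i<n. (partial_deriv i f x)\<^sup>2) \<le> (H x)\<^sup>2" for x
  proof -
    \<comment> \<open>For k = 0 the only multi-index is \<open>[]\<close>, so the form is f itself
      and its gradient that of f.\<close>
    have "{is. length is = 0 \<and> set is \<subseteq> {..<n}} = {[]}" by auto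
    then show ?thesis
      using gradient_deriv_form_le[of "\<lambda>_ _. 0" n 0 f x] unfolding H_def by (simp add: unit_tuples_def)
  qed
  define t where "t N x = truncate (1 / (real N + 1)) (f x)" for N x
  have "\<exists>t'. has_partials n G (t N) t' \<and> (\<forall>x\<in>G. (\<Sum>i<n. (t' i x)\<^sup>2) \<le> (H x)\<^sup>2) \<and> bounded (t N ` G)" for N
    unfolding t_def[abs_def]
    by (rule has_partials_truncate[OF C_diff_Suc_imp_has_partials[OF f] grad, of "1 / (real N + 1)"]) auto
  then obtain t' where t': "\<And>N. has_partials n G (t N) (t' N)"
    "\<And>N x. x \<in> G \<Longrightarrow> (\<Sum>i<n. (t' N i x)\<^sup>2) \<le> (H x)\<^sup>2" "\<And>N. bounded (t N ` G)" by metis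
  have t_lim: "(\<lambda>N. t N x) \<longlonglongrightarrow> f x" for x
    unfolding t_def by (rule tendsto_truncate[OF tendsto_const])
  have tm: "t N \<in> borel_measurable M" for N
    by (rule borel_measurable_borel_prob_on[OF M has_partialsD(1)[OF t'(1)]])
  \<comment> \<open>Truncation may destroy the vanishing mean; dominated convergence restores it in
    the limit.\<close>
  have "(\<lambda>N. \<integral>x. t N x \<partial>M) \<longlonglongrightarrow> (\<integral>x. f x \<partial>M)"
  proof (rule integral_dominated_convergence[where w = "\<lambda>x. \<bar>f x\<bar>"])
    show "AE x in M. norm (t N x) \<le> \<bar>f x\<bar>" for N
      unfolding t_def real_norm_def by (intro AE_I2 abs_truncate_le) simp
  qed (use int tm t_lim in auto)
  then have "(\<lambda>N. (\<integral>x. t N x \<partial>M)\<^sup>2) \<longlonglongrightarrow> 0\<^sup>2" unfolding int(2) by (rule tendsto_power)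
  \<comment> \<open>X bounds the variance of \<open>t N\<close>. Once the squared mean is below X as
    well, twice the second moment is below 4 X \<le> 64 X = ((8 \<tau>)^(e+1))^2.\<close>
  define X where "X = \<tau>\<^sup>2 * ((8 * \<tau>) ^ e)\<^sup>2"
  have X: "0 < X" using \<tau> by (simp add: X_def)
  have "\<forall>\<^sub>F N in sequentially. (\<integral>x. t N x \<partial>M)\<^sup>2 < X"
    using \<open>_ \<longlonglongrightarrow> 0\<^sup>2\<close> X by (intro order_tendstoD(2)) auto
  then have base: "\<forall>\<^sub>F N in sequentially. 2 * (\<integral>x. (t N x)\<^sup>2 \<partial>M) \<le> ((8 * \<tau>) ^ Suc e)\<^sup>2"
  proof eventually_elim
    case (elim N)
    have m1: "(1 :: nat) \<le> 1" by simp
    note H2 = even_moments_integrable[OF mom[folded H_def] Hm \<tau> m1]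
    have intH: "integrable M (\<lambda>x. (H x)\<^sup>2)" and H2': "(\<integral>x. (H x)\<^sup>2 \<partial>M) \<le> ((8 * \<tau>) ^ e)\<^sup>2"
      using H2 by (simp_all add: mult.commute)
    have "Var M (t N) \<le> \<tau>\<^sup>2 * (\<integral>x. (H x)\<^sup>2 \<partial>M)"
      using P t' intH unfolding poincare_C1_def by blast
    also have "\<dots> \<le> X" unfolding X_def using H2' by (intro mult_left_mono) auto
    finally have "2 * (\<integral>x. (t N x)\<^sup>2 \<partial>M) \<le> 64 * X" using elim X unfolding Var_def by linarith
    also have "\<dots> = ((8 * \<tau>) ^ Suc e)\<^sup>2" by (simp add: X_def power_mult_distrib)
    finally show ?case .
  qed
  show ?thesis
    by (rule even_moments_step[OF M P \<tau> t'(1,3) H0 t'(2) Hm mom[folded H_def] t_lim base])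
qed

section \<open>The norm hypotheses as moment bounds, and the theorem\<close>

lemma nn_integral_sq_le_of_Lp_norm_2:
  assumes "Lp_norm M 2 h \<le> ennreal c" "0 \<le> c"
  shows "(\<integral>\<^sup>+x. ennreal ((h x)\<^sup>2) \<partial>M) \<le> ennreal (c\<^sup>2)"
proof -
  define I where "I = (\<integral>\<^sup>+x. ennreal ((h x)\<^sup>2) \<partial>M)"
  have sq: "\<bar>y\<bar> powr 2 = y\<^sup>2" for y :: real by (cases "y = 0") auto
  have L: "(if I = \<infinity> then \<infinity> else ennreal (enn2real I powr (1 / 2))) \<le> ennreal c"
    using assms(1) unfolding Lp_norm_def Let_def I_def sq .
  then have fin: "I \<noteq> \<infinity>" by (auto simp: top_unique)
  then have "sqrt (enn2real I) \<le> c" using L assms(2) by (simp add: powr_half_sqrt)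
  then have "enn2real I \<le> c\<^sup>2" by (rule sqrt_le_D)
  then have "ennreal (enn2real I) \<le> ennreal (c\<^sup>2)" by (rule ennreal_leI)
  then show ?thesis using fin by (simp add: I_def ennreal_enn2real_if)
qed

text \<open>|h| is at most its essential supremum almost everywhere, and e = 0 makes the right side
  1. This starts the descent at order d.\<close>

lemma even_moments_0:
  assumes "prob_space M" "Linf_norm M h \<le> 1"
  shows "even_moments M \<tau> h 0"
  unfolding even_moments_def
proof (intro allI impI)
  interpret prob_space M by fact
  fix m :: nat assume m: "1 \<le> m"
  have "AE x in M. ennreal \<bar>h x\<bar> \<le> 1"
    using esssup_AE[of "\<lambda>x. ennreal \<bar>h x\<bar>" M] assms(2)[unfolded Linf_norm_def]
    by (elim eventually_mono) (rule order_trans)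
  then have "AE x in M. ennreal (h x ^ 2 ^ m) \<le> 1"
  proof eventually_elim
    case (elim x)
    then have "\<bar>h x\<bar> ^ 2 ^ m \<le> 1" by (intro power_le_one) auto
    moreover have "\<bar>h x\<bar> ^ 2 ^ m = h x ^ 2 ^ m" using m by (intro power_even_abs) auto
    ultimately show ?case by simp
  qed
  then have "(\<integral>\<^sup>+x. ennreal (h x ^ 2 ^ m) \<partial>M) \<le> (\<integral>\<^sup>+x. 1 \<partial>M)" by (rule nn_integral_mono_AE)
  then show "(\<integral>\<^sup>+x. ennreal (h x ^ 2 ^ m) \<partial>M) \<le> ennreal (((4 * \<tau> * 2 ^ m) ^ 0) ^ 2 ^ m)"
    by (simp add: emeasure_space_1)
qed

theorem theorem1p1:
  shows "\<exists>c::real. c > 0 \<and>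
    (\<forall>(n::nat) (d::nat) (G :: (nat \<Rightarrow> real) set) (M :: (nat \<Rightarrow> real) measure)
       (\<sigma>::real) (f :: (nat \<Rightarrow> real) \<Rightarrow> real).
      n \<ge> 1 \<longrightarrow> d \<ge> 1 \<longrightarrow>
      openin (Euclidean_space n) G \<longrightarrow>
      borel_prob_on G M \<longrightarrow>
      \<sigma> > 0 \<longrightarrow>
      poincare_ineq n G M (\<sigma>\<^sup>2) \<longrightarrow>
      C_diff n d G f \<longrightarrow>
      integrable M f \<longrightarrow> (\<integral>x. f x \<partial>M) = 0 \<longrightarrow>
      (\<forall>k\<in>{1..<d}. op_norm_Lp n M 2 k f \<le> ennreal (\<sigma> ^ (d - k))) \<longrightarrow>
      op_norm_Linf n M d f \<le> 1 \<longrightarrow>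
      (\<integral>\<^sup>+x. ennreal (exp (c / \<sigma> * \<bar>f x\<bar> powr (1 / real d))) \<partial>M) \<le> 2)"
proof (intro exI[of _ "1 / 144"] conjI allI impI)
  fix n d :: nat and G :: "(nat \<Rightarrow> real) set" and M :: "(nat \<Rightarrow> real) measure"
    and \<sigma> :: real and f :: "(nat \<Rightarrow> real) \<Rightarrow> real"
  assume n: "1 \<le> n" and d: "1 \<le> d" and G: "openin (Euclidean_space n) G" and M: "borel_prob_on G M"
    and \<sigma>: "0 < \<sigma>" and P: "poincare_ineq n G M (\<sigma>\<^sup>2)" and f: "C_diff n d G f"
    and int: "integrable M f" "(\<integral>x. f x \<partial>M) = 0"
    and L2: "\<forall>k\<in>{1..<d}. op_norm_Lp n M 2 k f \<le> ennreal (\<sigma> ^ (d - k))"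
    and Linf: "op_norm_Linf n M d f \<le> 1"
  interpret prob_space M using M by (simp add: borel_prob_on_def)
  \<comment> \<open>\<open>poincare_ineq_imp_C1\<close> gives the constant 2 \<sigma>^2 \<le> (2
    \<sigma>)^2. As \<sigma> \<le> \<tau>, the norm hypotheses persist with \<tau>, and 72 \<tau> =
    144 \<sigma>.\<close>
  define \<tau> where "\<tau> = 2 * \<sigma>"
  have \<tau>: "0 < \<tau>" using \<sigma> by (simp add: \<tau>_def)
  have P1: "poincare_C1 n G M (\<tau>\<^sup>2)"
    unfolding poincare_C1_def
  proof (intro allI impI)
    fix w w' K
    assume w: "has_partials n G w w'" "bounded (w ` G)" "integrable M K" "\<forall>x\<in>G. (\<Sum>i<n. (w' i x)\<^sup>2) \<le> K x"
    have "Var M w \<le> 2 * \<sigma>\<^sup>2 * (\<integral>x. K x \<partial>M)"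
      using poincare_ineq_imp_C1[OF G M P] w unfolding poincare_C1_def by simp
    also have "\<dots> \<le> \<tau>\<^sup>2 * (\<integral>x. K x \<partial>M)"
    proof (rule mult_right_mono)
      show "0 \<le> (\<integral>x. K x \<partial>M)"
      proof (rule Bochner_Integration.integral_nonneg_AE, rule AE_I2)
        fix x assume "x \<in> space M"
        then have "x \<in> G" using M by (simp add: borel_prob_on_def)
        then show "0 \<le> K x" using w(4) by (meson order_trans sum_nonneg zero_le_power2)
      qed
    qed (simp add: \<tau>_def power_mult_distrib)
    finally show "Var M w \<le> \<tau>\<^sup>2 * (\<integral>x. K x \<partial>M)" .
  qed
  \<comment> \<open>e = d - k counts the levels below d. The induction stops at k = 1, where the
    norm hypotheses end and \<open>even_moments_centered\<close> takes over.\<close>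
  have "even_moments M \<tau> (op_norm n (d - e) f) e" if "e < d" for e
    using that
  proof (induction e)
    case 0
    then show ?case using even_moments_0[OF prob_space_axioms] Linf by (simp add: op_norm_Linf_def)
  next
    case (Suc e)
    define k where "k = d - Suc e"
    have k: "1 \<le> k" "Suc k = d - e" "k \<in> {1..<d}" "d - k = Suc e" "Suc k \<le> d" using Suc.prems by (auto simp: k_def)
    have "even_moments M \<tau> (op_norm n k f) (Suc e)"
    proof (rule even_moments_deriv[OF M n P1 \<tau> C_diff_le[OF f k(5)] k(1)])
      show "even_moments M \<tau> (op_norm n (Suc k) f) e" unfolding k(2) by (rule Suc.IH) (use Suc.prems in simp)
      have "Lp_norm M 2 (op_norm n k f) \<le> ennreal (\<sigma> ^ Suc e)"
        using L2 k(3) unfolding op_norm_Lp_def k(4)[symmetric] by blast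
      then have "(\<integral>\<^sup>+x. ennreal ((op_norm n k f x)\<^sup>2) \<partial>M) \<le> ennreal ((\<sigma> ^ Suc e)\<^sup>2)"
        by (rule nn_integral_sq_le_of_Lp_norm_2) (use \<sigma> in simp)
      also have "\<dots> \<le> ennreal ((\<tau> ^ Suc e)\<^sup>2)"
        using \<sigma> by (intro ennreal_leI power_mono) (auto simp: \<tau>_def)
      finally show "(\<integral>\<^sup>+x. ennreal ((op_norm n k f x)\<^sup>2) \<partial>M) \<le> ennreal ((\<tau> ^ Suc e)\<^sup>2)" .
    qed
    then show ?case by (simp add: k_def)
  qed
  from this[of "d - 1"] d have "even_moments M \<tau> (op_norm n (Suc 0) f) (d - 1)" by simp
  from even_moments_centered[OF M n P1 \<tau> C_diff_le[OF f] int this] d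
  have "even_moments M \<tau> f d" by simp
  then have "(\<integral>\<^sup>+x. ennreal (exp (1 / (72 * \<tau>) * \<bar>f x\<bar> powr (1 / real d))) \<partial>M) \<le> 2"
    using int(1) by (intro exp_integral_le_2[OF prob_space_axioms _ d \<tau>]) auto
  then show "(\<integral>\<^sup>+x. ennreal (exp (1 / 144 / \<sigma> * \<bar>f x\<bar> powr (1 / real d))) \<partial>M) \<le> 2"
    by (simp add: \<tau>_def)
qed simp

end
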